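(* Let $K_2$ be the field generated over $\mathbb{Q}$ by the polynomials $S_{ijk}$ ($0\le i<j<k\le n$) expressing the squares of the areas of the $2$-faces of an $n$-simplex through the squares $s_{ij}$ of its edge lengths. (1) If $n\ge 5$, then every element $s_{ij}s_{kl}$ (with $i\ne j$, $k\ne l$; in particular, every element $s_{ij}^2$) belongs to $K_2$, but none of the elements $s_{ij}$ belongs to $K_2$. (2) If $n=4$, then for all $i\neq j$ the degree of the minimal polynomial of $s_{ij}$ over $K_2$ is equal to $64$.
   Context: Let $\ell_{ij}=\ell_{ji}$, $0\le i<j\le n$, be $\binom{n+1}{2}$ independent variables over $\mathbb{Q}$ (the edge lengths of an $n$-simplex with vertices $p_0,\dots,p_n$), and put $s_{ij}=\ell_{ij}^2$. For pairwise distinct $i,j,k$ put $$S_{ijk}=\tfrac1{16}\left(2s_{ij}s_{jk}+2s_{jk}s_{ki}+2s_{ki}s_{ij}-s_{ij}^2-s_{jk}^2-s_{ki}^2\right)$$ (the square of the area of the $2$-face $p_ip_jp_k$). $K_2=\mathbb{Q}(S_{ijk}:0\le i<j<k\le n)$ is a subfield of the field of rational functions $\mathbb{Q}(\ell_{ij})$. *)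

theory Defs
  imports
    "HOL-Algebra.Algebraic_Closure_Type"
    "HOL-Algebra.Generated_Fields"
    "HOL-Algebra.Finite_Extensions"
    "HOL-Library.Poly_Mapping"
    "HOL-Library.Nat_Bijection"
begin

text \<open>Rational functions over the rationals in countably many independent variables
  indexed by \<^typ>\<open>nat\<close>: fractions of polynomials, a polynomial being a finitely supported
  map from monomials (finitely supported exponent maps) to coefficients.\<close>

type_synonym ratfun = "((nat \<Rightarrow>\<^sub>0 nat) \<Rightarrow>\<^sub>0 rat) fract"

definition variable :: "nat \<Rightarrow> ratfun" where
  "variable v = Fract (Poly_Mapping.single (Poly_Mapping.single v 1) 1) 1"

text \<open>The variable of the edge \<open>p\<^sub>i p\<^sub>j\<close> is numbered by \<^term>\<open>set_encode {i, j}\<close>. Since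
  \<^const>\<open>set_encode\<close> is injective on finite sets, \<open>edge_len i j = edge_len j i\<close> and distinct
  edges get distinct (hence independent) variables. The value at \<open>i = j\<close> has no meaning
  and is never used.\<close>

definition edge_len :: "nat \<Rightarrow> nat \<Rightarrow> ratfun" where
  "edge_len i j = variable (set_encode {i, j})"

definition edge_sq :: "nat \<Rightarrow> nat \<Rightarrow> ratfun" where
  "edge_sq i j = edge_len i j ^ 2"

definition area_sq :: "nat \<Rightarrow> nat \<Rightarrow> nat \<Rightarrow> ratfun" where
  "area_sq i j k = (1 / 16) *
     (2 * edge_sq i j * edge_sq j k + 2 * edge_sq j k * edge_sq k i + 2 * edge_sq k i * edge_sq i j
      - edge_sq i j ^ 2 - edge_sq j k ^ 2 - edge_sq k i ^ 2)"

text \<open>\<open>edge_field n\<close> is the field of rational functions over the rationals in the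
  edge lengths of an \<open>n\<close>-simplex only. A field generated by a set always contains the
  prime field, which is the rationals here, so no constants have to be adjoined.\<close>

definition edge_field :: "nat \<Rightarrow> ratfun ring" where
  "edge_field n = ring_of_type_algebra
     \<lparr>carrier := generate_field ring_of_type_algebra {edge_len i j |i j. i < j \<and> j \<le> n}\<rparr>"

definition K2 :: "nat \<Rightarrow> ratfun set" where
  "K2 n = generate_field (edge_field n) {area_sq i j k |i j k. i < j \<and> j < k \<and> k \<le> n}"

instance fract :: ("{idom, ring_char_0}") ring_char_0
  by standard (auto simp: inj_def of_nat_fract eq_fract)

lemma single_one_inject:
  assumes "Poly_Mapping.single a (1 :: 'b :: zero_neq_one) = Poly_Mapping.single b 1"
  shows "a = b"
  using arg_cong[OF assms, of Poly_Mapping.keys] by simp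

lemma edge_len_eq_iff: "edge_len i j = edge_len k l \<longleftrightarrow> {i, j} = {k, l}"
proof
  assume "edge_len i j = edge_len k l"
  then have "Poly_Mapping.single (Poly_Mapping.single (set_encode {i, j}) (1 :: nat)) (1 :: rat)
      = Poly_Mapping.single (Poly_Mapping.single (set_encode {k, l}) 1) 1"
    unfolding edge_len_def variable_def
    by (simp only: eq_fract one_neq_zero mult_1_right not_False_eq_True)
  then have "set_encode {i, j} = set_encode {k, l}"
    by (rule single_one_inject[OF single_one_inject])
  then show "{i, j} = {k, l}"
    by (simp only: set_encode_eq finite_insert finite.emptyI)
next
  assume "{i, j} = {k, l}"
  then show "edge_len i j = edge_len k l"
    by (simp only: edge_len_def)
qed

lemma field_edge_field: "field (edge_field n)"
proof -
  interpret field "ring_of_type_algebra :: ratfun ring"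
    by (rule field_from_type_algebra)
  show ?thesis unfolding edge_field_def
    by (intro subfield_iff(2) generate_field_is_subfield) (simp add: ring_of_type_algebra_def)
qed

lemma edge_len_carrier:
  assumes "i \<noteq> j" "i \<le> n" "j \<le> n"
  shows "edge_len i j \<in> carrier (edge_field n)"
proof -
  have *: "edge_len i j \<in> carrier (edge_field n)" if "i < j" "j \<le> n" for i j
    using that by (auto simp: edge_field_def intro: generate_field.incl)
  have "edge_len j i = edge_len i j"
    by (simp add: edge_len_eq_iff insert_commute)
  then show ?thesis
    using *[of i j] *[of j i] assms by (cases "i < j") auto
qed

lemma edge_sq_carrier:
  assumes "i \<noteq> j" "i \<le> n" "j \<le> n"
  shows "edge_sq i j \<in> carrier (edge_field n)"
proof -
  interpret field "edge_field n" by (rule field_edge_field)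
  have "edge_sq i j = edge_len i j \<otimes>\<^bsub>edge_field n\<^esub> edge_len i j"
    by (simp add: edge_sq_def edge_field_def ring_of_type_algebra_def power2_eq_square)
  then show ?thesis
    using edge_len_carrier[OF assms] by simp
qed

lemma area_sq_carrier:
  assumes "i < j" "j < k" "k \<le> n"
  shows "area_sq i j k \<in> carrier (edge_field n)"
proof -
  let ?R = "ring_of_type_algebra :: ratfun ring"
  let ?C = "carrier (edge_field n)"
  interpret R: field ?R by (rule field_from_type_algebra)
  have "subfield ?C ?R"
    using R.generate_field_is_subfield[of "{edge_len i j |i j. i < j \<and> j \<le> n}"]
    by (simp add: edge_field_def ring_of_type_algebra_def)
  note C = subfieldE(1)[OF this]
  have add: "x + y \<in> ?C" and mult: "x * y \<in> ?C" if "x \<in> ?C" "y \<in> ?C" for x y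
    using subringE(7)[OF C that] subringE(6)[OF C that]
    by (simp_all add: ring_of_type_algebra_def)
  have one: "1 \<in> ?C"
    using subringE(3)[OF C] by (simp add: ring_of_type_algebra_def)
  have uminus: "- x \<in> ?C" if "x \<in> ?C" for x
  proof -
    have "\<ominus>\<^bsub>?R\<^esub> x \<in> ?C"
      by (rule subringE(5)[OF C that])
    moreover have "\<ominus>\<^bsub>?R\<^esub> x = - x"
      by (rule R.minus_equality) (auto simp: ring_of_type_algebra_def)
    ultimately show ?thesis by simp
  qed
  have diff: "x - y \<in> ?C" if "x \<in> ?C" "y \<in> ?C" for x y
    using add[OF that(1) uminus[OF that(2)]] by simp
  have num: "of_nat m \<in> ?C" for m
    by (induction m) (use add one diff[OF one one] in simp_all)
  have "16 \<in> ?C" using num[of 16] by simp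
  then have "inv\<^bsub>?R\<^esub> 16 \<in> ?C"
    unfolding edge_field_def
    by (simp add: generate_field.m_inv ring_of_type_algebra_def)
  moreover have "inv\<^bsub>?R\<^esub> 16 = 1 / 16"
    by (rule R.comm_inv_char) (auto simp: ring_of_type_algebra_def)
  ultimately have "1 / 16 \<in> ?C" by simp
  moreover have "2 \<in> ?C" using num[of 2] by simp
  ultimately show ?thesis
    using assms unfolding area_sq_def power2_eq_square
    by (intro add diff mult edge_sq_carrier) auto
qed

lemma subfield_K2: "subfield (K2 n) (edge_field n)"
proof -
  interpret field "edge_field n" by (rule field_edge_field)
  show ?thesis unfolding K2_def
    by (rule generate_field_is_subfield) (auto intro: area_sq_carrier)
qed

end

theory Submission
  imports Defs "HOL-Analysis.Analysis"
begin

text \<open>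
  The squared areas are specialised to complex numbers. Write a configuration as a symmetric function
  \<open>x\<close> on pairs of vertices, standing for the values of the \<open>s\<^sub>i\<^sub>j\<close>; its face \<open>ijk\<close> is the number
  \<open>heron (x i j) (x j k) (x k i)\<close>, which is \<open>16\<close> times the specialised squared area. Three facts link
  fields to configurations (\<open>generic_config\<close>, \<open>same_areas_root\<close>, \<open>conjugate_configs\<close>). Arbitrarily close to any
  configuration \<open>c\<close> there is the image \<open>s\<close> of the \<open>s\<^sub>i\<^sub>j\<close> under an embedding into the complex numbers
  of a field that contains all edge lengths. If \<open>y\<close> is any configuration with the same faces as such an \<open>s\<close>,
  then \<open>y a b\<close> is a root of every polynomial over \<open>K\<^sub>2\<close> that \<open>s\<^sub>a\<^sub>b\<close> satisfies, and conversely an element whose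
  degree over \<open>K\<^sub>2\<close> is at least \<open>m\<close> takes \<open>m\<close> different values on such configurations, each
  coming from another embedding. Degrees over \<open>K\<^sub>2\<close> thus become counts of the configurations that share their
  faces with a generic \<open>s\<close>, and these counts may be done near one convenient \<open>c\<close>.

  Take \<open>s\<close> close to the regular simplex, where all entries are \<open>1\<close> and all faces are \<open>3\<close>. A sequence of
  configurations whose faces tend to \<open>3\<close> need not converge, but on each tetrahedron the four almost equal
  faces force linear relations between the entries of every (rescaled) limit: this is \<open>tet_limit\<close>. On
  five points those relations leave only the configurations with entries \<open>b\<close> and \<open>3b\<close> and those with entries
  \<open>\<plusminus>b\<close> (\<open>classify_complex\<close>). Hence the sequence is bounded and its limits belong to an explicit finite list:
  up to sign, entry \<open>3\<close> on one of the 26 matchings of the complete graph on five vertices and \<open>1\<close> elsewhere,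
  and, with \<open>\<omega>\<^sup>2 = - 3/5\<close>, the value \<open>\<omega>\<close> on one 5-cycle and \<open>-\<omega>\<close> on the complementary one, which leaves 12 choices.
  This gives \<open>2 * 26 + 12 = 64\<close> points, and at each of them the derivative of the face map is injective
  (\<open>nondegenerate_point\<close>). Injectivity near each point bounds the number of configurations by 64. Invariance of
  domain produces one configuration near each point for all faces close to \<open>3\<close>. To see that their entries on a
  given edge are different, the faces are moved in a direction in which the 64 pairs of
  an entry and its first derivative are different (\<open>points_distinct\<close>).

  On six points the limits have entries \<open>\<plusminus>1\<close> and \<open>\<plusminus>3\<close> only, because a two-colouring of the edges of the complete
  graph on six vertices contains a monochromatic triangle. If some entry is \<open>\<plusminus>3\<close>, then the system of the first
  order is overdetermined, and it is contradictory when \<open>s\<close> leaves the regular simplex in a suitable direction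
  (\<open>first_order_obstruction\<close>). Only the limits \<open>\<plusminus>1\<close> remain, so \<open>s\<close> is determined by its faces up to a global sign.
  That sign does not change products of two entries, which therefore lie in \<open>K\<^sub>2\<close>. It does
  change the entries, so that no \<open>s\<^sub>i\<^sub>j\<close> lies in \<open>K\<^sub>2\<close>.
\<close>

section \<open>Homomorphisms on subrings of a field\<close>

text \<open>
  Subrings are handled as sets inside one ambient field, because the proof extends homomorphisms along chains of
  subrings of the field of rational functions.
\<close>

definition closed_ring :: "'a::field set \<Rightarrow> bool" where
  "closed_ring R \<longleftrightarrow> 1 \<in> R \<and> (\<forall>a\<in>R. \<forall>b\<in>R. a + b \<in> R \<and> a * b \<in> R) \<and> (\<forall>a\<in>R. - a \<in> R)"

definition closed_field :: "'a::field set \<Rightarrow> bool" where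
  "closed_field K \<longleftrightarrow> closed_ring K \<and> (\<forall>a\<in>K. inverse a \<in> K)"

definition hom_on :: "'a::field set \<Rightarrow> ('a \<Rightarrow> 'b::field) \<Rightarrow> bool" where
  "hom_on R \<psi> \<longleftrightarrow> \<psi> 1 = 1 \<and> (\<forall>a\<in>R. \<forall>b\<in>R. \<psi> (a + b) = \<psi> a + \<psi> b \<and> \<psi> (a * b) = \<psi> a * \<psi> b)"

definition polys_over :: "'a::field set \<Rightarrow> 'a poly set" where
  "polys_over R = {p. \<forall>i. coeff p i \<in> R}"

definition adjoin :: "'a::field set \<Rightarrow> 'a \<Rightarrow> 'a set" where
  "adjoin R x = (\<lambda>q. poly q x) ` polys_over R"

definition quotients :: "'a::field set \<Rightarrow> 'a set" where
  "quotients R = {a / b |a b. a \<in> R \<and> b \<in> R \<and> b \<noteq> 0}"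

lemma closed_ringD:
  assumes "closed_ring R"
  shows "1 \<in> R" "a \<in> R \<Longrightarrow> b \<in> R \<Longrightarrow> a + b \<in> R" "a \<in> R \<Longrightarrow> b \<in> R \<Longrightarrow> a * b \<in> R"
    "a \<in> R \<Longrightarrow> - a \<in> R" "0 \<in> R" "a \<in> R \<Longrightarrow> b \<in> R \<Longrightarrow> a - b \<in> R"
proof -
  show 1: "1 \<in> R" and 2: "\<And>a b. a \<in> R \<Longrightarrow> b \<in> R \<Longrightarrow> a + b \<in> R"
    and "a \<in> R \<Longrightarrow> b \<in> R \<Longrightarrow> a * b \<in> R" and 3: "\<And>a. a \<in> R \<Longrightarrow> - a \<in> R"
    using assms by (auto simp: closed_ring_def)
  show "0 \<in> R" using 2[OF 1 3[OF 1]] by simp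
  show "a \<in> R \<Longrightarrow> b \<in> R \<Longrightarrow> a - b \<in> R" using 2[OF _ 3, of a b] by simp
qed

lemma closed_ring_sum:
  assumes "closed_ring R" "\<And>i. i \<in> I \<Longrightarrow> f i \<in> R"
  shows "sum f I \<in> R"
  using assms(2) by (induction I rule: infinite_finite_induct) (auto intro: closed_ringD[OF assms(1)])

lemma closed_ring_power: "closed_ring R \<Longrightarrow> a \<in> R \<Longrightarrow> a ^ k \<in> R"
  by (induction k) (auto intro: closed_ringD)

lemma closed_ring_of_nat: "closed_ring R \<Longrightarrow> of_nat k \<in> R"
  by (induction k) (auto intro: closed_ringD)

lemma closed_ring_numeral: "closed_ring R \<Longrightarrow> numeral k \<in> R"
  using closed_ring_of_nat[of R "numeral k"] by simp

lemma closed_fieldD: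
  assumes "closed_field K"
  shows "closed_ring K" "a \<in> K \<Longrightarrow> inverse a \<in> K" "a \<in> K \<Longrightarrow> b \<in> K \<Longrightarrow> a / b \<in> K"
  using assms by (auto simp: closed_field_def divide_inverse intro: closed_ringD)

lemma hom_onD:
  assumes "hom_on R \<psi>" "closed_ring R"
  shows "\<psi> 1 = 1" "a \<in> R \<Longrightarrow> b \<in> R \<Longrightarrow> \<psi> (a + b) = \<psi> a + \<psi> b"
    "a \<in> R \<Longrightarrow> b \<in> R \<Longrightarrow> \<psi> (a * b) = \<psi> a * \<psi> b" "\<psi> 0 = 0"
    "a \<in> R \<Longrightarrow> \<psi> (- a) = - \<psi> a" "a \<in> R \<Longrightarrow> b \<in> R \<Longrightarrow> \<psi> (a - b) = \<psi> a - \<psi> b"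
proof -
  show "\<psi> 1 = 1" and 2: "\<And>a b. a \<in> R \<Longrightarrow> b \<in> R \<Longrightarrow> \<psi> (a + b) = \<psi> a + \<psi> b"
    and "a \<in> R \<Longrightarrow> b \<in> R \<Longrightarrow> \<psi> (a * b) = \<psi> a * \<psi> b"
    using assms by (auto simp: hom_on_def)
  show 0: "\<psi> 0 = 0" using 2[of 0 0] closed_ringD(5)[OF assms(2)] by (metis add_0 add_cancel_right_right)
  show 3: "\<psi> (- a) = - \<psi> a" if "a \<in> R" for a
    using 2[of a "- a"] that 0 closed_ringD(4)[OF assms(2)] by (simp add: eq_neg_iff_add_eq_0 add.commute)
  show "a \<in> R \<Longrightarrow> b \<in> R \<Longrightarrow> \<psi> (a - b) = \<psi> a - \<psi> b"
    using 2[of a "- b"] 3[of b] closed_ringD(4)[OF assms(2)] by simp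
qed

lemma hom_on_subset: "hom_on R \<psi> \<Longrightarrow> S \<subseteq> R \<Longrightarrow> hom_on S \<psi>"
  by (auto simp: hom_on_def)

lemma hom_on_sum:
  assumes "hom_on R \<psi>" "closed_ring R" "\<And>i. i \<in> I \<Longrightarrow> f i \<in> R"
  shows "\<psi> (sum f I) = (\<Sum>i\<in>I. \<psi> (f i))"
  using assms(3)
  by (induction I rule: infinite_finite_induct)
     (auto simp: hom_onD[OF assms(1,2)] closed_ring_sum[OF assms(2)])

lemma hom_on_power:
  assumes "hom_on R \<psi>" "closed_ring R" "a \<in> R"
  shows "\<psi> (a ^ k) = \<psi> a ^ k"
  by (induction k) (auto simp: hom_onD[OF assms(1,2)] closed_ring_power assms)

lemma hom_on_numeral:
  assumes "hom_on R \<psi>" "closed_ring R"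
  shows "\<psi> (numeral k) = numeral k"
proof -
  have "\<psi> (of_nat m) = of_nat m" for m
    by (induction m) (auto simp: hom_onD[OF assms] closed_ring_of_nat[OF assms(2)] closed_ringD[OF assms(2)])
  from this[of "numeral k"] show ?thesis by simp
qed

lemma hom_on_inverse:
  assumes "hom_on K \<psi>" "closed_field K" "a \<in> K"
  shows "\<psi> (inverse a) = inverse (\<psi> a)"
proof (cases "a = 0")
  case True
  then show ?thesis using hom_onD(4)[OF assms(1) closed_fieldD(1)[OF assms(2)]] by simp
next
  case False
  then have "\<psi> a * \<psi> (inverse a) = 1"
    using hom_onD(1,3)[OF assms(1) closed_fieldD(1)[OF assms(2)]] closed_fieldD(2)[OF assms(2)] assms(3)
    by (metis right_inverse)
  then show ?thesis by (simp add: inverse_unique)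
qed

lemma hom_on_nonzero:
  assumes "hom_on K \<psi>" "closed_field K" "a \<in> K" "\<psi> a = 0"
  shows "a = 0"
proof (rule ccontr)
  assume "a \<noteq> 0"
  then have "\<psi> a * \<psi> (inverse a) = 1"
    using hom_onD(1,3)[OF assms(1) closed_fieldD(1)[OF assms(2)]] closed_fieldD(2)[OF assms(2)] assms(3)
    by (metis right_inverse)
  with assms(4) show False by simp
qed

lemma polys_over_coeff: "p \<in> polys_over R \<Longrightarrow> coeff p i \<in> R"
  by (simp add: polys_over_def)

lemma polys_over_closed:
  assumes R: "closed_ring R"
  shows "0 \<in> polys_over R" "1 \<in> polys_over R" "c \<in> R \<Longrightarrow> [:c:] \<in> polys_over R"
    "c \<in> R \<Longrightarrow> p \<in> polys_over R \<Longrightarrow> pCons c p \<in> polys_over R"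
    "c \<in> R \<Longrightarrow> monom c k \<in> polys_over R"
    "p \<in> polys_over R \<Longrightarrow> q \<in> polys_over R \<Longrightarrow> p + q \<in> polys_over R"
    "p \<in> polys_over R \<Longrightarrow> q \<in> polys_over R \<Longrightarrow> p - q \<in> polys_over R"
    "p \<in> polys_over R \<Longrightarrow> - p \<in> polys_over R"
    "c \<in> R \<Longrightarrow> p \<in> polys_over R \<Longrightarrow> smult c p \<in> polys_over R"
    "p \<in> polys_over R \<Longrightarrow> q \<in> polys_over R \<Longrightarrow> p * q \<in> polys_over R"
    "p \<in> polys_over R \<Longrightarrow> pderiv p \<in> polys_over R"
  using closed_ringD[OF R] closed_ring_of_nat[OF R]
  by (auto simp: polys_over_def coeff_pCons coeff_1 coeff_mult coeff_pderiv split: nat.split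
      intro!: closed_ring_sum[OF R] simp del: of_nat_Suc)

lemma map_poly_hom:
  assumes \<psi>: "hom_on R \<psi>" "closed_ring R" and pq: "p \<in> polys_over R" "q \<in> polys_over R"
  shows "map_poly \<psi> (p + q) = map_poly \<psi> p + map_poly \<psi> q"
    "map_poly \<psi> (p - q) = map_poly \<psi> p - map_poly \<psi> q"
    "map_poly \<psi> (- p) = - map_poly \<psi> p"
    "map_poly \<psi> (p * q) = map_poly \<psi> p * map_poly \<psi> q"
    "map_poly \<psi> (pderiv p) = pderiv (map_poly \<psi> p)"
proof -
  note h = hom_onD[OF \<psi>]
  note c = pq[THEN polys_over_coeff]
  show "map_poly \<psi> (p + q) = map_poly \<psi> p + map_poly \<psi> q"
    by (intro poly_eqI) (simp add: coeff_map_poly h c)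
  show "map_poly \<psi> (p - q) = map_poly \<psi> p - map_poly \<psi> q"
    by (intro poly_eqI) (simp add: coeff_map_poly h c)
  show "map_poly \<psi> (- p) = - map_poly \<psi> p"
    by (intro poly_eqI) (simp add: coeff_map_poly h c)
  show "map_poly \<psi> (p * q) = map_poly \<psi> p * map_poly \<psi> q"
    by (intro poly_eqI)
      (simp add: coeff_map_poly coeff_mult h c hom_on_sum[OF \<psi>] closed_ringD[OF \<psi>(2)])
  have "\<psi> (of_nat m) = of_nat m" for m
    by (induction m) (auto simp: h closed_ring_of_nat[OF \<psi>(2)] closed_ringD[OF \<psi>(2)])
  then show "map_poly \<psi> (pderiv p) = pderiv (map_poly \<psi> p)"
    by (intro poly_eqI)
      (simp add: coeff_map_poly coeff_pderiv h c closed_ring_of_nat[OF \<psi>(2)] del: of_nat_Suc)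
qed

lemma closed_ring_adjoin:
  assumes "closed_ring R"
  shows "closed_ring (adjoin R x)" "R \<subseteq> adjoin R x" "x \<in> adjoin R x"
proof -
  note c = polys_over_closed[OF assms]
  show "closed_ring (adjoin R x)"
    unfolding closed_ring_def adjoin_def
  proof (intro conjI ballI; (elim imageE)?; hypsubst?)
    show "1 \<in> (\<lambda>q. poly q x) ` polys_over R" by (rule image_eqI[of _ _ 1]) (auto intro: c)
    fix p q assume pq: "p \<in> polys_over R" "q \<in> polys_over R"
    then show "poly p x + poly q x \<in> (\<lambda>q. poly q x) ` polys_over R"
      by (intro image_eqI[of _ _ "p + q"]) (auto intro: c)
    from pq show "poly p x * poly q x \<in> (\<lambda>q. poly q x) ` polys_over R"
      by (intro image_eqI[of _ _ "p * q"]) (auto intro: c)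
  next
    fix p assume "p \<in> polys_over R"
    then show "- poly p x \<in> (\<lambda>q. poly q x) ` polys_over R"
      by (intro image_eqI[of _ _ "- p"]) (auto intro: c)
  qed
  show "R \<subseteq> adjoin R x"
  proof
    fix a assume "a \<in> R"
    then show "a \<in> adjoin R x" unfolding adjoin_def by (intro image_eqI[of _ _ "[:a:]"]) (auto intro: c)
  qed
  show "x \<in> adjoin R x"
    unfolding adjoin_def by (intro image_eqI[of _ _ "[:0, 1:]"]) (auto intro!: c closed_ringD[OF assms])
qed

text \<open>
  The value of a polynomial expression in \<open>x\<close> does not depend on the polynomial that represents it,
  since the difference of two representatives vanishes at \<open>x\<close> and so, by hypothesis, its image
  vanishes at \<open>\<rho>\<close>.
\<close>

lemma extend_hom_adjoin:
  fixes \<psi> :: "'a::field \<Rightarrow> 'b::field"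
  assumes R: "closed_ring R" and \<psi>: "hom_on R \<psi>"
    and root: "\<And>q. q \<in> polys_over R \<Longrightarrow> poly q x = 0 \<Longrightarrow> poly (map_poly \<psi> q) \<rho> = 0"
  shows "\<exists>\<psi>'. hom_on (adjoin R x) \<psi>' \<and> (\<forall>q\<in>polys_over R. \<psi>' (poly q x) = poly (map_poly \<psi> q) \<rho>) \<and>
           (\<forall>a\<in>R. \<psi>' a = \<psi> a) \<and> \<psi>' x = \<rho>"
proof -
  define \<psi>' where "\<psi>' y = poly (map_poly \<psi> (SOME q. q \<in> polys_over R \<and> poly q x = y)) \<rho>" for y
  note c = polys_over_closed[OF R]
  note h = map_poly_hom[OF \<psi> R]
  have eq: "\<psi>' (poly q x) = poly (map_poly \<psi> q) \<rho>" if q: "q \<in> polys_over R" for q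
  proof -
    let ?q = "SOME q'. q' \<in> polys_over R \<and> poly q' x = poly q x"
    have *: "?q \<in> polys_over R \<and> poly ?q x = poly q x"
      by (rule someI[of _ q]) (use q in simp)
    then have "poly (map_poly \<psi> (?q - q)) \<rho> = 0"
      by (intro root c) (use q in auto)
    then show ?thesis using * q by (simp add: h \<psi>'_def)
  qed
  have 1: "\<psi>' 1 = 1" using eq[OF c(2)] hom_onD(1)[OF \<psi> R] by (simp add: map_poly_1)
  have "hom_on (adjoin R x) \<psi>'"
    unfolding hom_on_def adjoin_def
  proof (intro conjI ballI; (elim imageE)?; hypsubst?)
    fix p q assume "p \<in> polys_over R" "q \<in> polys_over R"
    then show "\<psi>' (poly p x + poly q x) = \<psi>' (poly p x) + \<psi>' (poly q x)"
      "\<psi>' (poly p x * poly q x) = \<psi>' (poly p x) * \<psi>' (poly q x)"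
      using eq[of "p + q"] eq[of "p * q"] eq[of p] eq[of q] by (simp_all add: c h)
  qed (rule 1)
  moreover have "\<psi>' a = \<psi> a" if "a \<in> R" for a
    using eq[OF c(3)[OF that]] by (simp add: map_poly_pCons hom_onD(4)[OF \<psi> R])
  moreover have "\<psi>' x = \<rho>"
    using eq[OF c(4)[OF closed_ringD(5)[OF R] c(2)]]
    by (simp add: map_poly_pCons map_poly_1 hom_onD[OF \<psi> R])
  ultimately show ?thesis using eq by blast
qed

lemma closed_field_quotients:
  assumes R: "closed_ring R"
  shows "closed_field (quotients R)" "R \<subseteq> quotients R"
proof -
  note c = closed_ringD[OF R]
  have *: "a / b \<in> quotients R" if "a \<in> R" "b \<in> R" "b \<noteq> 0" for a b
    using that by (auto simp: quotients_def)
  have one: "1 \<in> quotients R" using *[of 1 1] c by simp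
  show "closed_field (quotients R)"
    unfolding closed_field_def closed_ring_def
  proof (intro conjI ballI, goal_cases)
    case (2 u v)
    then obtain a b d e where "u = a / b" "v = d / e" "a \<in> R" "b \<in> R" "d \<in> R" "e \<in> R" "b \<noteq> 0" "e \<noteq> 0"
      by (auto simp: quotients_def)
    then show ?case using *[of "a * e + d * b" "b * e"] c by (simp add: add_frac_eq)
  next
    case (3 u v)
    then obtain a b d e where "u = a / b" "v = d / e" "a \<in> R" "b \<in> R" "d \<in> R" "e \<in> R" "b \<noteq> 0" "e \<noteq> 0"
      by (auto simp: quotients_def)
    then show ?case using *[of "a * d" "b * e"] c by simp
  next
    case (4 u)
    then obtain a b where "u = a / b" "a \<in> R" "b \<in> R" "b \<noteq> 0"
      by (auto simp: quotients_def)
    then show ?case using *[of "- a" b] c by simp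
  next
    case (5 u)
    then obtain a b where "u = a / b" "a \<in> R" "b \<in> R" "b \<noteq> 0"
      by (auto simp: quotients_def)
    then show ?case using *[of b a] *[of 0 1] c by (cases "a = 0") simp_all
  qed (rule one)
  show "R \<subseteq> quotients R" using *[of _ 1] c by auto
qed

lemma extend_hom_quotients:
  fixes \<psi> :: "'a::field \<Rightarrow> 'b::field"
  assumes R: "closed_ring R" and \<psi>: "hom_on R \<psi>" and inj: "\<And>a. a \<in> R \<Longrightarrow> \<psi> a = 0 \<Longrightarrow> a = 0"
  shows "\<exists>\<psi>'. hom_on (quotients R) \<psi>' \<and> (\<forall>a\<in>R. \<psi>' a = \<psi> a)"
proof -
  note c = closed_ringD[OF R]
  note h = hom_onD[OF \<psi> R]
  let ?P = "\<lambda>y (a, b). a \<in> R \<and> b \<in> R \<and> b \<noteq> 0 \<and> y = a / b"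
  define \<psi>' where "\<psi>' y = (case SOME ab. ?P y ab of (a, b) \<Rightarrow> \<psi> a / \<psi> b)" for y
  have eq: "\<psi>' (a / b) = \<psi> a / \<psi> b" if ab: "a \<in> R" "b \<in> R" "b \<noteq> 0" for a b
  proof -
    have "?P (a / b) (SOME ab. ?P (a / b) ab)"
      by (rule someI[of _ "(a, b)"]) (use ab in simp)
    then obtain d e where de: "(SOME ab. ?P (a / b) ab) = (d, e)" "d \<in> R" "e \<in> R" "e \<noteq> 0" "a / b = d / e"
      by (cases "SOME ab. ?P (a / b) ab") auto
    then have "a * e = d * b" using ab by (simp add: frac_eq_eq)
    then have "\<psi> a * \<psi> e = \<psi> d * \<psi> b" using h(3) ab de by metis
    moreover have "\<psi> b \<noteq> 0" "\<psi> e \<noteq> 0" using inj ab de by auto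
    ultimately show ?thesis using de by (simp add: \<psi>'_def frac_eq_eq)
  qed
  have on_R: "\<psi>' a = \<psi> a" if "a \<in> R" for a using eq[of a 1] that c h by simp
  have "hom_on (quotients R) \<psi>'"
    unfolding hom_on_def
  proof (intro conjI ballI, goal_cases)
    case 1 show ?case using on_R c h by simp
  next
    case (2 u v)
    then obtain a b d e where *: "u = a / b" "v = d / e" "a \<in> R" "b \<in> R" "d \<in> R" "e \<in> R" "b \<noteq> 0" "e \<noteq> 0"
      by (auto simp: quotients_def)
    moreover have "\<psi> b \<noteq> 0" "\<psi> e \<noteq> 0" using inj * by auto
    ultimately show ?case using eq[of "a * e + d * b" "b * e"] c eq[of a b] eq[of d e]
      by (simp add: add_frac_eq h)
  next
    case (3 u v)
    then obtain a b d e where *: "u = a / b" "v = d / e" "a \<in> R" "b \<in> R" "d \<in> R" "e \<in> R" "b \<noteq> 0" "e \<noteq> 0"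
      by (auto simp: quotients_def)
    then show ?case using eq[of "a * d" "b * e"] c eq[of a b] eq[of d e] by (simp add: h)
  qed
  then show ?thesis using on_R by blast
qed

lemma polys_over_division:
  assumes K: "closed_field K" and q: "q \<in> polys_over K" "q \<noteq> 0" and p: "p \<in> polys_over K"
  shows "\<exists>h r. h \<in> polys_over K \<and> r \<in> polys_over K \<and> p = q * h + r \<and>
    (r = 0 \<or> Polynomial.degree r < Polynomial.degree q)"
  using p
proof (induction "Polynomial.degree p" arbitrary: p rule: less_induct)
  case less
  note R = closed_fieldD(1)[OF K]
  note c = polys_over_closed[OF R]
  show ?case
  proof (cases "p = 0 \<or> Polynomial.degree p < Polynomial.degree q")
    case True
    then show ?thesis using less(2) c(1) by (intro exI[of _ 0] exI[of _ p]) auto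
  next
    case False
    define m where "m = monom (lead_coeff p / lead_coeff q) (Polynomial.degree p - Polynomial.degree q)"
    have m: "m \<in> polys_over K"
      using less(2) q(1) unfolding m_def by (intro c closed_fieldD(3)[OF K] polys_over_coeff)
    define p' where "p' = p - q * m"
    have p': "p' \<in> polys_over K" unfolding p'_def using less(2) m q(1) by (intro c)
    have m0: "m \<noteq> 0" using False q(2) by (simp add: m_def)
    have deg: "Polynomial.degree (q * m) = Polynomial.degree p"
      using q(2) m0 False by (simp add: degree_mult_eq m_def degree_monom_eq)
    have lc: "lead_coeff (q * m) = lead_coeff p"
      using q(2) False by (simp add: lead_coeff_mult m_def degree_monom_eq)
    show ?thesis
    proof (cases "p' = 0")
      case True
      then show ?thesis using m c(1) by (intro exI[of _ m] exI[of _ 0]) (simp add: p'_def)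
    next
      case False
      have "Polynomial.degree p' \<le> Polynomial.degree p"
        unfolding p'_def using deg by (intro degree_diff_le) auto
      moreover have "coeff p' (Polynomial.degree p) = 0"
        using deg lc by (simp add: p'_def)
      ultimately have "Polynomial.degree p' < Polynomial.degree p"
        using False by (metis leading_coeff_0_iff nat_less_le)
      from less(1)[OF this p'] obtain h r where
        "h \<in> polys_over K" "r \<in> polys_over K" "p' = q * h + r" "r = 0 \<or> Polynomial.degree r < Polynomial.degree q"
        by blast
      then show ?thesis using m
        by (intro exI[of _ "m + h"] exI[of _ r]) (auto simp: p'_def algebra_simps intro: c)
    qed
  qed
qed

section \<open>Conjugates in the complex numbers\<close>

lemma card_roots_rsquarefree:
  fixes p :: "complex poly"
  assumes "rsquarefree p"
  shows "card {z. poly p z = 0} = Polynomial.degree p"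
proof -
  have p0: "p \<noteq> 0" using assms by (simp add: rsquarefree_def)
  have "Polynomial.degree p = Polynomial.degree (\<Prod>z | poly p z = 0. [:- z, 1:])"
    by (subst complex_poly_decompose_rsquarefree[OF assms, symmetric]) (use p0 in simp)
  also have "\<dots> = (\<Sum>z | poly p z = 0. Polynomial.degree [:- z, 1:])"
    by (rule degree_prod_eq_sum_degree) simp
  finally show ?thesis by simp
qed

lemma countable_polys_over:
  assumes "countable R" "0 \<in> R"
  shows "countable (polys_over R)"
proof (rule countable_subset)
  show "polys_over R \<subseteq> Poly ` lists R"
  proof
    fix p assume "p \<in> polys_over R"
    then have "coeffs p \<in> lists R" by (auto simp: polys_over_def coeffs_def)
    then show "p \<in> Poly ` lists R" by (intro image_eqI[of _ _ "coeffs p"]) auto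
  qed
  show "countable (Poly ` lists R)" using assms by auto
qed

text \<open>
  Each nonzero polynomial over a countable ring has finitely many roots, so almost every complex number is
  transcendental over the image of a countable field. This is what leaves room for generic specialisations.
\<close>

lemma countable_roots:
  fixes \<psi> :: "'a::field \<Rightarrow> complex"
  assumes R: "closed_ring R" "countable R" and \<psi>: "hom_on R \<psi>"
    and inj: "\<And>a. a \<in> R \<Longrightarrow> \<psi> a = 0 \<Longrightarrow> a = 0"
  shows "countable (\<Union>q \<in> polys_over R - {0}. {\<rho>. poly (map_poly \<psi> q) \<rho> = 0})"
proof (rule countable_UN)
  show "countable (polys_over R - {0})"
    using countable_polys_over[OF R(2)] closed_ringD(5)[OF R(1)] by auto
  fix q assume q: "q \<in> polys_over R - {0}"
  then have "\<psi> (lead_coeff q) \<noteq> 0" using inj polys_over_coeff by fastforce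
  then have "map_poly \<psi> q \<noteq> 0"
    using coeff_map_poly[of \<psi> q "Polynomial.degree q"] hom_onD(4)[OF \<psi> R(1)] by auto
  then show "countable {\<rho>. poly (map_poly \<psi> q) \<rho> = 0}"
    by (intro countable_finite poly_roots_finite)
qed

text \<open>
  The values that an extension of \<open>\<psi>\<close> may give to \<open>x\<close>. For transcendental
  \<open>x\<close> these are the numbers that are transcendental over the image of \<open>\<psi>\<close>.
\<close>

definition conjugate :: "'a::field set \<Rightarrow> ('a \<Rightarrow> complex) \<Rightarrow> 'a \<Rightarrow> complex \<Rightarrow> bool" where
  "conjugate K \<psi> x \<rho> \<longleftrightarrow> (\<forall>q\<in>polys_over K. poly q x = 0 \<longleftrightarrow> poly (map_poly \<psi> q) \<rho> = 0)"

text \<open>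
  Division with remainder by the polynomial of least degree: the remainder is zero as soon as \<open>x\<close>
  or \<open>\<rho>\<close> is a root, in the second case because the minimal polynomial is irreducible.
\<close>

lemma root_is_conjugate:
  fixes \<psi> :: "'a::field \<Rightarrow> complex"
  assumes K: "closed_field K" and \<psi>: "hom_on K \<psi>"
    and p: "p \<in> polys_over K" "p \<noteq> 0" "poly p x = 0"
    and min: "\<And>q. q \<in> polys_over K \<Longrightarrow> q \<noteq> 0 \<Longrightarrow> poly q x = 0 \<Longrightarrow> Polynomial.degree p \<le> Polynomial.degree q"
    and root: "poly (map_poly \<psi> p) \<rho> = 0"
  shows "conjugate K \<psi> x \<rho>"
proof -
  note R = closed_fieldD(1)[OF K]
  note h = map_poly_hom[OF \<psi> R]
  define Q where "Q = {q \<in> polys_over K. q \<noteq> 0 \<and> poly (map_poly \<psi> q) \<rho> = 0}"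
  have "p \<in> Q" using p root by (simp add: Q_def)
  then obtain q0 where q0: "q0 \<in> Q" and q0_min: "\<And>q. q \<in> Q \<Longrightarrow> Polynomial.degree q0 \<le> Polynomial.degree q"
    using ex_has_least_nat[of "\<lambda>q. q \<in> Q" p Polynomial.degree] by blast
  have dvd: "q0 dvd q" if q: "q \<in> polys_over K" "poly (map_poly \<psi> q) \<rho> = 0" for q
  proof -
    obtain f r where fr: "f \<in> polys_over K" "r \<in> polys_over K" "q = q0 * f + r"
      "r = 0 \<or> Polynomial.degree r < Polynomial.degree q0"
      using polys_over_division[OF K _ _ q(1), of q0] q0 by (auto simp: Q_def)
    have "poly (map_poly \<psi> r) \<rho> = 0"
      using q fr q0 polys_over_closed(10)[OF R, of q0 f] by (simp add: h Q_def)
    then have "r \<in> Q" if "r \<noteq> 0" using fr that by (simp add: Q_def)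
    then have "r = 0" using fr(4) q0_min[of r] by fastforce
    then show ?thesis using fr by simp
  qed
  obtain f where f: "p = q0 * f" using dvd[OF p(1) root] by (auto elim: dvdE)
  have f0: "f \<noteq> 0" "q0 \<noteq> 0" using f p(2) by auto
  have "Polynomial.degree q0 \<noteq> 0"
  proof
    assume "Polynomial.degree q0 = 0"
    then obtain c where c: "q0 = [:c:]" by (rule degree_eq_zeroE)
    have "c \<in> K" using q0 polys_over_coeff[of q0 K 0] by (simp add: Q_def c)
    moreover have "\<psi> c = 0"
      using q0 hom_onD(4)[OF \<psi> R] by (simp add: Q_def c map_poly_pCons)
    ultimately have "c = 0" by (rule hom_on_nonzero[OF \<psi> K])
    then show False using f0 c by simp
  qed
  have "poly q0 x = 0"
  proof (rule ccontr)
    assume *: "poly q0 x \<noteq> 0"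
    then have fx: "poly f x = 0" using f p(3) by simp
    obtain f' r where fr: "f' \<in> polys_over K" "r \<in> polys_over K" "p = q0 * f' + r"
      "r = 0 \<or> Polynomial.degree r < Polynomial.degree q0"
      using polys_over_division[OF K _ _ p(1), of q0] q0 by (auto simp: Q_def)
    have "q0 * (f - f') = r" using fr f by (simp add: algebra_simps)
    moreover have "Polynomial.degree q0 \<le> Polynomial.degree (q0 * (f - f'))" if "f \<noteq> f'"
      using that f0 by (simp add: degree_mult_eq)
    ultimately have "f = f'" using fr(4) f0 by fastforce
    then have "Polynomial.degree p \<le> Polynomial.degree f" using min fx fr(1) f0 by blast
    also have "\<dots> < Polynomial.degree p"
      using f f0 \<open>Polynomial.degree q0 \<noteq> 0\<close> by (simp add: degree_mult_eq)
    finally show False by simp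
  qed
  then have *: "poly q x = 0" if "q \<in> polys_over K" "poly (map_poly \<psi> q) \<rho> = 0" for q
    using dvd[OF that] by (auto elim: dvdE)
  have "poly (map_poly \<psi> q) \<rho> = 0" if q: "q \<in> polys_over K" "poly q x = 0" for q
  proof -
    obtain f r where fr: "f \<in> polys_over K" "r \<in> polys_over K" "q = p * f + r"
      "r = 0 \<or> Polynomial.degree r < Polynomial.degree p"
      using polys_over_division[OF K p(1,2) q(1)] by blast
    have "poly r x = 0" using fr(3) q(2) p(3) by simp
    then have "r = 0" using fr min by fastforce
    then show ?thesis using fr p(1) root by (simp add: h)
  qed
  then show ?thesis using * by (auto simp: conjugate_def)
qed

text \<open>
  In characteristic 0 a polynomial of least degree is prime to its derivative, so its image has as many roots as
  its degree. If there is no such polynomial, then all but countably many numbers are conjugates.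
\<close>

lemma many_conjugates:
  fixes \<psi> :: "'a::field_char_0 \<Rightarrow> complex"
  assumes K: "closed_field K" "countable K" and \<psi>: "hom_on K \<psi>"
    and low: "\<And>q. q \<in> polys_over K \<Longrightarrow> q \<noteq> 0 \<Longrightarrow> poly q x = 0 \<Longrightarrow> m \<le> Polynomial.degree q"
  shows "\<exists>\<rho>s. finite \<rho>s \<and> card \<rho>s = m \<and> (\<forall>\<rho>\<in>\<rho>s. conjugate K \<psi> x \<rho>)"
proof -
  note R = closed_fieldD(1)[OF K(1)]
  note h = map_poly_hom[OF \<psi> R]
  note inj = hom_on_nonzero[OF \<psi> K(1)]
  have "infinite {\<rho>. conjugate K \<psi> x \<rho>} \<or> m \<le> card {\<rho>. conjugate K \<psi> x \<rho>}"
  proof (cases "\<exists>p. p \<in> polys_over K \<and> p \<noteq> 0 \<and> poly p x = 0")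
    case True
    then obtain p where p: "p \<in> polys_over K" "p \<noteq> 0" "poly p x = 0"
      and min: "\<And>q. q \<in> polys_over K \<Longrightarrow> q \<noteq> 0 \<Longrightarrow> poly q x = 0 \<Longrightarrow> Polynomial.degree p \<le> Polynomial.degree q"
      using ex_has_least_nat[of "\<lambda>q. q \<in> polys_over K \<and> q \<noteq> 0 \<and> poly q x = 0" _ Polynomial.degree] by metis
    have conj: "conjugate K \<psi> x \<rho>" if "poly (map_poly \<psi> p) \<rho> = 0" for \<rho>
      using root_is_conjugate[OF K(1) \<psi> p] min that by blast
    define P where "P = map_poly \<psi> p"
    have lc: "\<psi> (lead_coeff p) \<noteq> 0" using inj p polys_over_coeff by fastforce
    then have P0: "P \<noteq> 0"
      using coeff_map_poly[of \<psi> p "Polynomial.degree p"] hom_onD(4)[OF \<psi> R] by (auto simp: P_def)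
    have deg: "Polynomial.degree P = Polynomial.degree p"
      unfolding P_def using lc hom_onD(4)[OF \<psi> R]
      by (intro antisym degree_le le_degree) (auto simp: coeff_map_poly coeff_eq_0)
    have "Polynomial.degree p \<noteq> 0"
      using p(2,3) by (metis degree_eq_zeroE poly_const_conv pCons_0_0)
    then have p': "pderiv p \<noteq> 0" "Polynomial.degree (pderiv p) < Polynomial.degree p"
      by (auto simp: pderiv_eq_0_iff degree_pderiv)
    have "rsquarefree P"
      unfolding rsquarefree_roots
    proof (intro allI notI, elim conjE)
      fix \<rho> assume \<rho>: "poly P \<rho> = 0" "poly (pderiv P) \<rho> = 0"
      have "pderiv p \<in> polys_over K" using polys_over_closed(11)[OF R] p by simp
      moreover have "poly (map_poly \<psi> (pderiv p)) \<rho> = 0" using \<rho>(2) h(5)[OF p(1,1)] by (simp add: P_def)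
      ultimately have "poly (pderiv p) x = 0"
        using conj[OF \<rho>(1)[unfolded P_def]] by (auto simp: conjugate_def)
      then show False using min[of "pderiv p"] p' \<open>pderiv p \<in> polys_over K\<close> by simp
    qed
    then have "m \<le> card {z. poly P z = 0}"
      using card_roots_rsquarefree deg low[OF p] by simp
    moreover have "{z. poly P z = 0} \<subseteq> {\<rho>. conjugate K \<psi> x \<rho>}" using conj by (auto simp: P_def)
    ultimately show ?thesis by (meson card_mono le_trans)
  next
    case False
    define B where "B = (\<Union>q \<in> polys_over K - {0}. {\<rho>. poly (map_poly \<psi> q) \<rho> = 0})"
    have "countable B" unfolding B_def by (rule countable_roots[OF R K(2) \<psi> inj])
    moreover have "conjugate K \<psi> x \<rho>" if "\<rho> \<notin> B" for \<rho>
      using that False hom_onD(4)[OF \<psi> R] by (auto simp: conjugate_def B_def)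
    then have "UNIV - B \<subseteq> {\<rho>. conjugate K \<psi> x \<rho>}" by blast
    moreover have "uncountable (UNIV - B)"
      using calculation(1) uncountable_UNIV_complex by (intro uncountable_minus_countable)
    ultimately have "infinite {\<rho>. conjugate K \<psi> x \<rho>}"
      using countable_finite countable_subset by blast
    then show ?thesis ..
  qed
  then obtain \<rho>s where "finite \<rho>s" "card \<rho>s = m" "\<rho>s \<subseteq> {\<rho>. conjugate K \<psi> x \<rho>}"
    by (elim disjE obtain_subset_with_card_n) (auto dest: infinite_arbitrarily_large[of _ m])
  then show ?thesis by blast
qed

lemma countable_adjoin: "countable R \<Longrightarrow> closed_ring R \<Longrightarrow> countable (adjoin R x)"
  unfolding adjoin_def using countable_polys_over closed_ringD(5) by blast

lemma countable_quotients: "countable R \<Longrightarrow> countable (quotients R)"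
proof -
  assume "countable R"
  then have "countable ((\<lambda>(a, b). a / b) ` (R \<times> R))" by auto
  moreover have "quotients R \<subseteq> (\<lambda>(a, b). a / b) ` (R \<times> R)" by (auto simp: quotients_def)
  ultimately show ?thesis by (rule countable_subset[rotated])
qed

lemma extend_hom_conjugate:
  fixes \<psi> :: "'a::field \<Rightarrow> complex"
  assumes K: "closed_field K" "countable K" and \<psi>: "hom_on K \<psi>" and \<rho>: "conjugate K \<psi> x \<rho>"
  shows "\<exists>K' \<psi>'. closed_field K' \<and> countable K' \<and> hom_on K' \<psi>' \<and> K \<subseteq> K' \<and> x \<in> K' \<and>
    K' \<subseteq> quotients (adjoin K x) \<and> (\<forall>a\<in>K. \<psi>' a = \<psi> a) \<and> \<psi>' x = \<rho>"
proof -
  note R = closed_fieldD(1)[OF K(1)]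
  obtain \<psi>1 where \<psi>1: "hom_on (adjoin K x) \<psi>1" "\<And>q. q \<in> polys_over K \<Longrightarrow> \<psi>1 (poly q x) = poly (map_poly \<psi> q) \<rho>"
    "\<And>a. a \<in> K \<Longrightarrow> \<psi>1 a = \<psi> a" "\<psi>1 x = \<rho>"
    using extend_hom_adjoin[OF R \<psi>, of x \<rho>] \<rho> by (auto simp: conjugate_def)
  note R1 = closed_ring_adjoin[OF R]
  have "a = 0" if "a \<in> adjoin K x" "\<psi>1 a = 0" for a
    using that \<rho> \<psi>1(2) by (auto simp: adjoin_def conjugate_def)
  then obtain \<psi>' where \<psi>': "hom_on (quotients (adjoin K x)) \<psi>'" "\<And>a. a \<in> adjoin K x \<Longrightarrow> \<psi>' a = \<psi>1 a"
    using extend_hom_quotients[OF R1(1) \<psi>1(1)] by blast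
  show ?thesis
  proof (intro exI conjI)
    show "closed_field (quotients (adjoin K x))" by (rule closed_field_quotients[OF R1(1)])
    show "countable (quotients (adjoin K x))"
      by (intro countable_quotients countable_adjoin K R)
    show "K \<subseteq> quotients (adjoin K x)" "x \<in> quotients (adjoin K x)"
      using closed_field_quotients(2)[OF R1(1)] R1 by blast+
    show "\<forall>a\<in>K. \<psi>' a = \<psi> a" "\<psi>' x = \<rho>" using \<psi>' \<psi>1 R1(2,3) by (auto simp: subset_iff)
  qed (use \<psi>' in auto)
qed

text \<open>
  Any finite set of further elements can be added to the domain of a homomorphism, because every element has a
  conjugate.
\<close>

lemma extend_hom_list:
  fixes \<psi> :: "'a::field_char_0 \<Rightarrow> complex"
  assumes "closed_field K" "countable K" "hom_on K \<psi>"
  shows "\<exists>K' \<psi>'. closed_field K' \<and> hom_on K' \<psi>' \<and> K \<subseteq> K' \<and> set xs \<subseteq> K' \<and> (\<forall>a\<in>K. \<psi>' a = \<psi> a)"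
  using assms
proof (induction xs arbitrary: K \<psi>)
  case Nil
  then show ?case by auto
next
  case (Cons x xs)
  have "1 \<le> Polynomial.degree q" if "q \<in> polys_over K" "q \<noteq> 0" "poly q x = 0" for q
    using that by (cases "Polynomial.degree q") (auto elim!: degree_eq_zeroE)
  from many_conjugates[OF Cons.prems, of x 1, OF this] obtain \<rho> where "conjugate K \<psi> x \<rho>"
    by (metis card_1_singletonE insertI1)
  from extend_hom_conjugate[OF Cons.prems this] obtain K1 \<psi>1 where
    1: "closed_field K1" "countable K1" "hom_on K1 \<psi>1" "K \<subseteq> K1" "x \<in> K1" "\<And>a. a \<in> K \<Longrightarrow> \<psi>1 a = \<psi> a"
    by blast
  from Cons.IH[OF 1(1-3)] obtain K' \<psi>' where
    "closed_field K'" "hom_on K' \<psi>'" "K1 \<subseteq> K'" "set xs \<subseteq> K'" "\<And>a. a \<in> K1 \<Longrightarrow> \<psi>' a = \<psi>1 a"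
    by blast
  with 1 show ?case by (intro exI[of _ K'] exI[of _ \<psi>']) auto
qed

section \<open>Rational functions and specialisations\<close>

instance fract :: ("{idom, ring_char_0}") field_char_0 ..

definition polys_in :: "nat set \<Rightarrow> ((nat \<Rightarrow>\<^sub>0 nat) \<Rightarrow>\<^sub>0 rat) set" where
  "polys_in V = {p. \<forall>m\<in>Poly_Mapping.keys p. Poly_Mapping.keys m \<subseteq> V}"

definition ratfuns_in :: "nat set \<Rightarrow> ratfun set" where
  "ratfuns_in V = {Fract p q |p q. p \<in> polys_in V \<and> q \<in> polys_in V \<and> q \<noteq> 0}"

lemma polys_in_closed:
  "0 \<in> polys_in V" "1 \<in> polys_in V"
  "p \<in> polys_in V \<Longrightarrow> q \<in> polys_in V \<Longrightarrow> p + q \<in> polys_in V"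
  "p \<in> polys_in V \<Longrightarrow> q \<in> polys_in V \<Longrightarrow> p * q \<in> polys_in V"
  "p \<in> polys_in V \<Longrightarrow> - p \<in> polys_in V"
proof -
  show "0 \<in> polys_in V" "1 \<in> polys_in V" by (auto simp: polys_in_def)
  show "p \<in> polys_in V \<Longrightarrow> q \<in> polys_in V \<Longrightarrow> p + q \<in> polys_in V"
    using Poly_Mapping.keys_add[of p q] by (fastforce simp: polys_in_def)
  show "p * q \<in> polys_in V" if "p \<in> polys_in V" "q \<in> polys_in V"
    unfolding polys_in_def
  proof (intro CollectI ballI)
    fix m assume "m \<in> Poly_Mapping.keys (p * q)"
    then obtain a b where "m = a + b" "a \<in> Poly_Mapping.keys p" "b \<in> Poly_Mapping.keys q"
      using Poly_Mapping.keys_mult[of p q] by auto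
    then show "Poly_Mapping.keys m \<subseteq> V"
      using that Poly_Mapping.keys_add[of a b] unfolding polys_in_def by blast
  qed
  show "p \<in> polys_in V \<Longrightarrow> - p \<in> polys_in V"
    by (auto simp: polys_in_def in_keys_iff)
qed

lemma closed_field_ratfuns_in: "closed_field (ratfuns_in V)"
proof -
  have *: "Fract p q \<in> ratfuns_in V" if "p \<in> polys_in V" "q \<in> polys_in V" "q \<noteq> 0" for p q
    using that by (auto simp: ratfuns_in_def)
  note c = polys_in_closed
  show ?thesis
    unfolding closed_field_def closed_ring_def
  proof (intro conjI ballI, goal_cases)
    case 1 show ?case using *[of 1 1] c by (simp add: One_fract_def)
  next
    case (2 u v)
    then obtain p q r t where "u = Fract p q" "v = Fract r t" "p \<in> polys_in V" "q \<in> polys_in V" "q \<noteq> 0"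
      "r \<in> polys_in V" "t \<in> polys_in V" "t \<noteq> 0"
      unfolding ratfuns_in_def by blast
    then show ?case using *[of "p * t + r * q" "q * t"] c by simp
  next
    case (3 u v)
    then obtain p q r t where "u = Fract p q" "v = Fract r t" "p \<in> polys_in V" "q \<in> polys_in V" "q \<noteq> 0"
      "r \<in> polys_in V" "t \<in> polys_in V" "t \<noteq> 0"
      unfolding ratfuns_in_def by blast
    then show ?case using *[of "p * r" "q * t"] c by simp
  next
    case (4 u)
    then obtain p q where "u = Fract p q" "p \<in> polys_in V" "q \<in> polys_in V" "q \<noteq> 0"
      unfolding ratfuns_in_def by blast
    then show ?case using *[of "- p" q] c by simp
  next
    case (5 u)
    then obtain p q where u: "u = Fract p q" "p \<in> polys_in V" "q \<in> polys_in V" "q \<noteq> 0"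
      unfolding ratfuns_in_def by blast
    show ?case
    proof (cases "p = 0")
      case True
      then show ?thesis using u *[of 0 1] c by (simp add: fract_collapse)
    next
      case False
      then show ?thesis using u *[of q p] by simp
    qed
  qed
qed

lemma variable_in_ratfuns: "v \<in> V \<Longrightarrow> variable v \<in> ratfuns_in V"
  unfolding ratfuns_in_def variable_def
  by (rule CollectI, intro exI conjI, rule refl) (auto simp: polys_in_def)

lemma ratfuns_in_mono: "V \<subseteq> W \<Longrightarrow> ratfuns_in V \<subseteq> ratfuns_in W"
  unfolding ratfuns_in_def polys_in_def by blast

lemma lookup_times_single:
  fixes p :: "(nat \<Rightarrow>\<^sub>0 nat) \<Rightarrow>\<^sub>0 rat"
  shows "Poly_Mapping.lookup (p * Poly_Mapping.single a 1) (b + a) = Poly_Mapping.lookup p b"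
proof (induction p rule: update_induct)
  case const
  then show ?case by simp
next
  case (update p k c)
  have "Poly_Mapping.update k c p = p + Poly_Mapping.single k c"
    using update by (intro poly_mapping_eqI) (auto simp: lookup_update lookup_add lookup_single when_def in_keys_iff)
  with update show ?case by (simp add: algebra_simps lookup_add mult_single lookup_single when_def)
qed

lemma variable_power: "variable v ^ k = Fract (Poly_Mapping.single (Poly_Mapping.single v k) 1) 1"
  by (induction k) (auto simp: variable_def One_fract_def mult_single Poly_Mapping.single_add[symmetric])

lemma Fract_sum: "(\<Sum>i\<in>I. Fract (f i) 1) = Fract (sum f I) 1"
  by (induction I rule: infinite_finite_induct) (auto simp: Zero_fract_def)

lemma lookup_times_single_0:
  fixes p :: "(nat \<Rightarrow>\<^sub>0 nat) \<Rightarrow>\<^sub>0 rat"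
  assumes p: "p \<in> polys_in V" "v \<notin> V" and m: "Poly_Mapping.lookup m v = 0" and "i \<noteq> k"
  shows "Poly_Mapping.lookup (p * Poly_Mapping.single (Poly_Mapping.single v i) 1) (m + Poly_Mapping.single v k) = 0"
proof (rule ccontr)
  assume "\<not> ?thesis"
  then have "m + Poly_Mapping.single v k \<in> Poly_Mapping.keys (p * Poly_Mapping.single (Poly_Mapping.single v i) 1)"
    by (simp add: in_keys_iff)
  then obtain a where a: "a \<in> Poly_Mapping.keys p" "m + Poly_Mapping.single v k = a + Poly_Mapping.single v i"
    using Poly_Mapping.keys_mult[of p "Poly_Mapping.single (Poly_Mapping.single v i) 1"] by auto
  then have "v \<notin> Poly_Mapping.keys a" using p unfolding polys_in_def by blast
  then have "Poly_Mapping.lookup a v = 0" by (simp add: in_keys_iff)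
  then have "k = i" using arg_cong[OF a(2), of "\<lambda>f. Poly_Mapping.lookup f v"] m by (simp add: lookup_add)
  with assms show False by simp
qed

text \<open>
  After clearing denominators the powers of the new variable in the different terms do not interact, so all
  coefficients vanish separately.
\<close>

lemma variable_transcendental:
  assumes q: "q \<in> polys_over (ratfuns_in V)" and v: "v \<notin> V" and root: "poly q (variable v) = 0"
  shows "q = 0"
proof -
  let ?n = "Polynomial.degree q"
  have "\<forall>i. \<exists>p d. p \<in> polys_in V \<and> d \<in> polys_in V \<and> d \<noteq> 0 \<and> coeff q i = Fract p d"
    using q unfolding polys_over_def ratfuns_in_def by blast
  then obtain p d where pd: "\<And>i. p i \<in> polys_in V" "\<And>i. d i \<in> polys_in V" "\<And>i. d i \<noteq> 0" "\<And>i. coeff q i = Fract (p i) (d i)"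
    by metis
  define r where "r i = p i * (\<Prod>j\<in>{..?n} - {i}. d j)" for i
  have prod_in: "(\<Prod>j\<in>I. d j) \<in> polys_in V" for I
    by (induction I rule: infinite_finite_induct) (auto intro: polys_in_closed pd)
  then have r: "r i \<in> polys_in V" for i unfolding r_def by (intro polys_in_closed pd)
  define D where "D = (\<Prod>j\<le>?n. d j)"
  have D0: "D \<noteq> 0" unfolding D_def using pd by simp
  have rD: "Fract (r i) 1 = coeff q i * Fract D 1" if "i \<le> ?n" for i
    using that pd(3) by (simp add: r_def D_def pd(4) eq_fract prod.remove[of _ i])
  have "0 = Fract D 1 * poly q (variable v)" using root by simp
  also have "\<dots> = (\<Sum>i\<le>?n. Fract (r i) 1 * variable v ^ i)"
    by (simp add: poly_altdef sum_distrib_left rD mult_ac)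
  also have "\<dots> = Fract (\<Sum>i\<le>?n. r i * Poly_Mapping.single (Poly_Mapping.single v i) 1) 1"
    by (simp add: variable_power Fract_sum)
  finally have sum0: "(\<Sum>i\<le>?n. r i * Poly_Mapping.single (Poly_Mapping.single v i) 1) = 0"
    by (simp add: Zero_fract_def eq_fract)
  have "r k = 0" if k: "k \<le> ?n" for k
  proof (rule poly_mapping_eqI)
    fix m
    show "Poly_Mapping.lookup (r k) m = Poly_Mapping.lookup 0 m"
    proof (cases "Poly_Mapping.lookup m v = 0")
      case True
      have "0 = Poly_Mapping.lookup (\<Sum>i\<le>?n. r i * Poly_Mapping.single (Poly_Mapping.single v i) 1) (m + Poly_Mapping.single v k)"
        by (simp add: sum0)
      also have "\<dots> = (\<Sum>i\<le>?n. if i = k then Poly_Mapping.lookup (r k) m else 0)"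
        unfolding lookup_sum
        by (intro sum.cong refl) (auto simp: lookup_times_single lookup_times_single_0[OF r v True])
      finally show ?thesis using k by simp
    next
      case False
      then have "v \<in> Poly_Mapping.keys m" by (simp add: in_keys_iff)
      then have "m \<notin> Poly_Mapping.keys (r k)" using r[of k] v unfolding polys_in_def by blast
      then show ?thesis by (simp add: in_keys_iff)
    qed
  qed
  moreover have "Fract D 1 \<noteq> 0" unfolding Zero_fract_def using D0 by (subst eq_fract) auto
  moreover have "Fract 0 1 = (0 :: ratfun)" by (simp only: Zero_fract_def)
  ultimately have "coeff q k = 0" if "k \<le> ?n" for k
    using rD[OF that] that by (metis mult_eq_0_iff)
  then show ?thesis by (metis leading_coeff_0_iff order_refl)
qed

definition rationals :: "'a::field_char_0 set" where "rationals = range of_rat"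

lemma closed_field_rationals: "closed_field rationals"
  unfolding closed_field_def closed_ring_def rationals_def
proof (intro conjI ballI; (elim rangeE)?; hypsubst?)
  show "1 \<in> range of_rat" by (metis of_rat_1 rangeI)
  show "of_rat r + of_rat q \<in> range of_rat" "of_rat r * of_rat q \<in> range of_rat"
    "- of_rat r \<in> range of_rat" "inverse (of_rat r) \<in> range of_rat" for r q
    by (metis of_rat_add rangeI, metis of_rat_mult rangeI, metis of_rat_minus rangeI, metis of_rat_inverse rangeI)
qed

lemma rationals_hom: "\<exists>\<psi> :: 'a::field_char_0 \<Rightarrow> 'b::field_char_0. hom_on rationals \<psi>"
proof
  have [simp]: "inv_into UNIV of_rat (of_rat r :: 'a) = r" for r
    by (intro inv_f_f injI) simp
  show "hom_on (rationals :: 'a set) (\<lambda>x. of_rat (inv_into UNIV of_rat x) :: 'b)"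
    unfolding hom_on_def rationals_def
  proof (intro conjI ballI; (elim rangeE)?; hypsubst?)
    show "of_rat (inv_into UNIV of_rat (1 :: 'a)) = (1 :: 'b)"
      using \<open>inv_into UNIV of_rat (of_rat 1 :: 'a) = 1\<close> by simp
    fix r q
    show "of_rat (inv_into UNIV of_rat (of_rat r + of_rat q :: 'a)) = (of_rat (inv_into UNIV of_rat (of_rat r :: 'a)) + of_rat (inv_into UNIV of_rat (of_rat q :: 'a)) :: 'b)"
      by (simp only: of_rat_add[symmetric] \<open>\<And>r. inv_into UNIV of_rat (of_rat r :: 'a) = r\<close>)
    show "of_rat (inv_into UNIV of_rat (of_rat r * of_rat q :: 'a)) = (of_rat (inv_into UNIV of_rat (of_rat r :: 'a)) * of_rat (inv_into UNIV of_rat (of_rat q :: 'a)) :: 'b)"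
      by (simp only: of_rat_mult[symmetric] \<open>\<And>r. inv_into UNIV of_rat (of_rat r :: 'a) = r\<close>)
  qed
qed

lemma of_rat_in_closed_field:
  assumes K: "closed_field (K :: 'a::field_char_0 set)"
  shows "rationals \<subseteq> K"
proof -
  note R = closed_fieldD(1)[OF K]
  have *: "of_int z \<in> K" for z
    by (cases z) (auto intro: closed_ringD[OF R] closed_ring_of_nat[OF R] simp del: of_nat_Suc)
  show ?thesis
    unfolding rationals_def
  proof safe
    fix r :: rat
    obtain a b where "r = of_int a / of_int b" by (metis Rat_cases Fract_of_int_quotient)
    then show "of_rat r \<in> K" using * closed_fieldD(3)[OF K] by (simp add: of_rat_divide)
  qed
qed

text \<open>
  The variables are added one after the other. The values in a ball are uncountable and those algebraic over the
  previous field are countable, so each variable may be sent to a transcendental number close to the prescribed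
  one; the homomorphism is then injective and extends to the field.
\<close>

lemma generic_hom:
  assumes "distinct vs" "\<epsilon> > 0"
  shows "\<exists>K \<psi>. closed_field K \<and> countable K \<and> K \<subseteq> ratfuns_in (set vs) \<and> hom_on K \<psi> \<and>
           (\<forall>v\<in>set vs. variable v \<in> K \<and> cmod (\<psi> (variable v) - pt v) < \<epsilon>)"
  using assms(1)
proof (induction vs)
  case Nil
  obtain \<psi> :: "ratfun \<Rightarrow> complex" where "hom_on rationals \<psi>" using rationals_hom by blast
  then show ?case
    using of_rat_in_closed_field[OF closed_field_ratfuns_in]
    by (intro exI[of _ rationals] exI[of _ \<psi>]) (simp add: closed_field_rationals, simp add: rationals_def)
next
  case (Cons v vs)
  then obtain K \<psi> where K: "closed_field K" "countable K" "K \<subseteq> ratfuns_in (set vs)" "hom_on K \<psi>"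
    and vs: "\<And>w. w \<in> set vs \<Longrightarrow> variable w \<in> K \<and> cmod (\<psi> (variable w) - pt w) < \<epsilon>"
    by auto
  note R = closed_fieldD(1)[OF K(1)]
  define B where "B = (\<Union>q \<in> polys_over K - {0}. {\<rho>. poly (map_poly \<psi> q) \<rho> = 0})"
  have "countable B" unfolding B_def by (rule countable_roots[OF R K(2,4) hom_on_nonzero[OF K(4,1)]])
  then obtain \<rho> where \<rho>: "\<rho> \<in> ball (pt v) \<epsilon>" "\<rho> \<notin> B"
    using ball_minus_countable_nonempty[of B \<epsilon> "pt v"] assms(2) by blast
  have "q = 0" if "q \<in> polys_over K" "poly q (variable v) = 0" for q
    using variable_transcendental[of q "set vs" v] that K(3) Cons.prems by (auto simp: polys_over_def)
  then have "conjugate K \<psi> (variable v) \<rho>"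
    using \<rho>(2) hom_onD(4)[OF K(4) R] by (fastforce simp: conjugate_def B_def)
  from extend_hom_conjugate[OF K(1,2,4) this] obtain K' \<psi>' where
    K': "closed_field K'" "countable K'" "hom_on K' \<psi>'" "K \<subseteq> K'" "variable v \<in> K'"
      "K' \<subseteq> quotients (adjoin K (variable v))" "\<forall>a\<in>K. \<psi>' a = \<psi> a" "\<psi>' (variable v) = \<rho>"
    by blast
  let ?F = "ratfuns_in (set (v # vs))"
  note F = closed_field_ratfuns_in[of "set (v # vs)"]
  have "poly q (variable v) \<in> ?F" if "q \<in> polys_over K" for q
    unfolding poly_altdef
    using that K(3) ratfuns_in_mono[of "set vs" "set (v # vs)"] variable_in_ratfuns[of v "set (v # vs)"]
    by (intro closed_ring_sum closed_ringD(3) closed_ring_power closed_fieldD(1)[OF F])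
       (auto simp: polys_over_def)
  then have "quotients (adjoin K (variable v)) \<subseteq> ?F"
    using closed_fieldD(3)[OF F] by (auto simp: quotients_def adjoin_def)
  then show ?case
    using K' vs \<rho>(1)
    by (intro exI[of _ K'] exI[of _ \<psi>']) (auto simp: dist_norm norm_minus_commute)
qed

text \<open>
  An arbitrary value may be given to each variable if inverses are given up: the domain is only a ring,
  generated by the variables over the rational numbers.
\<close>

lemma evaluation_hom:
  assumes "distinct vs"
  shows "\<exists>R \<psi>. closed_ring R \<and> rationals \<subseteq> R \<and> R \<subseteq> ratfuns_in (set vs) \<and> hom_on R \<psi> \<and>
           (\<forall>v\<in>set vs. variable v \<in> R \<and> \<psi> (variable v) = (pt v :: complex))"
  using assms
proof (induction vs)
  case Nil
  obtain \<psi> :: "ratfun \<Rightarrow> complex" where "hom_on rationals \<psi>" using rationals_hom by blast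
  then show ?case
    using of_rat_in_closed_field[OF closed_field_ratfuns_in]
    by (intro exI[of _ rationals] exI[of _ \<psi>]) (auto simp: closed_fieldD[OF closed_field_rationals])
next
  case (Cons v vs)
  then obtain R \<psi> where R: "closed_ring R" "rationals \<subseteq> R" "R \<subseteq> ratfuns_in (set vs)" "hom_on R \<psi>"
    and vs: "\<And>w. w \<in> set vs \<Longrightarrow> variable w \<in> R \<and> \<psi> (variable w) = pt w"
    by auto
  have "q = 0" if "q \<in> polys_over R" "poly q (variable v) = 0" for q
    using variable_transcendental[of q "set vs" v] that R(3) Cons.prems by (auto simp: polys_over_def)
  note trans = this
  have "poly (map_poly \<psi> q) (pt v) = 0" if "q \<in> polys_over R" "poly q (variable v) = 0" for q
    using trans[OF that] by simp
  from extend_hom_adjoin[OF R(1,4) this] obtain \<psi>' where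
    \<psi>': "hom_on (adjoin R (variable v)) \<psi>'" "\<And>a. a \<in> R \<Longrightarrow> \<psi>' a = \<psi> a" "\<psi>' (variable v) = pt v"
    by blast
  let ?F = "ratfuns_in (set (v # vs))"
  note F = closed_field_ratfuns_in[of "set (v # vs)"]
  have "poly q (variable v) \<in> ?F" if "q \<in> polys_over R" for q
    unfolding poly_altdef
    using that R(3) ratfuns_in_mono[of "set vs" "set (v # vs)"] variable_in_ratfuns[of v "set (v # vs)"]
    by (intro closed_ring_sum closed_ringD(3) closed_ring_power closed_fieldD(1)[OF F])
       (auto simp: polys_over_def)
  then have "adjoin R (variable v) \<subseteq> ?F" by (auto simp: adjoin_def)
  then show ?case
    using \<psi>' vs closed_ring_adjoin[OF R(1), of "variable v"] R(2)
    by (intro exI[of _ "adjoin R (variable v)"] exI[of _ \<psi>']) (auto simp: subset_iff)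
qed

section \<open>The field of squared areas\<close>

lemma edge_field_simps:
  "x \<otimes>\<^bsub>edge_field n\<^esub> y = x * y" "x \<oplus>\<^bsub>edge_field n\<^esub> y = x + y"
  "\<one>\<^bsub>edge_field n\<^esub> = 1" "\<zero>\<^bsub>edge_field n\<^esub> = 0"
  by (simp_all add: edge_field_def ring_of_type_algebra_def)

lemma edge_field_pow: "x [^]\<^bsub>edge_field n\<^esub> (k :: nat) = x ^ k"
  by (induction k) (simp_all add: nat_pow_def edge_field_simps)

lemma edge_field_m_inv:
  assumes "h \<in> carrier (edge_field n)" "h \<noteq> 0"
  shows "inv\<^bsub>edge_field n\<^esub> h = inverse h"
proof -
  interpret E: field "edge_field n" by (rule field_edge_field)
  have "h * inv\<^bsub>edge_field n\<^esub> h = 1"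
    using E.Units_r_inv[of h] E.field_Units assms by (simp add: edge_field_simps)
  then show ?thesis by (metis inverse_unique)
qed

lemma edge_field_a_inv:
  assumes "h \<in> carrier (edge_field n)"
  shows "\<ominus>\<^bsub>edge_field n\<^esub> h = - h"
proof -
  interpret E: field "edge_field n" by (rule field_edge_field)
  have "h + (\<ominus>\<^bsub>edge_field n\<^esub> h) = 0"
    using E.r_neg[OF assms] by (simp add: edge_field_simps)
  then show ?thesis by (simp add: eq_neg_iff_add_eq_0 add.commute)
qed

lemma K2_carrier: "K2 n \<subseteq> carrier (edge_field n)"
  using subfieldE(3)[OF subfield_K2] .

lemma closed_field_K2: "closed_field (K2 n)"
proof -
  note K = subfieldE(1)[OF subfield_K2, of n]
  interpret E: field "edge_field n" by (rule field_edge_field)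
  have inv: "inverse a \<in> K2 n" if "a \<in> K2 n" for a
  proof (cases "a = 0")
    case True then show ?thesis using that by simp
  next
    case False
    then show ?thesis
      using E.subfield_m_inv(1)[OF subfield_K2, of a] edge_field_m_inv[of a n] that subsetD[OF K2_carrier that]
      by (auto simp: edge_field_simps)
  qed
  have "- a \<in> K2 n" if "a \<in> K2 n" for a
    using subringE(5)[OF K that] edge_field_a_inv[of a n] subsetD[OF K2_carrier that] by simp
  then show ?thesis
    using inv subringE(3,6,7)[OF K] by (auto simp: closed_field_def closed_ring_def edge_field_simps)
qed

text \<open>
  The form of minimality that is used to compare two homomorphisms on \<open>K2 n\<close>: they need only agree
  on the squared areas.
\<close>

lemma K2_least:
  assumes F: "closed_field F" and area: "\<And>i j k. i < j \<Longrightarrow> j < k \<Longrightarrow> k \<le> n \<Longrightarrow> area_sq i j k \<in> F"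
  shows "K2 n \<subseteq> F"
proof
  fix h assume "h \<in> K2 n"
  then show "h \<in> F" unfolding K2_def
  proof (induction rule: generate_field.induct)
    case (a_inv h)
    then have "h \<in> carrier (edge_field n)" using K2_carrier by (auto simp: K2_def)
    then show ?case using a_inv edge_field_a_inv closed_ringD(4)[OF closed_fieldD(1)[OF F]] by simp
  next
    case (m_inv h)
    then have "h \<in> carrier (edge_field n)" using K2_carrier by (auto simp: K2_def)
    then show ?case using m_inv edge_field_m_inv closed_fieldD(2)[OF F] by (simp add: edge_field_simps)
  qed (use area closed_ringD[OF closed_fieldD(1)[OF F]] in \<open>auto simp: edge_field_simps\<close>)
qed

lemma area_sq_in_K2: "i < j \<Longrightarrow> j < k \<Longrightarrow> k \<le> n \<Longrightarrow> area_sq i j k \<in> K2 n"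
  unfolding K2_def by (rule generate_field.incl) auto

lemma eval_edge_field:
  "ring.eval (edge_field n) p x = poly (Poly (rev p)) x"
proof (induction p)
  case Nil
  interpret E: field "edge_field n" by (rule field_edge_field)
  show ?case by (simp add: edge_field_simps)
next
  case (Cons a p)
  interpret E: field "edge_field n" by (rule field_edge_field)
  have "poly (Poly (rev (a # p))) x = poly (Poly (rev p)) x + a * x ^ length p"
    by (simp add: Poly_append poly_monom)
  then show ?case
    using Cons by (simp add: edge_field_simps edge_field_pow)
qed

lemma degree_Poly_rev:
  assumes "p \<noteq> []" "hd p \<noteq> 0"
  shows "Polynomial.degree (Poly (rev p)) = length p - 1" "Poly (rev p) \<noteq> 0"
proof -
  have c: "coeff (Poly (rev p)) (length p - 1) \<noteq> 0"
    using assms by (simp add: nth_default_def rev_nth hd_conv_nth)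
  then show "Poly (rev p) \<noteq> 0" by (metis coeff_0)
  have "Polynomial.degree (Poly (rev p)) \<le> length p - 1"
    using assms(1) by (intro degree_le) (auto simp: nth_default_def)
  then show "Polynomial.degree (Poly (rev p)) = length p - 1" using c le_degree by (intro antisym)
qed

text \<open>
  Translates the notions of the algebraic library, where polynomials are coefficient lists starting with the
  leading one, into a statement on elements of type \<open>poly\<close>.
\<close>

lemma Irr_degree:
  assumes x: "x \<in> carrier (edge_field n)"
    and p: "p \<in> polys_over (K2 n)" "p \<noteq> 0" "poly p x = 0" "Polynomial.degree p \<le> m"
    and min: "\<And>q. q \<in> polys_over (K2 n) \<Longrightarrow> q \<noteq> 0 \<Longrightarrow> poly q x = 0 \<Longrightarrow> m \<le> Polynomial.degree q"
  shows "ring.algebraic (edge_field n) (K2 n) x"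
    and "Polynomials.degree (ring.Irr (edge_field n) (K2 n) x) = m"
proof -
  interpret E: field "edge_field n" by (rule field_edge_field)
  let ?P = "carrier ((K2 n) [X]\<^bsub>edge_field n\<^esub>)"
  define l where "l = rev (coeffs p)"
  have l: "l \<in> ?P" "l \<noteq> []"
    using p(1,2) closed_ringD(5)[OF closed_fieldD(1)[OF closed_field_K2]]
    by (auto simp: l_def univ_poly_def polynomial_def coeffs_def polys_over_def edge_field_simps hd_rev
        last_coeffs_eq_coeff_degree[unfolded coeffs_def])
  have ev: "E.eval l x = \<zero>\<^bsub>edge_field n\<^esub>"
    using p(3) by (simp add: eval_edge_field l_def edge_field_simps)
  note alg = E.algebraicI[OF l ev]
  then show "E.algebraic (K2 n) x" by (simp add: over_def)
  note K = subfield_K2[of n]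
  note I = E.IrrE[OF K x alg]
  let ?I = "E.Irr (K2 n) x"
  have I': "?I \<noteq> []" "hd ?I \<noteq> 0" "set ?I \<subseteq> K2 n"
    using E.pirreducibleE(1)[OF subfieldE(1)[OF K] I(1,2)] I(1,3)
    by (auto simp: univ_poly_def polynomial_def edge_field_simps)
  have deg: "Polynomial.degree (Poly (rev ?I)) = Polynomials.degree ?I"
    using degree_Poly_rev(1)[OF I'(1,2)] by simp
  have "Poly (rev ?I) \<in> polys_over (K2 n)"
    using I'(3) closed_ringD(5)[OF closed_fieldD(1)[OF closed_field_K2]]
    by (auto simp: polys_over_def nth_default_def) (metis length_rev nth_mem set_rev subsetD)
  then have "m \<le> Polynomials.degree ?I"
    using min[of "Poly (rev ?I)"] degree_Poly_rev(2)[OF I'(1,2)] I(4) deg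
    by (simp add: eval_edge_field edge_field_simps)
  moreover have "Polynomials.degree ?I \<le> Polynomials.degree l"
    using E.Irr_minimal[OF K x alg l(1) ev] l I(1)
      E.pdivides_imp_degree_le[OF subfieldE(1)[OF K] I(1) l(1)] by blast
  moreover have "Polynomials.degree l = Polynomial.degree p"
    using p(2) by (simp add: l_def length_coeffs)
  ultimately show "Polynomials.degree ?I = m" using p(4) by simp
qed

section \<open>Configurations with equal areas\<close>

text \<open>
  Sixteen times the square of the area of a triangle, as a function of its squared edge lengths.
\<close>

definition heron :: "'a::comm_ring_1 \<Rightarrow> 'a \<Rightarrow> 'a \<Rightarrow> 'a" where
  "heron a b c = 2 * a * b + 2 * b * c + 2 * c * a - a ^ 2 - b ^ 2 - c ^ 2"

definition symmetric :: "(nat \<Rightarrow> nat \<Rightarrow> 'a) \<Rightarrow> bool" where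
  "symmetric x \<longleftrightarrow> (\<forall>i j. x i j = x j i)"

definition same_areas :: "nat \<Rightarrow> (nat \<Rightarrow> nat \<Rightarrow> complex) \<Rightarrow> (nat \<Rightarrow> nat \<Rightarrow> complex) \<Rightarrow> bool" where
  "same_areas n x y \<longleftrightarrow> (\<forall>i j k. i < j \<longrightarrow> j < k \<longrightarrow> k \<le> n \<longrightarrow>
     heron (x i j) (x j k) (x k i) = heron (y i j) (y j k) (y k i))"

lemma edge_len_commute: "edge_len i j = edge_len j i"
  by (simp add: edge_len_eq_iff insert_commute)

lemma edge_sq_commute: "edge_sq i j = edge_sq j i"
  by (simp add: edge_sq_def edge_len_commute)

lemma area_sq_heron: "16 * area_sq i j k = heron (edge_sq i j) (edge_sq j k) (edge_sq k i)"
  by (simp add: area_sq_def heron_def)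

lemma hom_on_heron:
  assumes "hom_on R \<psi>" "closed_ring R" "a \<in> R" "b \<in> R" "c \<in> R"
  shows "\<psi> (heron a b c) = heron (\<psi> a) (\<psi> b) (\<psi> c)" "heron a b c \<in> R"
  using assms(3-)
  by (simp_all add: heron_def hom_onD[OF assms(1,2)] closed_ringD[OF assms(2)] hom_on_power[OF assms(1,2)]
      hom_on_numeral[OF assms(1,2)] closed_ring_power[OF assms(2)] closed_ring_numeral[OF assms(2)])

definition edge_codes :: "nat \<Rightarrow> nat list" where
  "edge_codes n = sorted_list_of_set ((\<lambda>(i, j). set_encode {i, j}) ` {(i, j). i \<noteq> j \<and> i \<le> n \<and> j \<le> n})"

lemma edge_codes:
  "distinct (edge_codes n)" "i \<noteq> j \<Longrightarrow> i \<le> n \<Longrightarrow> j \<le> n \<Longrightarrow> set_encode {i, j} \<in> set (edge_codes n)"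
proof -
  have "finite {(i, j). i \<noteq> j \<and> i \<le> n \<and> j \<le> n}"
    by (rule finite_subset[of _ "{..n} \<times> {..n}"]) auto
  then show "i \<noteq> j \<Longrightarrow> i \<le> n \<Longrightarrow> j \<le> n \<Longrightarrow> set_encode {i, j} \<in> set (edge_codes n)"
    by (force simp: edge_codes_def)
qed (simp add: edge_codes_def)

text \<open>
  The value for the variable with the given code: a square root of the entry of \<open>c\<close>, since the
  variables are the edge lengths and not their squares.
\<close>

definition root_at :: "(nat \<Rightarrow> nat \<Rightarrow> complex) \<Rightarrow> nat \<Rightarrow> complex" where
  "root_at c v = csqrt (c (Min (set_decode v)) (Max (set_decode v)))"

lemma root_at:
  assumes "symmetric c"
  shows "root_at c (set_encode {i, j}) = csqrt (c i j)"
proof -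
  have "c (min i j) (max i j) = c i j"
    using assms unfolding symmetric_def by (cases "i \<le> j") (auto simp: min_def max_def)
  then show ?thesis by (simp add: root_at_def)
qed

text \<open>
  Generic edge lengths are taken close to square roots of the entries of \<open>c\<close>, so that the squares
  are close to \<open>c\<close>.
\<close>

lemma generic_config:
  assumes c: "symmetric c" and \<epsilon>: "\<epsilon> > 0"
  shows "\<exists>K \<psi>. closed_field K \<and> countable K \<and> hom_on K \<psi> \<and>
    (\<forall>i j. i \<noteq> j \<longrightarrow> i \<le> n \<longrightarrow> j \<le> n \<longrightarrow> edge_len i j \<in> K \<and> cmod (\<psi> (edge_sq i j) - c i j) < \<epsilon>)"
proof -
  define M where "M = (\<Sum>i\<le>n. \<Sum>j\<le>n. cmod (csqrt (c i j)))"
  have M: "cmod (csqrt (c i j)) \<le> M" if "i \<le> n" "j \<le> n" for i j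
  proof -
    have "cmod (csqrt (c i j)) \<le> (\<Sum>j\<le>n. cmod (csqrt (c i j)))"
      using that by (intro member_le_sum) auto
    also have "\<dots> \<le> M" unfolding M_def using that by (intro member_le_sum sum_nonneg) auto
    finally show ?thesis .
  qed
  define \<delta> where "\<delta> = min 1 (\<epsilon> / (2 * M + 2))"
  have M0: "M \<ge> 0" unfolding M_def by (intro sum_nonneg) auto
  have \<delta>: "\<delta> > 0" "\<delta> \<le> 1" "\<delta> * (2 * M + 1) < \<epsilon>"
  proof -
    show "\<delta> > 0" "\<delta> \<le> 1" using \<epsilon> M0 by (auto simp: \<delta>_def)
    have "\<delta> * (2 * M + 1) < \<delta> * (2 * M + 2)" using \<open>\<delta> > 0\<close> by simp
    also have "\<dots> \<le> \<epsilon> / (2 * M + 2) * (2 * M + 2)"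
      using M0 by (intro mult_right_mono) (auto simp: \<delta>_def)
    finally show "\<delta> * (2 * M + 1) < \<epsilon>" using M0 by simp
  qed
  obtain K \<psi> where K: "closed_field K" "countable K" "hom_on K \<psi>"
    and v: "\<And>v. v \<in> set (edge_codes n) \<Longrightarrow> variable v \<in> K \<and> cmod (\<psi> (variable v) - root_at c v) < \<delta>"
    using generic_hom[OF edge_codes(1) \<delta>(1), of n "root_at c"] by blast
  have "edge_len i j \<in> K \<and> cmod (\<psi> (edge_sq i j) - c i j) < \<epsilon>" if ij: "i \<noteq> j" "i \<le> n" "j \<le> n" for i j
  proof -
    define l where "l = \<psi> (edge_len i j)"
    have e: "edge_len i j \<in> K" and near: "cmod (l - csqrt (c i j)) < \<delta>"
      using v[OF edge_codes(2)[OF ij]] root_at[OF c] by (simp_all add: edge_len_def l_def)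
    have "\<psi> (edge_sq i j) - c i j = (l - csqrt (c i j)) * (l + csqrt (c i j))"
      using hom_on_power[OF K(3) closed_fieldD(1)[OF K(1)] e]
      by (simp add: edge_sq_def l_def power2_eq_square[symmetric] algebra_simps)
    moreover have "cmod (l + csqrt (c i j)) \<le> 2 * M + 1"
    proof -
      have "l + csqrt (c i j) = (l - csqrt (c i j)) + 2 * csqrt (c i j)" by simp
      then have "cmod (l + csqrt (c i j)) \<le> cmod (l - csqrt (c i j)) + cmod (2 * csqrt (c i j))"
        by (metis norm_triangle_ineq)
      then show ?thesis using near \<delta>(2) M[OF ij(2,3)] by (simp add: norm_mult)
    qed
    ultimately have "cmod (\<psi> (edge_sq i j) - c i j) \<le> \<delta> * (2 * M + 1)"
      using near \<delta>(1) M0 by (simp add: norm_mult mult_mono)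
    then show ?thesis using \<delta>(3) e by simp
  qed
  then show ?thesis using K by blast
qed

lemma edge_sq_in:
  assumes "closed_field K" "edge_len i j \<in> K"
  shows "edge_sq i j \<in> K"
  using assms closed_ring_power[OF closed_fieldD(1)] by (simp add: edge_sq_def)

lemma K2_subset:
  assumes K: "closed_field K" and e: "\<And>i j. i \<noteq> j \<Longrightarrow> i \<le> n \<Longrightarrow> j \<le> n \<Longrightarrow> edge_len i j \<in> K"
  shows "K2 n \<subseteq> K"
proof (rule K2_least[OF K])
  note R = closed_fieldD(1)[OF K]
  fix i j k :: nat assume "i < j" "j < k" "k \<le> n"
  then have "edge_sq i j \<in> K" "edge_sq j k \<in> K" "edge_sq k i \<in> K" by (auto intro!: edge_sq_in[OF K] e)
  then have "(1 / 16) * heron (edge_sq i j) (edge_sq j k) (edge_sq k i) \<in> K"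
    unfolding heron_def
    by (intro closed_ringD[OF R] closed_fieldD(3)[OF K] closed_ring_power[OF R] closed_ring_numeral[OF R])
  then show "area_sq i j k \<in> K" by (simp add: area_sq_def heron_def)
qed

lemma common_denominator:
  assumes A: "closed_ring A" and p: "p \<in> polys_over (quotients A)"
  shows "\<exists>d\<in>A. d \<noteq> 0 \<and> smult d p \<in> polys_over A"
  using p
proof (induction p)
  case 0
  then show ?case using closed_ringD(1)[OF A] polys_over_closed(1)[OF A] by (intro bexI[of _ 1]) auto
next
  case (pCons a p)
  have "coeff (pCons a p) 0 \<in> quotients A" "coeff (pCons a p) (Suc i) \<in> quotients A" for i
    using pCons.prems polys_over_coeff by blast+
  then have "a \<in> quotients A" "p \<in> polys_over (quotients A)" by (auto simp: polys_over_def)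
  then obtain d u v where d: "d \<in> A" "d \<noteq> 0" "smult d p \<in> polys_over A"
    and uv: "a = u / v" "u \<in> A" "v \<in> A" "v \<noteq> 0"
    using pCons.IH unfolding quotients_def by blast
  have "smult (d * v) (pCons a p) = pCons (d * u) (smult v (smult d p))"
    using uv by (simp add: mult.commute)
  then show ?case
    using d(1,2) uv polys_over_closed(4)[OF A closed_ringD(3)[OF A d(1) uv(2)]
        polys_over_closed(9)[OF A uv(3) d(3)]] closed_ringD(3)[OF A d(1) uv(3)]
    by (intro bexI[of _ "d * v"]) simp_all
qed

lemma hom_on_poly:
  assumes \<psi>: "hom_on R \<psi>" "closed_ring R" and "q \<in> polys_over R" "x \<in> R"
  shows "\<psi> (poly q x) = poly (map_poly \<psi> q) (\<psi> x)"
proof -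
  have "\<psi> (poly q x) = poly (map_poly \<psi> q) (\<psi> x) \<and> poly q x \<in> R"
    using assms(3)
  proof (induction q)
    case 0
    then show ?case using hom_onD(4)[OF \<psi>] closed_ringD(5)[OF \<psi>(2)] by simp
  next
    case (pCons a q)
    have "coeff (pCons a q) 0 \<in> R" "coeff (pCons a q) (Suc i) \<in> R" for i
      using pCons.prems polys_over_coeff by blast+
    then have "a \<in> R" "q \<in> polys_over R" by (auto simp: polys_over_def)
    then show ?case
      using pCons.IH assms(4) hom_onD[OF \<psi>] closed_ringD[OF \<psi>(2)] by (simp add: map_poly_pCons)
  qed
  then show ?thesis ..
qed

text \<open>
  Let \<open>\<phi>\<close> be the evaluation at \<open>y\<close>. It is only defined on a ring
  \<open>R\<close>, but it agrees with \<open>\<psi>\<close> on the squared areas, hence on a ring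
  \<open>A\<close> whose quotients contain \<open>K2 n\<close>. Multiplying \<open>p\<close> by a denominator in
  \<open>A\<close> brings its coefficients into \<open>A\<close>; the two homomorphisms then transform it in the
  same way, and \<open>\<phi>\<close> maps the equation \<open>p(s\<^sub>a\<^sub>b) = 0\<close> to the claim.
\<close>

lemma same_areas_root:
  assumes K: "closed_field K" "hom_on K \<psi>" "\<And>i j. i \<noteq> j \<Longrightarrow> i \<le> n \<Longrightarrow> j \<le> n \<Longrightarrow> edge_len i j \<in> K"
    and p: "p \<in> polys_over (K2 n)" "poly p (edge_sq a b) = 0" and ab: "a \<noteq> b" "a \<le> n" "b \<le> n"
    and y: "symmetric y" "same_areas n (\<lambda>i j. \<psi> (edge_sq i j)) y"
  shows "poly (map_poly \<psi> p) (y a b) = 0"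
proof -
  note RK = closed_fieldD(1)[OF K(1)]
  obtain R \<phi> where R: "closed_ring R" "rationals \<subseteq> R" "hom_on R \<phi>"
    and v: "\<And>v. v \<in> set (edge_codes n) \<Longrightarrow> variable v \<in> R \<and> \<phi> (variable v) = root_at y v"
    using evaluation_hom[OF edge_codes(1), of n "root_at y"] by blast
  have e: "edge_sq i j \<in> R" "\<phi> (edge_sq i j) = y i j" "edge_sq i j \<in> K"
    if ij: "i \<noteq> j" "i \<le> n" "j \<le> n" for i j
  proof -
    have "edge_len i j \<in> R" "\<phi> (edge_len i j) = csqrt (y i j)"
      using v[OF edge_codes(2)[OF ij]] root_at[OF y(1)] by (simp_all add: edge_len_def)
    then show "edge_sq i j \<in> R" "\<phi> (edge_sq i j) = y i j"
      by (simp_all add: edge_sq_def closed_ring_power[OF R(1)] hom_on_power[OF R(3,1)])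
    show "edge_sq i j \<in> K" using edge_sq_in[OF K(1)] K(3)[OF ij] by blast
  qed
  \<comment> \<open>The ring on which both homomorphisms are defined and equal.\<close>
  define A where "A = {r \<in> R \<inter> K. \<phi> r = \<psi> r}"
  have A: "closed_ring A"
    unfolding closed_ring_def A_def
    using closed_ringD[OF R(1)] closed_ringD[OF RK] hom_onD[OF R(3,1)] hom_onD[OF K(2) RK] by auto
  have A16: "16 \<in> A"
    using closed_ring_numeral[OF R(1)] closed_ring_numeral[OF RK] hom_on_numeral[OF R(3,1)]
      hom_on_numeral[OF K(2) RK] by (simp add: A_def)
  have "K2 n \<subseteq> quotients A"
  proof (rule K2_least[OF closed_field_quotients(1)[OF A]])
    fix i j k :: nat assume ijk: "i < j" "j < k" "k \<le> n"
    let ?h = "heron (edge_sq i j) (edge_sq j k) (edge_sq k i)"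
    have "?h \<in> R" "?h \<in> K" "\<phi> ?h = heron (y i j) (y j k) (y k i)"
      "\<psi> ?h = heron (\<psi> (edge_sq i j)) (\<psi> (edge_sq j k)) (\<psi> (edge_sq k i))"
      using ijk hom_on_heron[OF R(3,1)] hom_on_heron[OF K(2) RK] e by auto
    then have "?h \<in> A" using y(2) ijk by (simp add: A_def same_areas_def)
    then have "?h / 16 \<in> quotients A"
      unfolding quotients_def using A16 by (intro CollectI exI[of _ ?h] exI[of _ 16]) simp
    moreover have "area_sq i j k = ?h / 16" unfolding area_sq_heron[symmetric] by simp
    ultimately show "area_sq i j k \<in> quotients A" by metis
  qed
  then have "p \<in> polys_over (quotients A)" using p(1) by (auto simp: polys_over_def)
  then obtain d where d: "d \<in> A" "d \<noteq> 0" "smult d p \<in> polys_over A"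
    using common_denominator[OF A] by blast
  have AR: "polys_over A \<subseteq> polys_over R" by (auto simp: polys_over_def A_def)
  have "poly (map_poly \<phi> (smult d p)) (y a b) = \<phi> (poly (smult d p) (edge_sq a b))"
    using hom_on_poly[OF R(3,1), of "smult d p" "edge_sq a b"] d(3) AR e[OF ab] by auto
  also have "\<dots> = 0" using p(2) hom_onD(4)[OF R(3,1)] by simp
  also have "map_poly \<phi> (smult d p) = map_poly \<psi> (smult d p)"
  proof (rule poly_eqI)
    fix i
    have "coeff (smult d p) i \<in> A" by (rule polys_over_coeff[OF d(3)])
    then show "coeff (map_poly \<phi> (smult d p)) i = coeff (map_poly \<psi> (smult d p)) i"
      using hom_onD(4)[OF R(3,1)] hom_onD(4)[OF K(2) RK]
      by (simp only: coeff_map_poly A_def) blast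
  qed
  also have "\<dots> = smult (\<psi> d) (map_poly \<psi> p)"
  proof (rule poly_eqI)
    fix i
    have "coeff p i \<in> K" "d \<in> K"
      using polys_over_coeff[OF p(1)] K2_subset[OF K(1,3)] d(1) by (auto simp: A_def)
    then show "coeff (map_poly \<psi> (smult d p)) i = coeff (smult (\<psi> d) (map_poly \<psi> p)) i"
      using hom_onD(3,4)[OF K(2) RK] by (simp add: coeff_map_poly)
  qed
  finally show ?thesis
    using hom_on_nonzero[OF K(2,1), of d] d by (auto simp: A_def)
qed

text \<open>
  The conjugates of \<open>x\<close> over \<open>K2 n\<close> are values of extensions of the restriction of
  \<open>\<psi>\<close> to \<open>K2 n\<close>. An extension may be continued to all edge lengths, and its
  values on the squared edge lengths have the same faces, because it agrees with \<open>\<psi>\<close> on the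
  squared areas.
\<close>

lemma conjugate_configs:
  assumes K: "closed_field K" "countable K" "hom_on K \<psi>"
      "\<And>i j. i \<noteq> j \<Longrightarrow> i \<le> n \<Longrightarrow> j \<le> n \<Longrightarrow> edge_len i j \<in> K"
    and low: "\<And>q. q \<in> polys_over (K2 n) \<Longrightarrow> q \<noteq> 0 \<Longrightarrow> poly q x = 0 \<Longrightarrow> m \<le> Polynomial.degree q"
  shows "\<exists>\<rho>s. finite \<rho>s \<and> card \<rho>s = m \<and> (\<forall>\<rho>\<in>\<rho>s. \<exists>K' \<psi>'. closed_field K' \<and> hom_on K' \<psi>' \<and>
    (\<forall>i j. i \<noteq> j \<longrightarrow> i \<le> n \<longrightarrow> j \<le> n \<longrightarrow> edge_len i j \<in> K') \<and> \<psi>' x = \<rho> \<and>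
    same_areas n (\<lambda>i j. \<psi> (edge_sq i j)) (\<lambda>i j. \<psi>' (edge_sq i j)))"
proof -
  have sub: "K2 n \<subseteq> K" using K2_subset[OF K(1,4)] .
  note K2 = closed_field_K2[of n] countable_subset[OF sub K(2)] hom_on_subset[OF K(3) sub]
  note RK = closed_fieldD(1)[OF K(1)]
  have "\<exists>\<rho>s. finite \<rho>s \<and> card \<rho>s = m \<and> (\<forall>\<rho>\<in>\<rho>s. conjugate (K2 n) \<psi> x \<rho>)"
    by (rule many_conjugates[OF K2]) (rule low)
  then obtain \<rho>s where \<rho>s: "finite \<rho>s" "card \<rho>s = m" "\<And>\<rho>. \<rho> \<in> \<rho>s \<Longrightarrow> conjugate (K2 n) \<psi> x \<rho>"
    by auto
  have "\<exists>K' \<psi>'. closed_field K' \<and> hom_on K' \<psi>' \<and>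
    (\<forall>i j. i \<noteq> j \<longrightarrow> i \<le> n \<longrightarrow> j \<le> n \<longrightarrow> edge_len i j \<in> K') \<and> \<psi>' x = \<rho> \<and>
    same_areas n (\<lambda>i j. \<psi> (edge_sq i j)) (\<lambda>i j. \<psi>' (edge_sq i j))" if \<rho>: "\<rho> \<in> \<rho>s" for \<rho>
  proof -
    obtain K1 \<psi>1 where K1: "closed_field K1" "countable K1" "hom_on K1 \<psi>1" "K2 n \<subseteq> K1" "x \<in> K1"
      "\<And>a. a \<in> K2 n \<Longrightarrow> \<psi>1 a = \<psi> a" "\<psi>1 x = \<rho>"
      using extend_hom_conjugate[OF K2 \<rho>s(3)[OF \<rho>]] by blast
    obtain K' \<psi>' where K': "closed_field K'" "hom_on K' \<psi>'" "K1 \<subseteq> K'"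
      "set (map variable (edge_codes n)) \<subseteq> K'" "\<And>a. a \<in> K1 \<Longrightarrow> \<psi>' a = \<psi>1 a"
      using extend_hom_list[OF K1(1-3), of "map variable (edge_codes n)"] by blast
    note R' = closed_fieldD(1)[OF K'(1)]
    have e: "edge_len i j \<in> K'" if "i \<noteq> j" "i \<le> n" "j \<le> n" for i j
      using K'(4) edge_codes(2)[OF that] by (auto simp: edge_len_def)
    note sq = edge_sq_in[OF K'(1) e] edge_sq_in[OF K(1) K(4)]
    have "same_areas n (\<lambda>i j. \<psi> (edge_sq i j)) (\<lambda>i j. \<psi>' (edge_sq i j))"
      unfolding same_areas_def
    proof (intro allI impI)
      fix i j k :: nat assume ijk: "i < j" "j < k" "k \<le> n"
      let ?h = "heron (edge_sq i j) (edge_sq j k) (edge_sq k i)"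
      have "\<psi> ?h = heron (\<psi> (edge_sq i j)) (\<psi> (edge_sq j k)) (\<psi> (edge_sq k i))"
        "\<psi>' ?h = heron (\<psi>' (edge_sq i j)) (\<psi>' (edge_sq j k)) (\<psi>' (edge_sq k i))"
        using ijk hom_on_heron[OF K'(2) R'] hom_on_heron[OF K(3) RK] sq by auto
      moreover have "?h \<in> K2 n"
        using area_sq_heron[of i j k] area_sq_in_K2[OF ijk] closed_fieldD(1)[OF K2(1)]
        by (metis closed_ringD(3) closed_ring_numeral)
      then have "\<psi>' ?h = \<psi> ?h" using K'(5) K1(4,6) by auto
      ultimately show "heron (\<psi> (edge_sq i j)) (\<psi> (edge_sq j k)) (\<psi> (edge_sq k i)) =
        heron (\<psi>' (edge_sq i j)) (\<psi>' (edge_sq j k)) (\<psi>' (edge_sq k i))" by simp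
    qed
    then show ?thesis using K'(1,2,3,5) K1(5,7) e by (intro exI[of _ K'] exI[of _ \<psi>']) auto
  qed
  then show ?thesis using \<rho>s by blast
qed

section \<open>Limits of configurations with equal areas\<close>

definition face :: "(nat \<Rightarrow> nat \<Rightarrow> 'a::comm_ring_1) \<Rightarrow> nat \<Rightarrow> nat \<Rightarrow> nat \<Rightarrow> 'a" where
  "face x i j k = heron (x i j) (x j k) (x k i)"

lemma symmetricD: "symmetric x \<Longrightarrow> x i j = x j i"
  unfolding symmetric_def by blast

lemma face_perm:
  assumes "symmetric x"
  shows "face x j i k = face x i j k" "face x i k j = face x i j k"
  using symmetricD[OF assms, of j i] symmetricD[OF assms, of j k] symmetricD[OF assms, of k i]
  by (simp_all add: face_def heron_def algebra_simps)

lemma triple_wlog: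
  fixes P :: "nat \<Rightarrow> nat \<Rightarrow> nat \<Rightarrow> bool"
  assumes ord: "\<And>i j k. i < j \<Longrightarrow> j < k \<Longrightarrow> k \<le> n \<Longrightarrow> P i j k"
    and perm: "\<And>i j k. P i j k \<Longrightarrow> P j i k" "\<And>i j k. P i j k \<Longrightarrow> P i k j"
    and "i \<noteq> j" "j \<noteq> k" "i \<noteq> k" "i \<le> n" "j \<le> n" "k \<le> n"
  shows "P i j k"
proof -
  consider "i < j" "j < k" | "i < k" "k < j" | "j < i" "i < k" | "j < k" "k < i" | "k < i" "i < j" | "k < j" "j < i"
    using assms by linarith
  then show ?thesis
    by cases (metis assms(1,7-9) perm)+
qed

lemma same_areas_face:
  assumes "symmetric x" "symmetric y" "same_areas n x y"
    and "i \<noteq> j" "j \<noteq> k" "i \<noteq> k" "i \<le> n" "j \<le> n" "k \<le> n"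
  shows "face x i j k = face y i j k"
proof (rule triple_wlog[where P = "\<lambda>i j k. face x i j k = face y i j k" and n = n])
  show "face x i j k = face y i j k" if "i < j" "j < k" "k \<le> n" for i j k
    using assms(3) that by (simp add: same_areas_def face_def)
  show "face x j i k = face y j i k" "face x i k j = face y i k j" if "face x i j k = face y i j k" for i j k
    using that face_perm[OF assms(1)] face_perm[OF assms(2)] by metis+
qed (use assms in auto)

lemma same_areasI:
  assumes "\<And>i j k. i < j \<Longrightarrow> j < k \<Longrightarrow> k \<le> n \<Longrightarrow> face x i j k = face y i j k"
  shows "same_areas n x y"
  using assms by (simp add: same_areas_def face_def)

text \<open>
  The number \<open>3\<close> is the face of the regular simplex with all entries \<open>1\<close>.
\<close>

definition faces_tend :: "nat \<Rightarrow> (nat \<Rightarrow> nat \<Rightarrow> nat \<Rightarrow> complex) \<Rightarrow> bool" where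
  "faces_tend n Z \<longleftrightarrow> (\<forall>i j k. i < j \<longrightarrow> j < k \<longrightarrow> k \<le> n \<longrightarrow> (\<lambda>m. face (Z m) i j k) \<longlonglongrightarrow> 3)"

lemma faces_tend_face:
  assumes "\<And>m. symmetric (Z m)" "faces_tend n Z"
    and "i \<noteq> j" "j \<noteq> k" "i \<noteq> k" "i \<le> n" "j \<le> n" "k \<le> n"
  shows "(\<lambda>m. face (Z m) i j k) \<longlonglongrightarrow> 3"
proof (rule triple_wlog[where P = "\<lambda>i j k. (\<lambda>m. face (Z m) i j k) \<longlonglongrightarrow> 3" and n = n])
  show "(\<lambda>m. face (Z m) i j k) \<longlonglongrightarrow> 3" if "i < j" "j < k" "k \<le> n" for i j k
    using assms(2) that by (simp add: faces_tend_def)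
  show "(\<lambda>m. face (Z m) j i k) \<longlonglongrightarrow> 3" "(\<lambda>m. face (Z m) i k j) \<longlonglongrightarrow> 3"
    if "(\<lambda>m. face (Z m) i j k) \<longlonglongrightarrow> 3" for i j k
  proof -
    have "(\<lambda>m. face (Z m) j i k) = (\<lambda>m. face (Z m) i j k)" "(\<lambda>m. face (Z m) i k j) = (\<lambda>m. face (Z m) i j k)"
      by (rule ext, rule face_perm[OF assms(1)])+
    then show "(\<lambda>m. face (Z m) j i k) \<longlonglongrightarrow> 3" "(\<lambda>m. face (Z m) i k j) \<longlonglongrightarrow> 3" using that by metis+
  qed
qed (use assms in auto)

text \<open>
  The relation between the three pairs of opposite edges of a tetrahedron in a limit of tetrahedra with equal
  faces: at least two pairs are equal, and the third pair is equal or has the sum given here, which is twice the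
  sum of the two other lengths.
\<close>

definition tet :: "'a::field \<Rightarrow> 'a \<Rightarrow> 'a \<Rightarrow> 'a \<Rightarrow> 'a \<Rightarrow> 'a \<Rightarrow> bool" where
  "tet a a' b b' c c' \<longleftrightarrow>
     b = b' \<and> c = c' \<and> (a = a' \<or> a + a' = 2 * (b + c)) \<or>
     a = a' \<and> c = c' \<and> (b = b' \<or> b + b' = 2 * (a + c)) \<or>
     a = a' \<and> b = b' \<and> (c = c' \<or> c + c' = 2 * (a + b))"

lemma scaled_minor_tendsto_0:
  fixes \<alpha> \<gamma> v n1 m2 m3 :: "nat \<Rightarrow> complex" and L :: "nat \<Rightarrow> real"
  assumes "\<And>k. \<gamma> k * n1 k = v k * m3 k - \<alpha> k * m2 k" and L: "\<And>k. L k \<ge> 1"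
    and "(\<lambda>k. \<gamma> k / L k) \<longlonglongrightarrow> \<gamma>'" "\<gamma>' \<noteq> 0" "(\<lambda>k. v k / L k) \<longlonglongrightarrow> v'" "(\<lambda>k. \<alpha> k / L k) \<longlonglongrightarrow> \<alpha>'"
    and "m2 \<longlonglongrightarrow> 0" "m3 \<longlonglongrightarrow> 0"
  shows "n1 \<longlonglongrightarrow> 0"
proof -
  have "(\<lambda>k. ((v k / L k) * m3 k - (\<alpha> k / L k) * m2 k) / (\<gamma> k / L k)) \<longlonglongrightarrow> (v' * 0 - \<alpha>' * 0) / \<gamma>'"
    using assms by (intro tendsto_intros)
  moreover have "\<forall>\<^sub>F k in sequentially. \<gamma> k / L k \<noteq> 0"
    using assms(3,4) by (rule tendsto_imp_eventually_ne)
  then have "\<forall>\<^sub>F k in sequentially. ((v k / L k) * m3 k - (\<alpha> k / L k) * m2 k) / (\<gamma> k / L k) = n1 k"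
  proof eventually_elim
    case (elim k)
    then have "\<gamma> k \<noteq> 0" "L k \<noteq> 0" by auto
    then show ?case using assms(1)[of k] by (simp add: field_simps)
  qed
  ultimately have "n1 \<longlonglongrightarrow> (v' * 0 - \<alpha>' * 0) / \<gamma>'" by (rule Lim_transform_eventually)
  then show ?thesis by simp
qed

text \<open>
  With \<open>\<alpha>, \<beta>, \<gamma>\<close> the differences of opposite entries and \<open>u, v, w\<close>
  as in the proof, consider the symmetric matrix with diagonal \<open>u, v, w\<close> and entries
  \<open>-\<gamma>, -\<beta>, -\<alpha>\<close> above it. The entries of its adjugate are combinations of the
  four faces: the off-diagonal ones \<open>m\<^sub>1, m\<^sub>2, m\<^sub>3\<close> tend to \<open>0\<close>,
  while the trace \<open>n\<^sub>1 + n\<^sub>2 + n\<^sub>3\<close> tends to \<open>4t\<close>. If one of the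
  differences survives in the limit after division by \<open>L\<close>, then the identities between minors make
  some of the \<open>n\<^sub>i\<close> tend to \<open>0\<close>. Since they cannot all do so, enough differences
  vanish in the limit.
\<close>

lemma tet_limit:
  fixes A A' B B' C C' :: "nat \<Rightarrow> complex" and L :: "nat \<Rightarrow> real"
  assumes L: "\<And>k. L k \<ge> 1"
    and lim: "(\<lambda>k. A k / L k) \<longlonglongrightarrow> a" "(\<lambda>k. A' k / L k) \<longlonglongrightarrow> a'" "(\<lambda>k. B k / L k) \<longlonglongrightarrow> b"
      "(\<lambda>k. B' k / L k) \<longlonglongrightarrow> b'" "(\<lambda>k. C k / L k) \<longlonglongrightarrow> c" "(\<lambda>k. C' k / L k) \<longlonglongrightarrow> c'"
    and H: "(\<lambda>k. heron (A k) (B k) (C k)) \<longlonglongrightarrow> t" "(\<lambda>k. heron (A k) (B' k) (C' k)) \<longlonglongrightarrow> t"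
      "(\<lambda>k. heron (A' k) (B k) (C' k)) \<longlonglongrightarrow> t" "(\<lambda>k. heron (A' k) (B' k) (C k)) \<longlonglongrightarrow> t"
    and "t \<noteq> 0"
  shows "tet a a' b b' c c'"
proof -
  define \<alpha> \<beta> \<gamma> where "\<alpha> k = A k - A' k" and "\<beta> k = B k - B' k" and "\<gamma> k = C k - C' k" for k
  define u v w where "u k = B k + B' k + C k + C' k - A k - A' k" and "v k = A k + A' k + C k + C' k - B k - B' k"
    and "w k = A k + A' k + B k + B' k - C k - C' k" for k
  define m1 m2 m3 where "m1 k = u k * \<alpha> k + \<beta> k * \<gamma> k" and "m2 k = v k * \<beta> k + \<gamma> k * \<alpha> k"
    and "m3 k = w k * \<gamma> k + \<alpha> k * \<beta> k" for k
  define n1 n2 n3 where "n1 k = v k * w k - \<alpha> k ^ 2" and "n2 k = u k * w k - \<beta> k ^ 2" and "n3 k = u k * v k - \<gamma> k ^ 2" for k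
  note defs = \<alpha>_def \<beta>_def \<gamma>_def u_def v_def w_def m1_def m2_def m3_def n1_def n2_def n3_def
  have "(\<lambda>k. (heron (A k) (B k) (C k) + heron (A k) (B' k) (C' k) - heron (A' k) (B k) (C' k) - heron (A' k) (B' k) (C k)) / 2) \<longlonglongrightarrow> (t + t - t - t) / 2"
    by (intro tendsto_intros H) simp
  then have m1: "m1 \<longlonglongrightarrow> 0" by (rule tendsto_eq_rhs[OF Lim_transform_eventually]) (auto simp: defs heron_def field_simps power2_eq_square)
  have "(\<lambda>k. (heron (A k) (B k) (C k) - heron (A k) (B' k) (C' k) + heron (A' k) (B k) (C' k) - heron (A' k) (B' k) (C k)) / 2) \<longlonglongrightarrow> (t - t + t - t) / 2"
    by (intro tendsto_intros H) simp
  then have m2: "m2 \<longlonglongrightarrow> 0" by (rule tendsto_eq_rhs[OF Lim_transform_eventually]) (auto simp: defs heron_def field_simps power2_eq_square)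
  have "(\<lambda>k. (heron (A k) (B k) (C k) - heron (A k) (B' k) (C' k) - heron (A' k) (B k) (C' k) + heron (A' k) (B' k) (C k)) / 2) \<longlonglongrightarrow> (t - t - t + t) / 2"
    by (intro tendsto_intros H) simp
  then have m3: "m3 \<longlonglongrightarrow> 0" by (rule tendsto_eq_rhs[OF Lim_transform_eventually]) (auto simp: defs heron_def field_simps power2_eq_square)
  have "(\<lambda>k. heron (A k) (B k) (C k) + heron (A k) (B' k) (C' k) + heron (A' k) (B k) (C' k) + heron (A' k) (B' k) (C k)) \<longlonglongrightarrow> t + t + t + t"
    by (intro tendsto_intros H)
  then have nsum: "(\<lambda>k. n1 k + n2 k + n3 k) \<longlonglongrightarrow> 4 * t"
    by (rule tendsto_eq_rhs[OF Lim_transform_eventually]) (auto simp: defs heron_def field_simps power2_eq_square)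
  have lim\<alpha>: "(\<lambda>k. \<alpha> k / L k) \<longlonglongrightarrow> a - a'" and lim\<beta>: "(\<lambda>k. \<beta> k / L k) \<longlonglongrightarrow> b - b'" and lim\<gamma>: "(\<lambda>k. \<gamma> k / L k) \<longlonglongrightarrow> c - c'"
    and limu: "(\<lambda>k. u k / L k) \<longlonglongrightarrow> b + b' + c + c' - a - a'" and limv: "(\<lambda>k. v k / L k) \<longlonglongrightarrow> a + a' + c + c' - b - b'"
    and limw: "(\<lambda>k. w k / L k) \<longlonglongrightarrow> a + a' + b + b' - c - c'"
    unfolding \<alpha>_def \<beta>_def \<gamma>_def u_def v_def w_def add_divide_distrib diff_divide_distrib
    by (intro tendsto_intros lim)+
  have "a = a' \<or> b = b' \<or> c = c'"
  proof (rule ccontr)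
    assume *: "\<not> ?thesis"
    have "n1 \<longlonglongrightarrow> 0"
      by (rule scaled_minor_tendsto_0[OF _ L lim\<gamma> _ limv lim\<alpha> m2 m3]) (use * in \<open>auto simp: n1_def m2_def m3_def power2_eq_square algebra_simps\<close>)
    moreover have "n2 \<longlonglongrightarrow> 0"
      by (rule scaled_minor_tendsto_0[OF _ L lim\<alpha> _ limw lim\<beta> m3 m1]) (use * in \<open>auto simp: n2_def m1_def m3_def power2_eq_square algebra_simps\<close>)
    moreover have "n3 \<longlonglongrightarrow> 0"
      by (rule scaled_minor_tendsto_0[OF _ L lim\<beta> _ limu lim\<gamma> m1 m2]) (use * in \<open>auto simp: n3_def m1_def m2_def power2_eq_square algebra_simps\<close>)
    ultimately have "(\<lambda>k. n1 k + n2 k + n3 k) \<longlonglongrightarrow> 0 + 0 + 0" by (intro tendsto_intros)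
    from LIMSEQ_unique[OF nsum this] show False using \<open>t \<noteq> 0\<close> by simp
  qed
  have scaled: "\<mu> = 0" if "m \<longlonglongrightarrow> 0" "(\<lambda>k. m k / (L k) ^ 2) \<longlonglongrightarrow> \<mu>" for m :: "nat \<Rightarrow> complex" and \<mu>
  proof -
    have "(\<lambda>k. m k / (L k) ^ 2) \<longlonglongrightarrow> 0"
    proof (rule tendsto_norm_zero_cancel, rule tendsto_sandwich[OF _ _ tendsto_const tendsto_norm_zero[OF that(1)]])
      show "\<forall>\<^sub>F k in sequentially. norm (m k / (L k) ^ 2) \<le> norm (m k)"
      proof (rule always_eventually, rule allI)
        fix k
        have "1 \<le> (L k) ^ 2" using L[of k] by simp
        then have "norm (m k) / (L k) ^ 2 \<le> norm (m k) / 1"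
          by (intro divide_left_mono) auto
        then show "norm (m k / (L k) ^ 2) \<le> norm (m k)"
          using L[of k] by (simp add: norm_divide norm_power flip: of_real_power)
      qed
    qed simp
    then show ?thesis using LIMSEQ_unique that(2) by blast
  qed
  have e1: "(b + b' + c + c' - a - a') * (a - a') + (b - b') * (c - c') = 0"
  proof (rule scaled[OF m1])
    have "(\<lambda>k. (u k / L k) * (\<alpha> k / L k) + (\<beta> k / L k) * (\<gamma> k / L k)) \<longlonglongrightarrow> (b + b' + c + c' - a - a') * (a - a') + (b - b') * (c - c')"
      by (intro tendsto_intros lim\<alpha> lim\<beta> lim\<gamma> limu)
    then show "(\<lambda>k. m1 k / (L k) ^ 2) \<longlonglongrightarrow> (b + b' + c + c' - a - a') * (a - a') + (b - b') * (c - c')"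
      by (simp add: m1_def power2_eq_square add_divide_distrib)
  qed
  have e2: "(a + a' + c + c' - b - b') * (b - b') + (c - c') * (a - a') = 0"
  proof (rule scaled[OF m2])
    have "(\<lambda>k. (v k / L k) * (\<beta> k / L k) + (\<gamma> k / L k) * (\<alpha> k / L k)) \<longlonglongrightarrow> (a + a' + c + c' - b - b') * (b - b') + (c - c') * (a - a')"
      by (intro tendsto_intros lim\<alpha> lim\<beta> lim\<gamma> limv)
    then show "(\<lambda>k. m2 k / (L k) ^ 2) \<longlonglongrightarrow> (a + a' + c + c' - b - b') * (b - b') + (c - c') * (a - a')"
      by (simp add: m2_def power2_eq_square add_divide_distrib)
  qed
  have e3: "(a + a' + b + b' - c - c') * (c - c') + (a - a') * (b - b') = 0"
  proof (rule scaled[OF m3])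
    have "(\<lambda>k. (w k / L k) * (\<gamma> k / L k) + (\<alpha> k / L k) * (\<beta> k / L k)) \<longlonglongrightarrow> (a + a' + b + b' - c - c') * (c - c') + (a - a') * (b - b')"
      by (intro tendsto_intros lim\<alpha> lim\<beta> lim\<gamma> limw)
    then show "(\<lambda>k. m3 k / (L k) ^ 2) \<longlonglongrightarrow> (a + a' + b + b' - c - c') * (c - c') + (a - a') * (b - b')"
      by (simp add: m3_def power2_eq_square add_divide_distrib)
  qed
  have sq: "x + x' = 2 * (y + z)" if "y + y' + z + z' - x - x' = 0" "y = y'" "z = z'" for x x' y y' z z' :: complex
    using that by (simp add: algebra_simps)
  have "\<not> (a \<noteq> a' \<and> b \<noteq> b')" "\<not> (a \<noteq> a' \<and> c \<noteq> c')" "\<not> (b \<noteq> b' \<and> c \<noteq> c')"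
    using \<open>a = a' \<or> b = b' \<or> c = c'\<close> e1 e2 e3 by auto
  then consider "b = b'" "c = c'" | "a = a'" "c = c'" | "a = a'" "b = b'" by blast
  then show ?thesis
  proof cases
    case 1
    then have "a = a' \<or> a + a' = 2 * (b + c)" using e1 sq[of b b' c c' a a'] by auto
    then show ?thesis using 1 by (simp add: tet_def)
  next
    case 2
    then have "b = b' \<or> b + b' = 2 * (a + c)" using e2 sq[of a a' c c' b b'] by auto
    then show ?thesis using 2 by (simp add: tet_def)
  next
    case 3
    then have "c = c' \<or> c + c' = 2 * (a + b)" using e3 sq[of a a' b b' c c'] by auto
    then show ?thesis using 3 by (simp add: tet_def)
  qed
qed

text \<open>
  Each hypothesis is a disjunction of systems of linear equations, so this is a finite case distinction in
  linear arithmetic.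
\<close>

lemma classify_real:
  fixes x01 x02 x03 x04 x12 x13 x14 x23 x24 x34 :: real
  assumes "tet x01 x23 x02 x13 x12 x03" "tet x01 x24 x02 x14 x12 x04" "tet x01 x34 x03 x14 x13 x04"
    "tet x02 x34 x03 x24 x23 x04" "tet x12 x34 x13 x24 x23 x14"
  shows "(\<forall>x\<in>{x01,x02,x03,x04,x12,x13,x14,x23,x24,x34}. x = x01 \<or> x = 3 * x01) \<or>
   (\<forall>x\<in>{x01,x02,x03,x04,x12,x13,x14,x23,x24,x34}. 3 * x = x01 \<or> x = x01) \<or>
   (\<forall>x\<in>{x01,x02,x03,x04,x12,x13,x14,x23,x24,x34}. x = x01 \<or> x = - x01)"
  using assms unfolding tet_def ball_simps insert_iff
  by (smt (z3) insert_iff empty_iff)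

text \<open>
  Reduces identities between finitely many complex numbers to real ones: all but finitely many \<open>c\<close>
  have this property.
\<close>

lemma separating_functional:
  assumes "finite (Z :: complex set)"
  shows "\<exists>c. \<forall>z\<in>Z. Re z + c * Im z = 0 \<longrightarrow> z = 0"
proof -
  have "finite ((\<lambda>z. - Re z / Im z) ` Z)" using assms by simp
  then obtain c where c: "c \<notin> (\<lambda>z. - Re z / Im z) ` Z"
    using ex_new_if_finite[OF infinite_UNIV_char_0] by blast
  have "z = 0" if "z \<in> Z" "Re z + c * Im z = 0" for z
  proof (cases "Im z = 0")
    case True
    then show ?thesis using that by (simp add: complex_eq_iff)
  next
    case False
    then have "c = - Re z / Im z" using that(2) by (simp add: field_simps)
    then show ?thesis using c that(1) by blast
  qed
  then show ?thesis by blast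
qed

definition tets :: "nat \<Rightarrow> (nat \<Rightarrow> nat \<Rightarrow> 'a::field) \<Rightarrow> bool" where
  "tets n x \<longleftrightarrow> (\<forall>p q r s. distinct [p, q, r, s] \<longrightarrow> p \<le> n \<longrightarrow> q \<le> n \<longrightarrow> r \<le> n \<longrightarrow> s \<le> n \<longrightarrow>
     tet (x p q) (x r s) (x p r) (x q s) (x q r) (x p s))"

text \<open>
  A real linear functional preserves the alternatives of \<open>tet\<close>, and one that separates the finitely
  many combinations in the conclusion also reflects them. The classification of real configurations therefore
  carries over.
\<close>

lemma classify_complex:
  fixes x :: "nat \<Rightarrow> nat \<Rightarrow> complex"
  assumes sym: "symmetric x" and tets: "tets 4 x"
  shows "\<exists>b. (\<forall>i j. i \<noteq> j \<longrightarrow> i \<le> 4 \<longrightarrow> j \<le> 4 \<longrightarrow> x i j = b \<or> x i j = 3 * b) \<or>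
             (\<forall>i j. i \<noteq> j \<longrightarrow> i \<le> 4 \<longrightarrow> j \<le> 4 \<longrightarrow> x i j = b \<or> x i j = - b)"
proof -
  define E where "E = {x 0 1, x 0 2, x 0 3, x 0 4, x 1 2, x 1 3, x 1 4, x 2 3, x 2 4, x 3 4}"
  define D where "D = (\<lambda>e. e - x 0 1) ` E \<union> (\<lambda>e. e - 3 * x 0 1) ` E \<union> (\<lambda>e. 3 * e - x 0 1) ` E \<union> (\<lambda>e. e + x 0 1) ` E"
  have "finite D" unfolding D_def E_def by (intro finite_UnI finite_imageI finite.insertI finite.emptyI)
  then obtain c where c: "\<forall>z\<in>D. Re z + c * Im z = 0 \<longrightarrow> z = 0"
    using separating_functional by blast
  have inD: "e - x 0 1 \<in> D" "e - 3 * x 0 1 \<in> D" "3 * e - x 0 1 \<in> D" "e + x 0 1 \<in> D" if "e \<in> E" for e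
    using that unfolding D_def by blast+
  define f where "f z = Re z + c * Im z" for z
  have f: "f (a + b) = f a + f b" "f (a - b) = f a - f b" "f (2 * a) = 2 * f a" "f (3 * a) = 3 * f a" for a b
    by (auto simp: f_def algebra_simps)
  have ftet: "tet (f a) (f a') (f b) (f b') (f d) (f d')" if "tet a a' b b' d d'" for a a' b b' d d'
    using that unfolding tet_def by (metis f(1,3))
  have t: "tet (x p q) (x r s) (x p r) (x q s) (x q r) (x p s)" if "distinct [p, q, r, s]" "p \<le> 4" "q \<le> 4" "r \<le> 4" "s \<le> 4" for p q r s
    using tets that unfolding tets_def by blast
  have "(\<forall>e\<in>E. f e = f (x 0 1) \<or> f e = 3 * f (x 0 1)) \<or> (\<forall>e\<in>E. 3 * f e = f (x 0 1) \<or> f e = f (x 0 1)) \<or>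
    (\<forall>e\<in>E. f e = f (x 0 1) \<or> f e = - f (x 0 1))"
    using classify_real[OF ftet[OF t[of 0 1 2 3]] ftet[OF t[of 0 1 2 4]] ftet[OF t[of 0 1 3 4]] ftet[OF t[of 0 2 3 4]]
        ftet[OF t[of 1 2 3 4]]]
    unfolding E_def ball_simps by simp
  moreover have "e = x 0 1" if "e \<in> E" "f e = f (x 0 1)" for e
    using bspec[OF c inD(1)[OF that(1)]] that(2) by (auto simp: f_def algebra_simps)
  moreover have "e = 3 * x 0 1" if "e \<in> E" "f e = 3 * f (x 0 1)" for e
    using bspec[OF c inD(2)[OF that(1)]] that(2) by (auto simp: f_def algebra_simps)
  moreover have "3 * e = x 0 1" if "e \<in> E" "3 * f e = f (x 0 1)" for e
    using bspec[OF c inD(3)[OF that(1)]] that(2) by (auto simp: f_def algebra_simps)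
  moreover have "e = - x 0 1" if "e \<in> E" "f e = - f (x 0 1)" for e
    using bspec[OF c inD(4)[OF that(1)]] that(2) by (auto simp: f_def algebra_simps eq_neg_iff_add_eq_0)
  ultimately have "(\<forall>e\<in>E. e = x 0 1 \<or> e = 3 * x 0 1) \<or> (\<forall>e\<in>E. 3 * e = x 0 1 \<or> e = x 0 1) \<or> (\<forall>e\<in>E. e = x 0 1 \<or> e = - x 0 1)"
    by meson
  then consider "\<forall>e\<in>E. e = x 0 1 \<or> e = 3 * x 0 1" | "\<forall>e\<in>E. e = x 0 1 / 3 \<or> e = 3 * (x 0 1 / 3)" | "\<forall>e\<in>E. e = x 0 1 \<or> e = - x 0 1"
    by (elim disjE) (auto simp: field_simps)
  moreover have "x i j \<in> E" if "i \<noteq> j" "i \<le> 4" "j \<le> 4" for i j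
  proof -
    have "i \<in> {0,1,2,3,4}" "j \<in> {0,1,2,3,4}" using that by auto
    then show ?thesis using that(1) unfolding E_def
      using symmetricD[OF sym] by (elim insertE emptyE; simp; metis)
  qed
  ultimately show ?thesis
    by cases blast+
qed

section \<open>Bounded configurations\<close>

lemma simultaneous_subsequence:
  fixes f :: "'e \<Rightarrow> nat \<Rightarrow> complex"
  assumes "finite E" "\<And>e. e \<in> E \<Longrightarrow> \<exists>B. \<forall>m. cmod (f e m) \<le> B"
  shows "\<exists>r l. strict_mono (r :: nat \<Rightarrow> nat) \<and> (\<forall>e\<in>E. (\<lambda>m. f e (r m)) \<longlonglongrightarrow> l e)"
  using assms
proof (induction E rule: finite_induct)
  case empty
  show ?case by (intro exI[of _ id]) (simp add: strict_mono_def)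
next
  case (insert e E)
  then obtain r l where r: "strict_mono (r :: nat \<Rightarrow> nat)" "\<And>e. e \<in> E \<Longrightarrow> (\<lambda>m. f e (r m)) \<longlonglongrightarrow> l e"
    by fastforce
  obtain B where "\<And>m. cmod (f e m) \<le> B" using insert.prems by auto
  then have "bounded (range (\<lambda>m. f e (r m)))" by (intro boundedI) auto
  then obtain l' r' where r': "strict_mono r'" "((\<lambda>m. f e (r m)) \<circ> r') \<longlonglongrightarrow> l'"
    using bounded_imp_convergent_subsequence by blast
  have "(\<lambda>m. f d ((r \<circ> r') m)) \<longlonglongrightarrow> (if d = e then l' else l d)" if "d \<in> insert e E" for d
    using r'(2) that LIMSEQ_subseq_LIMSEQ[OF r(2) r'(1), of d] by (auto simp: o_def)
  then show ?case using strict_mono_o[OF r(1) r'(1)]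
    by (intro exI[of _ "r \<circ> r'"] exI[of _ "\<lambda>d. if d = e then l' else l d"]) blast
qed

definition edges :: "nat \<Rightarrow> (nat \<times> nat) set" where
  "edges n = {(i, j). i \<noteq> j \<and> i \<le> n \<and> j \<le> n}"

lemma finite_edges: "finite (edges n)"
  by (rule finite_subset[of _ "{..n} \<times> {..n}"]) (auto simp: edges_def)

definition converges :: "nat \<Rightarrow> (nat \<Rightarrow> nat \<Rightarrow> nat \<Rightarrow> complex) \<Rightarrow> (nat \<Rightarrow> nat \<Rightarrow> complex) \<Rightarrow> bool" where
  "converges n Z q \<longleftrightarrow> (\<forall>(i, j) \<in> edges n. (\<lambda>m. Z m i j) \<longlonglongrightarrow> q i j)"

lemma convergesD: "converges n Z q \<Longrightarrow> i \<noteq> j \<Longrightarrow> i \<le> n \<Longrightarrow> j \<le> n \<Longrightarrow> (\<lambda>m. Z m i j) \<longlonglongrightarrow> q i j"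
  by (auto simp: converges_def edges_def)

lemma converges_subseq:
  assumes "converges n Z q" "strict_mono r"
  shows "converges n (\<lambda>m. Z (r m)) q"
  using assms LIMSEQ_subseq_LIMSEQ[OF _ assms(2)] by (fastforce simp: converges_def o_def)

lemma convergent_subsequences:
  fixes Z :: "'t \<Rightarrow> nat \<Rightarrow> nat \<Rightarrow> nat \<Rightarrow> complex"
  assumes T: "finite T" and sym: "\<And>t m. symmetric (Z t m)"
    and bd: "\<And>t i j. t \<in> T \<Longrightarrow> (i, j) \<in> edges n \<Longrightarrow> \<exists>B. \<forall>m. cmod (Z t m i j) \<le> B"
  shows "\<exists>r q. strict_mono (r :: nat \<Rightarrow> nat) \<and> (\<forall>t\<in>T. symmetric (q t) \<and> converges n (\<lambda>m. Z t (r m)) (q t))"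
proof -
  have "\<exists>r l. strict_mono (r :: nat \<Rightarrow> nat) \<and> (\<forall>e\<in>T \<times> edges n. (\<lambda>m. (\<lambda>(t, i, j) m. Z t m i j) e (r m)) \<longlonglongrightarrow> l e)"
    by (rule simultaneous_subsequence) (use T finite_edges bd in auto)
  then obtain r l where r: "strict_mono (r :: nat \<Rightarrow> nat)"
    "\<And>t i j. t \<in> T \<Longrightarrow> (i, j) \<in> edges n \<Longrightarrow> (\<lambda>m. Z t (r m) i j) \<longlonglongrightarrow> l (t, i, j)"
    by fastforce
  define q where "q t i j = l (t, min i j, max i j)" for t i j
  have "symmetric (q t)" for t by (auto simp: symmetric_def q_def min_def max_def)
  moreover have "converges n (\<lambda>m. Z t (r m)) (q t)" if "t \<in> T" for t
    unfolding converges_def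
  proof safe
    fix i j assume ij: "(i, j) \<in> edges n"
    then have "(min i j, max i j) \<in> edges n" by (auto simp: edges_def min_def max_def)
    from r(2)[OF that this] have "(\<lambda>m. Z t (r m) (min i j) (max i j)) \<longlonglongrightarrow> q t i j" by (simp add: q_def)
    moreover have "Z t (r m) (min i j) (max i j) = Z t (r m) i j" for m
      using symmetricD[OF sym, of t "r m" i j] by (auto simp: min_def max_def)
    ultimately show "(\<lambda>m. Z t (r m) i j) \<longlonglongrightarrow> q t i j" by simp
  qed
  ultimately show ?thesis using r(1) by blast
qed

corollary convergent_subsequence:
  fixes Z :: "nat \<Rightarrow> nat \<Rightarrow> nat \<Rightarrow> complex"
  assumes "\<And>m. symmetric (Z m)" "\<And>i j. (i, j) \<in> edges n \<Longrightarrow> \<exists>B. \<forall>m. cmod (Z m i j) \<le> B"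
  shows "\<exists>r q. strict_mono (r :: nat \<Rightarrow> nat) \<and> symmetric q \<and> converges n (\<lambda>m. Z (r m)) q"
  using convergent_subsequences[of "{()}" "\<lambda>_. Z" n] assms by auto

definition edge_norm :: "nat \<Rightarrow> (nat \<Rightarrow> nat \<Rightarrow> complex) \<Rightarrow> real" where
  "edge_norm n x = (\<Sum>(i, j)\<in>edges n. cmod (x i j))"

lemma edge_norm_ge: "(i, j) \<in> edges n \<Longrightarrow> cmod (x i j) \<le> edge_norm n x"
  unfolding edge_norm_def using member_le_sum[of "(i, j)" "edges n" "\<lambda>(i, j). cmod (x i j)"] finite_edges
  by auto

lemma edge_norm_nonneg: "edge_norm n x \<ge> 0"
  unfolding edge_norm_def by (intro sum_nonneg) auto

lemma edge_norm_tendsto: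
  assumes "converges n Z q"
  shows "(\<lambda>m. edge_norm n (Z m)) \<longlonglongrightarrow> edge_norm n q"
  unfolding edge_norm_def using assms by (auto simp: converges_def intro!: tendsto_sum tendsto_norm)

lemma edge_norm_eq_0: "edge_norm n x = 0 \<longleftrightarrow> (\<forall>(i, j)\<in>edges n. x i j = 0)"
  unfolding edge_norm_def by (subst sum_nonneg_eq_0_iff) (auto simp: finite_edges)

lemma face_tendsto:
  assumes "converges n Z q" "i \<noteq> j" "j \<noteq> k" "i \<noteq> k" "i \<le> n" "j \<le> n" "k \<le> n"
  shows "(\<lambda>m. face (Z m) i j k) \<longlonglongrightarrow> face q i j k"
  unfolding face_def heron_def using convergesD[OF assms(1)] assms(2-) by (intro tendsto_intros) auto

lemma limit_tets:
  assumes sym: "\<And>m. symmetric (Z m)" and faces: "faces_tend n Z" and L: "\<And>m. L m \<ge> 1"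
    and lim: "converges n (\<lambda>m i j. Z m i j / complex_of_real (L m)) q"
  shows "tets n q"
  unfolding tets_def
proof (intro allI impI)
  fix p q' r s assume d: "distinct [p, q', r, s]" and n: "p \<le> n" "q' \<le> n" "r \<le> n" "s \<le> n"
  have c: "Z m i j = Z m j i" for m i j by (rule symmetricD[OF sym])
  note F = faces_tend_face[OF sym faces, unfolded face_def]
  show "tet (q p q') (q r s) (q p r) (q q' s) (q q' r) (q p s)"
  proof (rule tet_limit[OF L])
    show "(\<lambda>m. heron (Z m p q') (Z m p r) (Z m q' r)) \<longlonglongrightarrow> 3"
      using F[of q' p r] d n by (simp add: c[of _ q' p] c[of _ r q'])
    show "(\<lambda>m. heron (Z m p q') (Z m q' s) (Z m p s)) \<longlonglongrightarrow> 3"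
      using F[of p q' s] d n by (simp add: c[of _ s p])
    show "(\<lambda>m. heron (Z m r s) (Z m p r) (Z m p s)) \<longlonglongrightarrow> 3"
      using F[of s r p] d n by (simp add: c[of _ s r] c[of _ r p])
    show "(\<lambda>m. heron (Z m r s) (Z m q' s) (Z m q' r)) \<longlonglongrightarrow> 3"
      using F[of r s q'] d n by (simp add: c[of _ s q'])
  qed (use convergesD[OF lim] d n in auto)
qed

lemma face_scale: "face (\<lambda>i j. c * x i j) i j k = c ^ 2 * face x i j k"
  by (simp add: face_def heron_def algebra_simps power2_eq_square)

text \<open>
  In both cases of the classification a face is a nonzero multiple of \<open>b\<^sup>2\<close>.
\<close>

lemma tets_faces_zero:
  fixes q :: "nat \<Rightarrow> nat \<Rightarrow> complex"
  assumes "symmetric q" "tets 4 q" "\<And>i j k. i < j \<Longrightarrow> j < k \<Longrightarrow> k \<le> 4 \<Longrightarrow> face q i j k = 0"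
    and ij: "i \<noteq> j" "i \<le> 4" "j \<le> 4"
  shows "q i j = 0"
proof -
  obtain b where b: "(\<forall>i j. i \<noteq> j \<longrightarrow> i \<le> 4 \<longrightarrow> j \<le> 4 \<longrightarrow> q i j = b \<or> q i j = 3 * b) \<or>
             (\<forall>i j. i \<noteq> j \<longrightarrow> i \<le> 4 \<longrightarrow> j \<le> 4 \<longrightarrow> q i j = b \<or> q i j = - b)"
    using classify_complex[OF assms(1,2)] by blast
  have "q 0 1 \<in> {b, 3 * b} \<and> q 1 2 \<in> {b, 3 * b} \<and> q 2 0 \<in> {b, 3 * b} \<or>
    q 0 1 \<in> {b, - b} \<and> q 1 2 \<in> {b, - b} \<and> q 2 0 \<in> {b, - b}"
    using b
  proof
    assume b: "\<forall>i j. i \<noteq> j \<longrightarrow> i \<le> 4 \<longrightarrow> j \<le> 4 \<longrightarrow> q i j = b \<or> q i j = 3 * b"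
    show ?thesis using b[rule_format, of 0 1] b[rule_format, of 1 2] b[rule_format, of 2 0] by simp
  next
    assume b: "\<forall>i j. i \<noteq> j \<longrightarrow> i \<le> 4 \<longrightarrow> j \<le> 4 \<longrightarrow> q i j = b \<or> q i j = - b"
    show ?thesis using b[rule_format, of 0 1] b[rule_format, of 1 2] b[rule_format, of 2 0] by simp
  qed
  moreover have "face q 0 1 2 = 0" using assms(3)[of 0 1 2] by simp
  ultimately have "b = 0"
    unfolding face_def heron_def by (auto simp: power2_eq_square algebra_simps)
  then show ?thesis using b ij by auto
qed

text \<open>
  Otherwise divide an unbounded subsequence by its norm. The limit has norm 1 and all its faces are
  \<open>0\<close>, but it satisfies the relations \<open>tets\<close> and so vanishes by
  \<open>tets_faces_zero\<close>.
\<close>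

lemma faces_tend_bounded:
  assumes sym: "\<And>m. symmetric (Z m)" and faces: "faces_tend 4 Z"
  shows "\<exists>B. \<forall>m. edge_norm 4 (Z m) \<le> B"
proof (rule ccontr)
  assume unbounded: "\<nexists>B. \<forall>m. edge_norm 4 (Z m) \<le> B"
  have "\<exists>k>m. edge_norm 4 (Z k) > real m" for m
  proof (rule ccontr)
    assume *: "\<not> ?thesis"
    have "edge_norm 4 (Z k) \<le> real m + (\<Sum>l\<le>m. edge_norm 4 (Z l))" for k
    proof (cases "k \<le> m")
      case True
      then have "edge_norm 4 (Z k) \<le> (\<Sum>l\<le>m. edge_norm 4 (Z l))"
        by (intro member_le_sum) (auto simp: edge_norm_nonneg)
      then show ?thesis by simp
    next
      case False
      moreover have "(\<Sum>l\<le>m. edge_norm 4 (Z l)) \<ge> 0" by (intro sum_nonneg edge_norm_nonneg)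
      moreover have "edge_norm 4 (Z k) \<le> real m" using * False by (meson not_le)
      ultimately show ?thesis by linarith
    qed
    then show False using unbounded by blast
  qed
  then obtain r0 where r0: "\<And>m. r0 m > m" "\<And>m. edge_norm 4 (Z (r0 m)) > real m" by metis
  define L where "L m = 1 + edge_norm 4 (Z (r0 m))" for m
  have L: "L m \<ge> 1" for m by (simp add: L_def edge_norm_nonneg)
  have Linf: "filterlim L at_top sequentially"
    by (rule filterlim_at_top_mono[OF filterlim_real_sequentially])
      (use r0(2) in \<open>auto simp: L_def intro!: always_eventually less_imp_le add_strict_increasing\<close>)
  define Q where "Q m i j = Z (r0 m) i j / complex_of_real (L m)" for m i j
  have symQ: "symmetric (Q m)" for m using sym[of "r0 m"] by (simp add: Q_def symmetric_def)
  have cmodQ: "cmod (Q m i j) = cmod (Z (r0 m) i j) / L m" for m i j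
    using L[of m] by (simp add: Q_def norm_divide)
  have "cmod (Q m i j) \<le> 1" if "(i, j) \<in> edges 4" for m i j
  proof -
    have "cmod (Z (r0 m) i j) \<le> L m" using edge_norm_ge[OF that, of "Z (r0 m)"] by (simp add: L_def)
    then show ?thesis using L[of m] by (simp add: cmodQ divide_le_eq)
  qed
  then obtain r q where r: "strict_mono (r :: nat \<Rightarrow> nat)" "symmetric q" "converges 4 (\<lambda>m. Q (r m)) q"
    using convergent_subsequence[of Q 4] symQ by blast
  have Lr: "filterlim (\<lambda>m. L (r m)) at_top sequentially"
    using filterlim_compose[OF Linf filterlim_subseq[OF r(1)]] by simp
  have faces': "faces_tend 4 (\<lambda>m. Z (r0 (r m)))"
  proof -
    have "m \<le> r0 (r m)" for m
      using r0(1)[of "r m"] seq_suble[OF r(1), of m] by simp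
    then have "filterlim (\<lambda>m. r0 (r m)) sequentially sequentially"
      by (intro filterlim_at_top_mono[OF filterlim_ident]) (auto intro: always_eventually)
    from filterlim_compose[OF _ this] show ?thesis
      using faces unfolding faces_tend_def by blast
  qed
  have "(\<lambda>m. Q (r m)) = (\<lambda>m i j. Z (r0 (r m)) i j / complex_of_real (L (r m)))"
    by (intro ext) (simp add: Q_def)
  then have "tets 4 q"
    using limit_tets[of "\<lambda>m. Z (r0 (r m))" 4 "\<lambda>m. L (r m)" q] sym faces' L r(3) by simp
  moreover have "face q i j k = 0" if "i < j" "j < k" "k \<le> 4" for i j k
  proof -
    have "face (Q m) i j k = face (Z (r0 m)) i j k * (1 / complex_of_real (L m)) ^ 2" for m
      using face_scale[of "1 / complex_of_real (L m)" "Z (r0 m)" i j k] by (simp add: Q_def[abs_def] mult.commute)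
    moreover have "(\<lambda>m. face (Z (r0 (r m))) i j k * (1 / complex_of_real (L (r m))) ^ 2) \<longlonglongrightarrow> 3 * 0 ^ 2"
    proof (intro tendsto_intros)
      show "(\<lambda>m. face (Z (r0 (r m))) i j k) \<longlonglongrightarrow> 3" using faces' that unfolding faces_tend_def by blast
      have "(\<lambda>m. complex_of_real (1 / L (r m))) \<longlonglongrightarrow> of_real 0"
        by (intro tendsto_of_real real_tendsto_divide_at_top[OF tendsto_const Lr])
      then show "(\<lambda>m. 1 / complex_of_real (L (r m))) \<longlonglongrightarrow> 0" by simp
    qed
    ultimately have "(\<lambda>m. face (Q (r m)) i j k) \<longlonglongrightarrow> 0" by simp
    moreover have "(\<lambda>m. face (Q (r m)) i j k) \<longlonglongrightarrow> face q i j k"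
      using face_tendsto[OF r(3)] that by auto
    ultimately show ?thesis using LIMSEQ_unique by blast
  qed
  ultimately have "q i j = 0" if "(i, j) \<in> edges 4" for i j
    using tets_faces_zero[OF r(2)] that by (auto simp: edges_def)
  then have "edge_norm 4 q = 0" by (auto simp: edge_norm_eq_0)
  moreover have "(\<lambda>m. edge_norm 4 (Q (r m))) \<longlonglongrightarrow> 1"
  proof -
    have "edge_norm 4 (Q m) = 1 - 1 / L m" for m
    proof -
      have "edge_norm 4 (Q m) = edge_norm 4 (Z (r0 m)) / L m"
        by (simp add: edge_norm_def cmodQ case_prod_unfold sum_divide_distrib)
      also have "\<dots> = (L m - 1) / L m" by (simp add: L_def)
      finally show ?thesis using L[of m] by (simp add: diff_divide_distrib)
    qed
    moreover have "(\<lambda>m. 1 - 1 / L (r m)) \<longlonglongrightarrow> 1 - 0"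
      by (intro tendsto_intros real_tendsto_divide_at_top[OF tendsto_const Lr])
    ultimately show ?thesis by simp
  qed
  ultimately show False using edge_norm_tendsto[OF r(3)] LIMSEQ_unique by fastforce
qed

lemma faces_tend_limit:
  assumes sym: "\<And>m. symmetric (Z m)" and faces: "faces_tend n Z" and q: "converges n Z q"
  shows "tets n q" "\<And>i j k. i < j \<Longrightarrow> j < k \<Longrightarrow> k \<le> n \<Longrightarrow> face q i j k = 3"
proof -
  show "tets n q" using limit_tets[OF sym faces, of "\<lambda>_. 1" q] q by simp
  fix i j k assume ijk: "i < j" "j < k" "k \<le> n"
  then have "(\<lambda>m. face (Z m) i j k) \<longlonglongrightarrow> face q i j k" using face_tendsto[OF q] by auto
  moreover have "(\<lambda>m. face (Z m) i j k) \<longlonglongrightarrow> 3" using faces ijk by (simp add: faces_tend_def)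
  ultimately show "face q i j k = 3" using LIMSEQ_unique by blast
qed

section \<open>First order behaviour\<close>

text \<open>
  Half of the derivative of the face \<open>ijk\<close> at \<open>z\<close> in the direction \<open>w\<close>.
  The face is a quadratic form, so this is its polar form.
\<close>

definition polar :: "(nat \<Rightarrow> nat \<Rightarrow> 'a::comm_ring_1) \<Rightarrow> (nat \<Rightarrow> nat \<Rightarrow> 'a) \<Rightarrow> nat \<Rightarrow> nat \<Rightarrow> nat \<Rightarrow> 'a" where
  "polar z w i j k = w i j * (z j k + z k i - z i j) + w j k * (z i j + z k i - z j k) + w k i * (z i j + z j k - z k i)"

lemma face_diff: "face x i j k - face y i j k = polar (\<lambda>i j. x i j + y i j) (\<lambda>i j. x i j - y i j) i j k"
  by (simp add: face_def heron_def polar_def algebra_simps power2_eq_square)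

lemma polar_scale: "polar z (\<lambda>i j. c * w i j) i j k = c * polar z w i j k"
  by (simp add: polar_def algebra_simps)

lemma polar_scale_left: "polar (\<lambda>i j. c * z i j) w i j k = c * polar z w i j k"
  by (simp add: polar_def algebra_simps)

lemma polar_tendsto:
  assumes "converges n Z z" "converges n W w" "i < j" "j < k" "k \<le> n"
  shows "(\<lambda>m. polar (Z m) (W m) i j k) \<longlonglongrightarrow> polar z w i j k"
  unfolding polar_def using convergesD[OF assms(1)] convergesD[OF assms(2)] assms(3-)
  by (intro tendsto_intros) auto

lemma converges_add:
  "converges n Y y \<Longrightarrow> converges n Z z \<Longrightarrow> converges n (\<lambda>m i j. Y m i j + Z m i j) (\<lambda>i j. y i j + z i j)"
  unfolding converges_def by (auto intro!: tendsto_add)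

lemma converges_const: "converges n (\<lambda>_. z) z"
  by (simp add: converges_def)

lemma converges_compose:
  assumes "converges n Z z" "filterlim r sequentially sequentially"
  shows "converges n (\<lambda>m. Z (r m)) z"
  unfolding converges_def
proof safe
  fix i j assume "(i, j) \<in> edges n"
  then have "(\<lambda>m. Z m i j) \<longlonglongrightarrow> z i j" using assms(1) unfolding converges_def by blast
  from filterlim_compose[OF this assms(2)] show "(\<lambda>m. Z (r m) i j) \<longlonglongrightarrow> z i j" .
qed

text \<open>
  The derivative at \<open>z\<close> of the map from configurations to their faces is injective.
\<close>

definition nondegenerate :: "nat \<Rightarrow> (nat \<Rightarrow> nat \<Rightarrow> complex) \<Rightarrow> bool" where
  "nondegenerate n z \<longleftrightarrow> (\<forall>w. symmetric w \<longrightarrow> (\<forall>i j k. i < j \<longrightarrow> j < k \<longrightarrow> k \<le> n \<longrightarrow> polar z w i j k = 0) \<longrightarrow>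
     (\<forall>(i, j)\<in>edges n. w i j = 0))"

lemma normalized_subsequence:
  assumes sym: "\<And>m. symmetric (D m)" and pos: "\<And>m. edge_norm n (D m) > 0"
  shows "\<exists>r w. strict_mono (r :: nat \<Rightarrow> nat) \<and> symmetric w \<and> edge_norm n w = 1 \<and>
    converges n (\<lambda>m i j. (1 / complex_of_real (edge_norm n (D (r m)))) * D (r m) i j) w"
proof -
  define W where "W m i j = (1 / complex_of_real (edge_norm n (D m))) * D m i j" for m i j
  have cmodW: "cmod (W m i j) = cmod (D m i j) / edge_norm n (D m)" for m i j
    using pos[of m] by (simp add: W_def norm_divide)
  have "symmetric (W m)" for m using sym[of m] by (simp add: W_def symmetric_def)
  moreover have "cmod (W m i j) \<le> 1" if "(i, j) \<in> edges n" for m i j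
    using edge_norm_ge[OF that, of "D m"] pos[of m] by (simp add: cmodW divide_le_eq)
  ultimately obtain r w where r: "strict_mono (r :: nat \<Rightarrow> nat)" "symmetric w" "converges n (\<lambda>m. W (r m)) w"
    using convergent_subsequence[of W n] by blast
  have "edge_norm n (W m) = 1" for m
  proof -
    have "edge_norm n (W m) = (\<Sum>(i, j)\<in>edges n. cmod (D m i j) / edge_norm n (D m))"
      by (simp add: edge_norm_def[of n "W m"] cmodW)
    also have "\<dots> = edge_norm n (D m) / edge_norm n (D m)"
      by (simp only: edge_norm_def[of n "D m"] case_prod_unfold flip: sum_divide_distrib)
    finally have "edge_norm n (W m) = edge_norm n (D m) / edge_norm n (D m)" .
    then show ?thesis using pos[of m] by simp
  qed
  then have "(\<lambda>m. 1) \<longlonglongrightarrow> edge_norm n w" using edge_norm_tendsto[OF r(3)] by simp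
  from LIMSEQ_unique[OF tendsto_const this] have "edge_norm n w = 1" by simp
  moreover have "(\<lambda>m. W (r m)) = (\<lambda>m i j. (1 / complex_of_real (edge_norm n (D (r m)))) * D (r m) i j)"
    by (intro ext) (simp add: W_def)
  ultimately show ?thesis using r by auto
qed

text \<open>
  Otherwise the normalised differences of the two sequences have a limit of norm 1, which the derivative at
  \<open>z\<close> sends to \<open>0\<close> by \<open>face_diff\<close>.
\<close>

lemma nondegenerate_locally_injective:
  assumes z: "nondegenerate n z"
    and y: "\<And>m. symmetric (y m)" "\<And>m. symmetric (y' m)" "converges n y z" "converges n y' z"
    and same: "\<And>m. same_areas n (y m) (y' m)"
  shows "\<exists>m. \<forall>(i, j)\<in>edges n. y m i j = y' m i j"
proof (rule ccontr)
  assume *: "\<not> ?thesis"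
  define D where "D m i j = y m i j - y' m i j" for m i j
  have symD: "symmetric (D m)" for m using y(1,2)[of m] by (simp add: D_def symmetric_def)
  have "edge_norm n (D m) > 0" for m
    using * edge_norm_nonneg[of n "D m"] edge_norm_eq_0[of n "D m"] by (force simp: D_def less_le)
  from normalized_subsequence[of D n, OF symD this] obtain r w where
    r: "strict_mono (r :: nat \<Rightarrow> nat)" "symmetric w" "edge_norm n w = 1"
      "converges n (\<lambda>m i j. (1 / complex_of_real (edge_norm n (D (r m)))) * D (r m) i j) w"
    by (elim exE conjE) (rule that; assumption)
  have S: "converges n (\<lambda>m i j. y (r m) i j + y' (r m) i j) (\<lambda>i j. 2 * z i j)"
    unfolding mult_2 by (intro converges_add converges_subseq[OF _ r(1)] y)
  have "polar z w i j k = 0" if ijk: "i < j" "j < k" "k \<le> n" for i j k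
  proof -
    have "polar (\<lambda>i j. y m i j + y' m i j) (D m) i j k = 0" for m
      using same[of m] face_diff[of "y m" i j k "y' m"] ijk
      by (simp add: same_areas_def face_def D_def[abs_def])
    then have "(\<lambda>m. 0) \<longlonglongrightarrow> polar (\<lambda>i j. 2 * z i j) w i j k"
      using polar_tendsto[OF S r(4) ijk] unfolding polar_scale by simp
    from LIMSEQ_unique[OF tendsto_const this] show ?thesis by (simp add: polar_scale_left)
  qed
  then have "\<forall>(i, j)\<in>edges n. w i j = 0" using z r(2) unfolding nondegenerate_def by blast
  then have "edge_norm n w = 0" by (simp add: edge_norm_eq_0)
  then show False using r(3) by simp
qed

text \<open>
  If the difference quotients were unbounded, their normalised limit would be a nonzero vector in the kernel of
  the derivative.
\<close>

lemma first_order_bounded: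
  assumes z: "nondegenerate n z" "symmetric z"
    and y: "\<And>m. symmetric (y m)" "converges n y z"
    and \<tau>: "\<And>m. \<tau> m > 0"
    and lim: "\<And>i j k. i < j \<Longrightarrow> j < k \<Longrightarrow> k \<le> n \<Longrightarrow>
      (\<lambda>m. (face (y m) i j k - face z i j k) / complex_of_real (\<tau> m)) \<longlonglongrightarrow> \<sigma> i j k"
  shows "\<exists>B. \<forall>m. edge_norm n (\<lambda>i j. (y m i j - z i j) / complex_of_real (\<tau> m)) \<le> B"
proof (rule ccontr)
  assume unbounded: "\<not> ?thesis"
  define D where "D m i j = (y m i j - z i j) / complex_of_real (\<tau> m)" for m i j
  have symD: "symmetric (D m)" for m using y(1)[of m] z(2) by (simp add: D_def symmetric_def)
  have "\<exists>k>m. edge_norm n (D k) > real m" for m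
  proof (rule ccontr)
    assume *: "\<not> ?thesis"
    have "edge_norm n (D k) \<le> real m + (\<Sum>l\<le>m. edge_norm n (D l))" for k
    proof (cases "k \<le> m")
      case True
      then have "edge_norm n (D k) \<le> (\<Sum>l\<le>m. edge_norm n (D l))"
        by (intro member_le_sum) (auto simp: edge_norm_nonneg)
      then show ?thesis by simp
    next
      case False
      moreover have "(\<Sum>l\<le>m. edge_norm n (D l)) \<ge> 0" by (intro sum_nonneg edge_norm_nonneg)
      moreover have "edge_norm n (D k) \<le> real m" using * False by (meson not_le)
      ultimately show ?thesis by linarith
    qed
    then show False using unbounded unfolding D_def by blast
  qed
  then obtain r0 where r0: "\<And>m. r0 m > m" "\<And>m. edge_norm n (D (r0 m)) > real m" by metis
  have "edge_norm n (D (r0 m)) > 0" for m using r0(2)[of m] by (meson le_less_trans of_nat_0_le_iff)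
  from normalized_subsequence[of "\<lambda>m. D (r0 m)", OF symD this] obtain r w where
    r: "strict_mono (r :: nat \<Rightarrow> nat)" "symmetric w" "edge_norm n w = 1"
      "converges n (\<lambda>m i j. (1 / complex_of_real (edge_norm n (D (r0 (r m))))) * D (r0 (r m)) i j) w"
    by (elim exE conjE) (rule that; assumption)
  have "m \<le> r0 (r m)" for m
    using r0(1)[of "r m"] seq_suble[OF r(1), of m] by simp
  then have r0r: "filterlim (\<lambda>m. r0 (r m)) sequentially sequentially"
    by (intro filterlim_at_top_mono[OF filterlim_ident]) (auto intro: always_eventually)
  have "real m \<le> edge_norm n (D (r0 (r m)))" for m
    using r0(2)[of "r m"] seq_suble[OF r(1), of m] by linarith
  then have inf: "filterlim (\<lambda>m. edge_norm n (D (r0 (r m)))) at_top sequentially"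
    by (intro filterlim_at_top_mono[OF filterlim_real_sequentially]) (auto intro: always_eventually)
  have S: "converges n (\<lambda>m i j. y (r0 (r m)) i j + z i j) (\<lambda>i j. 2 * z i j)"
    unfolding mult_2 by (intro converges_add converges_const converges_compose[OF y(2) r0r])
  have "polar z w i j k = 0" if ijk: "i < j" "j < k" "k \<le> n" for i j k
  proof -
    have "(face (y m) i j k - face z i j k) / complex_of_real (\<tau> m) = polar (\<lambda>i j. y m i j + z i j) (D m) i j k" for m
      unfolding face_diff by (simp add: D_def[abs_def] polar_def add_divide_distrib)
    then have "(\<lambda>m. polar (\<lambda>i j. y (r0 (r m)) i j + z i j) (D (r0 (r m))) i j k) \<longlonglongrightarrow> \<sigma> i j k"
      using filterlim_compose[OF lim[OF ijk] r0r] by simp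
    moreover have "(\<lambda>m. complex_of_real (1 / edge_norm n (D (r0 (r m))))) \<longlonglongrightarrow> of_real 0"
      by (intro tendsto_of_real real_tendsto_divide_at_top[OF tendsto_const inf])
    ultimately have A: "(\<lambda>m. complex_of_real (1 / edge_norm n (D (r0 (r m)))) * polar (\<lambda>i j. y (r0 (r m)) i j + z i j) (D (r0 (r m))) i j k)
      \<longlonglongrightarrow> of_real 0 * \<sigma> i j k" by (intro tendsto_mult)
    have B: "(\<lambda>m. complex_of_real (1 / edge_norm n (D (r0 (r m)))) * polar (\<lambda>i j. y (r0 (r m)) i j + z i j) (D (r0 (r m))) i j k)
      \<longlonglongrightarrow> polar (\<lambda>i j. 2 * z i j) w i j k"
      using polar_tendsto[OF S r(4) ijk] unfolding polar_scale by simp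
    from LIMSEQ_unique[OF B A] have "polar (\<lambda>i j. 2 * z i j) w i j k = 0" by simp
    then show ?thesis by (simp add: polar_scale_left)
  qed
  then have "\<forall>(i, j)\<in>edges n. w i j = 0" using z r(2) unfolding nondegenerate_def by blast
  then have "edge_norm n w = 0" by (simp add: edge_norm_eq_0)
  then show False using r(3) by simp
qed

lemma first_order_limit:
  assumes z: "symmetric z" and y: "converges n y z"
    and lim: "\<And>i j k. i < j \<Longrightarrow> j < k \<Longrightarrow> k \<le> n \<Longrightarrow>
      (\<lambda>m. (face (y m) i j k - face z i j k) / complex_of_real (\<tau> m)) \<longlonglongrightarrow> \<sigma> i j k"
    and w: "converges n (\<lambda>m i j. (y m i j - z i j) / complex_of_real (\<tau> m)) w"
    and ijk: "i < j" "j < k" "k \<le> n"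
  shows "2 * polar z w i j k = \<sigma> i j k"
proof -
  have S: "converges n (\<lambda>m i j. y m i j + z i j) (\<lambda>i j. 2 * z i j)"
    unfolding mult_2 by (intro converges_add converges_const y)
  have "(face (y m) i j k - face z i j k) / complex_of_real (\<tau> m) =
    polar (\<lambda>i j. y m i j + z i j) (\<lambda>i j. (y m i j - z i j) / complex_of_real (\<tau> m)) i j k" for m
    unfolding face_diff by (simp add: polar_def add_divide_distrib)
  then have "(\<lambda>m. (face (y m) i j k - face z i j k) / complex_of_real (\<tau> m)) \<longlonglongrightarrow> polar (\<lambda>i j. 2 * z i j) w i j k"
    using polar_tendsto[OF S w ijk] by simp
  from LIMSEQ_unique[OF this lim[OF ijk]] have "polar (\<lambda>i j. 2 * z i j) w i j k = \<sigma> i j k" .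
  then show ?thesis by (simp add: polar_scale_left)
qed

text \<open>
  The entries are listed in the order 01, 02, 03, 04, 12, 13, 14, 23, 24, 34.
\<close>

definition conf :: "'a list \<Rightarrow> nat \<Rightarrow> nat \<Rightarrow> 'a" where
  "conf l i j = l ! ([0, 3, 5, 6] ! min i j + max i j - 1)"

lemma symmetric_conf: "symmetric (conf l)"
  unfolding symmetric_def conf_def by (metis min.commute max.commute)

lemma conf_simps:
  "conf l 1 0 = l ! 0" "conf l 2 0 = l ! 1" "conf l 3 0 = l ! 2" "conf l 4 0 = l ! 3" "conf l 2 1 = l ! 4"
  "conf l 3 1 = l ! 5" "conf l 4 1 = l ! 6" "conf l 3 2 = l ! 7" "conf l 4 2 = l ! 8" "conf l 4 3 = l ! 9"
  by (simp_all add: conf_def min_def max_def numeral_eq_Suc)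

text \<open>
  For each of the 26 matchings of the complete graph on five vertices, the configuration with \<open>3\<close>
  on its edges and \<open>1\<close> elsewhere, together with the entry on the edge 01 of the solution
  \<open>w\<close> of the linear system with right-hand side \<open>test_direction\<close>.
\<close>

definition matching_table :: "(real list \<times> real) list" where
  "matching_table =
   [([1, 1, 1, 1, 1, 1, 1, 1, 1, 1], 2 / 3),
    ([1, 1, 1, 1, 1, 1, 1, 1, 1, 3], 7 / 3),
    ([1, 1, 1, 1, 1, 1, 1, 1, 3, 1], 5 / 3),
    ([1, 1, 1, 1, 1, 1, 1, 3, 1, 1], 10 / 9),
    ([1, 1, 1, 1, 1, 1, 3, 1, 1, 1], 5 / 9),
    ([1, 1, 1, 1, 1, 1, 3, 3, 1, 1], 1),
    ([1, 1, 1, 1, 1, 3, 1, 1, 1, 1], 14 / 9),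
    ([1, 1, 1, 1, 1, 3, 1, 1, 3, 1], 23 / 9),
    ([1, 1, 1, 1, 3, 1, 1, 1, 1, 1], -1 / 3),
    ([1, 1, 1, 1, 3, 1, 1, 1, 1, 3], 4 / 3),
    ([1, 1, 1, 3, 1, 1, 1, 1, 1, 1], -1 / 9),
    ([1, 1, 1, 3, 1, 1, 1, 3, 1, 1], 1 / 3),
    ([1, 1, 1, 3, 1, 3, 1, 1, 1, 1], 7 / 9),
    ([1, 1, 1, 3, 3, 1, 1, 1, 1, 1], -10 / 9),
    ([1, 1, 3, 1, 1, 1, 1, 1, 1, 1], 17 / 9),
    ([1, 1, 3, 1, 1, 1, 1, 1, 3, 1], 26 / 9),
    ([1, 1, 3, 1, 1, 1, 3, 1, 1, 1], 16 / 9),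
    ([1, 1, 3, 1, 3, 1, 1, 1, 1, 1], 8 / 9),
    ([1, 3, 1, 1, 1, 1, 1, 1, 1, 1], -4 / 9),
    ([1, 3, 1, 1, 1, 1, 1, 1, 1, 3], 11 / 9),
    ([1, 3, 1, 1, 1, 1, 3, 1, 1, 1], -5 / 9),
    ([1, 3, 1, 1, 1, 3, 1, 1, 1, 1], 4 / 9),
    ([3, 1, 1, 1, 1, 1, 1, 1, 1, 1], 26 / 3),
    ([3, 1, 1, 1, 1, 1, 1, 1, 1, 3], 11 / 3),
    ([3, 1, 1, 1, 1, 1, 1, 1, 3, 1], 17 / 3),
    ([3, 1, 1, 1, 1, 1, 1, 3, 1, 1], 22 / 3)]"

text \<open>
  The splittings of the ten edges into two complementary 5-cycles, with sign \<open>1\<close> on the cycle that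
  contains the edge 01 and \<open>-1\<close> on the other, again with the entry of the solution for
  \<open>test_direction\<close>.
\<close>

definition pentagon_table :: "(real list \<times> real) list" where
  "pentagon_table =
   [([1, 1, -1, -1, -1, 1, -1, -1, 1, 1], -56 / 25),
    ([1, 1, -1, -1, -1, -1, 1, 1, -1, 1], 34 / 25),
    ([1, -1, 1, -1, 1, -1, -1, -1, 1, 1], -36 / 25),
    ([1, -1, 1, -1, -1, -1, 1, 1, 1, -1], -51 / 25),
    ([1, -1, -1, 1, 1, -1, -1, 1, -1, 1], 9 / 25),
    ([1, -1, -1, 1, -1, 1, -1, 1, 1, -1], -96 / 25)]"

text \<open>
  A direction for the ten faces that separates the 64 limit points to first order. Since it exists, almost every
  direction has this property; this one has small integral entries.
\<close>

definition test_direction :: "nat \<Rightarrow> nat \<Rightarrow> nat \<Rightarrow> real" where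
  "test_direction i j k = (if i = 0 then if j = 1 then (if k = 2 then 8 else if k = 3 then 0 else 8)
     else if j = 2 then (if k = 3 then 4 else 2) else 7
   else if i = 1 then (if j = 2 then if k = 3 then 0 else 7 else 8) else 0)"

section \<open>Linear systems at the limit points\<close>

lemma all_triples_4:
  "(\<forall>i j k. i < j \<longrightarrow> j < k \<longrightarrow> k \<le> (4::nat) \<longrightarrow> P i j k) \<longleftrightarrow>
    P 0 1 2 \<and> P 0 1 3 \<and> P 0 1 4 \<and> P 0 2 3 \<and> P 0 2 4 \<and> P 0 3 4 \<and> P 1 2 3 \<and> P 1 2 4 \<and> P 1 3 4 \<and> P 2 3 4"
  (is "?L = ?R")
proof
  assume ?R
  show ?L
  proof (intro allI impI)
    fix i j k :: nat assume "i < j" "j < k" "k \<le> 4"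
    then have "i \<in> {0,1,2}" "j \<in> {1,2,3}" "k \<in> {2,3,4}" by auto
    with \<open>i < j\<close> \<open>j < k\<close> \<open>?R\<close> show "P i j k" by auto
  qed
qed auto

lemma all_edges_4:
  assumes "\<And>i j. P i j \<Longrightarrow> P j i"
  shows "(\<forall>(i, j)\<in>edges 4. P i j) \<longleftrightarrow>
    P 0 1 \<and> P 0 2 \<and> P 0 3 \<and> P 0 4 \<and> P 1 2 \<and> P 1 3 \<and> P 1 4 \<and> P 2 3 \<and> P 2 4 \<and> P 3 4"
  (is "?L = ?R")
proof
  assume R: ?R
  show ?L
  proof safe
    fix i j assume ij: "(i, j) \<in> edges 4"
    have *: "P a b" if "a < b" "b \<le> 4" for a b
    proof -
      have "a \<in> {0,1,2,3}" "b \<in> {1,2,3,4}" using that by auto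
      then show ?thesis using R that(1) by auto
    qed
    show "P i j"
      using *[of i j] *[of j i] assms[of j i] ij by (cases "i < j") (auto simp: edges_def)
  qed
qed (auto simp: edges_def)

text \<open>
  The linear equation of a face of a configuration with entries \<open>\<plusminus>1\<close> that are not all
  equal; the three Booleans tell which of the entries are negative.
\<close>

definition pentagon_row :: "bool \<Rightarrow> bool \<Rightarrow> bool \<Rightarrow> real \<Rightarrow> real \<Rightarrow> real \<Rightarrow> real \<Rightarrow> bool" where
  "pentagon_row a b c x y z s \<longleftrightarrow> (b = c \<and> a \<noteq> b \<and> s = (if b then - 1 else 1) * (3 * x - y - z)) \<or>
    (a = c \<and> b \<noteq> a \<and> s = (if a then - 1 else 1) * (3 * y - x - z)) \<or>
    (a = b \<and> c \<noteq> a \<and> s = (if a then - 1 else 1) * (3 * z - x - y))"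

lemma pentagon_row_nonmono: "pentagon_row a b c x y z s \<Longrightarrow> \<not> (a = b \<and> b = c)"
  by (auto simp: pentagon_row_def)

lemma pentagon_row_0:
  "pentagon_row a b c x y z 0 \<Longrightarrow> (b = c \<and> a \<noteq> b \<and> 3 * x = y + z) \<or> (a = c \<and> b \<noteq> a \<and> 3 * y = x + z) \<or>
    (a = b \<and> c \<noteq> a \<and> 3 * z = x + y)"
  by (auto simp: pentagon_row_def split: if_splits)

lemma pentagon_kernel:
  fixes w01 w02 w03 w04 w12 w13 w14 w23 w24 w34 :: real
  assumes "pentagon_row b01 b12 b02 w01 w12 w02 0" "pentagon_row b01 b13 b03 w01 w13 w03 0" "pentagon_row b01 b14 b04 w01 w14 w04 0" "pentagon_row b02 b23 b03 w02 w23 w03 0" "pentagon_row b02 b24 b04 w02 w24 w04 0" "pentagon_row b03 b34 b04 w03 w34 w04 0" "pentagon_row b12 b23 b13 w12 w23 w13 0" "pentagon_row b12 b24 b14 w12 w24 w14 0" "pentagon_row b13 b34 b14 w13 w34 w14 0" "pentagon_row b23 b34 b24 w23 w34 w24 0"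
  shows "w01 = 0 \<and> w02 = 0 \<and> w03 = 0 \<and> w04 = 0 \<and> w12 = 0 \<and> w13 = 0 \<and> w14 = 0 \<and> w23 = 0 \<and> w24 = 0 \<and> w34 = 0"
  using assms[THEN pentagon_row_0] by (smt (z3))

text \<open>
  The inverse of the inclusion matrix of edges in triangles on five vertices, in its first row.
\<close>

lemma regular_solution:
  fixes x01 x02 x03 x04 x12 x13 x14 x23 x24 x34 :: real
  assumes "x01 + x12 + x02 = g012" "x01 + x13 + x03 = g013" "x01 + x14 + x04 = g014" "x02 + x23 + x03 = g023" "x02 + x24 + x04 = g024" "x03 + x34 + x04 = g034" "x12 + x23 + x13 = g123" "x12 + x24 + x14 = g124" "x13 + x34 + x14 = g134" "x23 + x34 + x24 = g234"
  shows "x01 = (g012 + g013 + g014 + g234) / 3 - (g023 + g024 + g034 + g123 + g124 + g134) / 6"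
  unfolding assms[symmetric] by (simp add: field_simps)

lemma regular_kernel:
  fixes x01 x02 x03 x04 x12 x13 x14 x23 x24 x34 :: real
  assumes "x01 + x12 + x02 = 0" "x01 + x13 + x03 = 0" "x01 + x14 + x04 = 0" "x02 + x23 + x03 = 0" "x02 + x24 + x04 = 0" "x03 + x34 + x04 = 0" "x12 + x23 + x13 = 0" "x12 + x24 + x14 = 0" "x13 + x34 + x14 = 0" "x23 + x34 + x24 = 0"
  shows "x01 = 0 \<and> x02 = 0 \<and> x03 = 0 \<and> x04 = 0 \<and> x12 = 0 \<and> x13 = 0 \<and> x14 = 0 \<and> x23 = 0 \<and> x24 = 0 \<and> x34 = 0"
  using assms by (smt (z3))

text \<open>
  At a face with entries 1 and 3, dividing the unknowns by \<open>3 - 2 * e\<close>, which is \<open>1\<close>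
  or \<open>-3\<close>, turns the equation into that of the regular simplex. The 26 systems thus reduce to one.
\<close>

lemma matching_row:
  fixes x y z s e1 e2 e3 :: real
  assumes "e1 \<in> {1, 3}" "e2 \<in> {1, 3}" "e3 \<in> {1, 3}" "heron e1 e2 e3 = 3"
    and "x * (e2 + e3 - e1) + y * (e1 + e3 - e2) + z * (e1 + e2 - e3) = s"
  shows "x / (3 - 2 * e1) + y / (3 - 2 * e2) + z / (3 - 2 * e3) = s / (e1 * e2 * e3)"
  using assms by (auto simp: heron_def)

lemma matching_membership:
  assumes "\<not> (b01 \<and> b12)" "\<not> (b12 \<and> b02)" "\<not> (b01 \<and> b02)"
    "\<not> (b01 \<and> b13)" "\<not> (b13 \<and> b03)" "\<not> (b01 \<and> b03)"
    "\<not> (b01 \<and> b14)" "\<not> (b14 \<and> b04)" "\<not> (b01 \<and> b04)"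
    "\<not> (b02 \<and> b23)" "\<not> (b23 \<and> b03)" "\<not> (b02 \<and> b03)"
    "\<not> (b02 \<and> b24)" "\<not> (b24 \<and> b04)" "\<not> (b02 \<and> b04)"
    "\<not> (b03 \<and> b34)" "\<not> (b34 \<and> b04)" "\<not> (b03 \<and> b04)"
    "\<not> (b12 \<and> b23)" "\<not> (b23 \<and> b13)" "\<not> (b12 \<and> b13)"
    "\<not> (b12 \<and> b24)" "\<not> (b24 \<and> b14)" "\<not> (b12 \<and> b14)"
    "\<not> (b13 \<and> b34)" "\<not> (b34 \<and> b14)" "\<not> (b13 \<and> b14)"
    "\<not> (b23 \<and> b34)" "\<not> (b34 \<and> b24)" "\<not> (b23 \<and> b24)"
  shows "[if b01 then 3 else 1, if b02 then 3 else 1, if b03 then 3 else 1, if b04 then 3 else 1, if b12 then 3 else 1, if b13 then 3 else 1, if b14 then 3 else 1, if b23 then 3 else 1, if b24 then 3 else 1, if b34 then 3 else 1] \<in> set (map fst matching_table)"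
proof -
  have "\<not> b01 \<and> \<not> b02 \<and> \<not> b03 \<and> \<not> b04 \<and> \<not> b12 \<and> \<not> b13 \<and> \<not> b14 \<and> \<not> b23 \<and> \<not> b24 \<and> \<not> b34 \<or>
    \<not> b01 \<and> \<not> b02 \<and> \<not> b03 \<and> \<not> b04 \<and> \<not> b12 \<and> \<not> b13 \<and> \<not> b14 \<and> \<not> b23 \<and> \<not> b24 \<and> b34 \<or>
    \<not> b01 \<and> \<not> b02 \<and> \<not> b03 \<and> \<not> b04 \<and> \<not> b12 \<and> \<not> b13 \<and> \<not> b14 \<and> \<not> b23 \<and> b24 \<and> \<not> b34 \<or>
    \<not> b01 \<and> \<not> b02 \<and> \<not> b03 \<and> \<not> b04 \<and> \<not> b12 \<and> \<not> b13 \<and> \<not> b14 \<and> b23 \<and> \<not> b24 \<and> \<not> b34 \<or>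
    \<not> b01 \<and> \<not> b02 \<and> \<not> b03 \<and> \<not> b04 \<and> \<not> b12 \<and> \<not> b13 \<and> b14 \<and> \<not> b23 \<and> \<not> b24 \<and> \<not> b34 \<or>
    \<not> b01 \<and> \<not> b02 \<and> \<not> b03 \<and> \<not> b04 \<and> \<not> b12 \<and> \<not> b13 \<and> b14 \<and> b23 \<and> \<not> b24 \<and> \<not> b34 \<or>
    \<not> b01 \<and> \<not> b02 \<and> \<not> b03 \<and> \<not> b04 \<and> \<not> b12 \<and> b13 \<and> \<not> b14 \<and> \<not> b23 \<and> \<not> b24 \<and> \<not> b34 \<or>
    \<not> b01 \<and> \<not> b02 \<and> \<not> b03 \<and> \<not> b04 \<and> \<not> b12 \<and> b13 \<and> \<not> b14 \<and> \<not> b23 \<and> b24 \<and> \<not> b34 \<or>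
    \<not> b01 \<and> \<not> b02 \<and> \<not> b03 \<and> \<not> b04 \<and> b12 \<and> \<not> b13 \<and> \<not> b14 \<and> \<not> b23 \<and> \<not> b24 \<and> \<not> b34 \<or>
    \<not> b01 \<and> \<not> b02 \<and> \<not> b03 \<and> \<not> b04 \<and> b12 \<and> \<not> b13 \<and> \<not> b14 \<and> \<not> b23 \<and> \<not> b24 \<and> b34 \<or>
    \<not> b01 \<and> \<not> b02 \<and> \<not> b03 \<and> b04 \<and> \<not> b12 \<and> \<not> b13 \<and> \<not> b14 \<and> \<not> b23 \<and> \<not> b24 \<and> \<not> b34 \<or>
    \<not> b01 \<and> \<not> b02 \<and> \<not> b03 \<and> b04 \<and> \<not> b12 \<and> \<not> b13 \<and> \<not> b14 \<and> b23 \<and> \<not> b24 \<and> \<not> b34 \<or>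
    \<not> b01 \<and> \<not> b02 \<and> \<not> b03 \<and> b04 \<and> \<not> b12 \<and> b13 \<and> \<not> b14 \<and> \<not> b23 \<and> \<not> b24 \<and> \<not> b34 \<or>
    \<not> b01 \<and> \<not> b02 \<and> \<not> b03 \<and> b04 \<and> b12 \<and> \<not> b13 \<and> \<not> b14 \<and> \<not> b23 \<and> \<not> b24 \<and> \<not> b34 \<or>
    \<not> b01 \<and> \<not> b02 \<and> b03 \<and> \<not> b04 \<and> \<not> b12 \<and> \<not> b13 \<and> \<not> b14 \<and> \<not> b23 \<and> \<not> b24 \<and> \<not> b34 \<or>
    \<not> b01 \<and> \<not> b02 \<and> b03 \<and> \<not> b04 \<and> \<not> b12 \<and> \<not> b13 \<and> \<not> b14 \<and> \<not> b23 \<and> b24 \<and> \<not> b34 \<or>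
    \<not> b01 \<and> \<not> b02 \<and> b03 \<and> \<not> b04 \<and> \<not> b12 \<and> \<not> b13 \<and> b14 \<and> \<not> b23 \<and> \<not> b24 \<and> \<not> b34 \<or>
    \<not> b01 \<and> \<not> b02 \<and> b03 \<and> \<not> b04 \<and> b12 \<and> \<not> b13 \<and> \<not> b14 \<and> \<not> b23 \<and> \<not> b24 \<and> \<not> b34 \<or>
    \<not> b01 \<and> b02 \<and> \<not> b03 \<and> \<not> b04 \<and> \<not> b12 \<and> \<not> b13 \<and> \<not> b14 \<and> \<not> b23 \<and> \<not> b24 \<and> \<not> b34 \<or>
    \<not> b01 \<and> b02 \<and> \<not> b03 \<and> \<not> b04 \<and> \<not> b12 \<and> \<not> b13 \<and> \<not> b14 \<and> \<not> b23 \<and> \<not> b24 \<and> b34 \<or>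
    \<not> b01 \<and> b02 \<and> \<not> b03 \<and> \<not> b04 \<and> \<not> b12 \<and> \<not> b13 \<and> b14 \<and> \<not> b23 \<and> \<not> b24 \<and> \<not> b34 \<or>
    \<not> b01 \<and> b02 \<and> \<not> b03 \<and> \<not> b04 \<and> \<not> b12 \<and> b13 \<and> \<not> b14 \<and> \<not> b23 \<and> \<not> b24 \<and> \<not> b34 \<or>
    b01 \<and> \<not> b02 \<and> \<not> b03 \<and> \<not> b04 \<and> \<not> b12 \<and> \<not> b13 \<and> \<not> b14 \<and> \<not> b23 \<and> \<not> b24 \<and> \<not> b34 \<or>
    b01 \<and> \<not> b02 \<and> \<not> b03 \<and> \<not> b04 \<and> \<not> b12 \<and> \<not> b13 \<and> \<not> b14 \<and> \<not> b23 \<and> \<not> b24 \<and> b34 \<or>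
    b01 \<and> \<not> b02 \<and> \<not> b03 \<and> \<not> b04 \<and> \<not> b12 \<and> \<not> b13 \<and> \<not> b14 \<and> \<not> b23 \<and> b24 \<and> \<not> b34 \<or>
    b01 \<and> \<not> b02 \<and> \<not> b03 \<and> \<not> b04 \<and> \<not> b12 \<and> \<not> b13 \<and> \<not> b14 \<and> b23 \<and> \<not> b24 \<and> \<not> b34"
    using assms by (smt (z3))
  then show ?thesis
    by (elim disjE conjE) (simp_all add: matching_table_def)
qed

lemma pentagon_colourings:
  assumes "\<not> b01"
    "\<not> (b01 = b12 \<and> b12 = b02)"
    "\<not> (b01 = b13 \<and> b13 = b03)"
    "\<not> (b01 = b14 \<and> b14 = b04)"
    "\<not> (b02 = b23 \<and> b23 = b03)"
    "\<not> (b02 = b24 \<and> b24 = b04)"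
    "\<not> (b03 = b34 \<and> b34 = b04)"
    "\<not> (b12 = b23 \<and> b23 = b13)"
    "\<not> (b12 = b24 \<and> b24 = b14)"
    "\<not> (b13 = b34 \<and> b34 = b14)"
    "\<not> (b23 = b34 \<and> b34 = b24)"
  shows "\<not> b01 \<and> \<not> b02 \<and> b03 \<and> b04 \<and> b12 \<and> \<not> b13 \<and> b14 \<and> b23 \<and> \<not> b24 \<and> \<not> b34 \<or>
    \<not> b01 \<and> \<not> b02 \<and> b03 \<and> b04 \<and> b12 \<and> b13 \<and> \<not> b14 \<and> \<not> b23 \<and> b24 \<and> \<not> b34 \<or>
    \<not> b01 \<and> b02 \<and> \<not> b03 \<and> b04 \<and> \<not> b12 \<and> b13 \<and> b14 \<and> b23 \<and> \<not> b24 \<and> \<not> b34 \<or>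
    \<not> b01 \<and> b02 \<and> \<not> b03 \<and> b04 \<and> b12 \<and> b13 \<and> \<not> b14 \<and> \<not> b23 \<and> \<not> b24 \<and> b34 \<or>
    \<not> b01 \<and> b02 \<and> b03 \<and> \<not> b04 \<and> \<not> b12 \<and> b13 \<and> b14 \<and> \<not> b23 \<and> b24 \<and> \<not> b34 \<or>
    \<not> b01 \<and> b02 \<and> b03 \<and> \<not> b04 \<and> b12 \<and> \<not> b13 \<and> b14 \<and> \<not> b23 \<and> \<not> b24 \<and> b34"
  using assms by (smt (z3))

lemma pentagon_membership:
  assumes "\<not> b01"
    "\<not> (b01 = b12 \<and> b12 = b02)"
    "\<not> (b01 = b13 \<and> b13 = b03)"
    "\<not> (b01 = b14 \<and> b14 = b04)"
    "\<not> (b02 = b23 \<and> b23 = b03)"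
    "\<not> (b02 = b24 \<and> b24 = b04)"
    "\<not> (b03 = b34 \<and> b34 = b04)"
    "\<not> (b12 = b23 \<and> b23 = b13)"
    "\<not> (b12 = b24 \<and> b24 = b14)"
    "\<not> (b13 = b34 \<and> b34 = b14)"
    "\<not> (b23 = b34 \<and> b34 = b24)"
  shows "[if b01 then - 1 else 1, if b02 then - 1 else 1, if b03 then - 1 else 1, if b04 then - 1 else 1, if b12 then - 1 else 1, if b13 then - 1 else 1, if b14 then - 1 else 1, if b23 then - 1 else 1, if b24 then - 1 else 1, if b34 then - 1 else 1] \<in> set (map fst pentagon_table)"
  using pentagon_colourings[OF assms]
  by (elim disjE conjE) (simp_all add: pentagon_table_def)

lemma pentagon_solution:
  fixes w01 w02 w03 w04 w12 w13 w14 w23 w24 w34 :: real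
  assumes "\<not> b01" "pentagon_row b01 b12 b02 w01 w12 w02 g012"
    "pentagon_row b01 b13 b03 w01 w13 w03 g013"
    "pentagon_row b01 b14 b04 w01 w14 w04 g014"
    "pentagon_row b02 b23 b03 w02 w23 w03 g023"
    "pentagon_row b02 b24 b04 w02 w24 w04 g024"
    "pentagon_row b03 b34 b04 w03 w34 w04 g034"
    "pentagon_row b12 b23 b13 w12 w23 w13 g123"
    "pentagon_row b12 b24 b14 w12 w24 w14 g124"
    "pentagon_row b13 b34 b14 w13 w34 w14 g134"
    "pentagon_row b23 b34 b24 w23 w34 w24 g234"
  shows "50 * w01 = (if b02 = b12 then - 18 * g012 else 2 * g012) + (if b03 = b13 then - 18 * g013 else 2 * g013) + (if b04 = b14 then - 18 * g014 else 2 * g014) + (if b02 \<and> b23 \<or> b23 \<and> b03 \<or> b02 \<and> b03 then - 3 * g023 else 7 * g023) + (if b02 \<and> b24 \<or> b24 \<and> b04 \<or> b02 \<and> b04 then - 3 * g024 else 7 * g024) + (if b03 \<and> b34 \<or> b34 \<and> b04 \<or> b03 \<and> b04 then - 3 * g034 else 7 * g034) + (if b12 \<and> b23 \<or> b23 \<and> b13 \<or> b12 \<and> b13 then - 3 * g123 else 7 * g123) + (if b12 \<and> b24 \<or> b24 \<and> b14 \<or> b12 \<and> b14 then - 3 * g124 else 7 * g124) + (if b13 \<and> b34 \<or> b34 \<and> b14 \<or> b13 \<and> b14 then - 3 * g134 else 7 * g134) + 2 * g234"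
proof -
  have "\<not> b01 \<and> \<not> b02 \<and> b03 \<and> b04 \<and> b12 \<and> \<not> b13 \<and> b14 \<and> b23 \<and> \<not> b24 \<and> \<not> b34 \<or>
    \<not> b01 \<and> \<not> b02 \<and> b03 \<and> b04 \<and> b12 \<and> b13 \<and> \<not> b14 \<and> \<not> b23 \<and> b24 \<and> \<not> b34 \<or>
    \<not> b01 \<and> b02 \<and> \<not> b03 \<and> b04 \<and> \<not> b12 \<and> b13 \<and> b14 \<and> b23 \<and> \<not> b24 \<and> \<not> b34 \<or>
    \<not> b01 \<and> b02 \<and> \<not> b03 \<and> b04 \<and> b12 \<and> b13 \<and> \<not> b14 \<and> \<not> b23 \<and> \<not> b24 \<and> b34 \<or>
    \<not> b01 \<and> b02 \<and> b03 \<and> \<not> b04 \<and> \<not> b12 \<and> b13 \<and> b14 \<and> \<not> b23 \<and> b24 \<and> \<not> b34 \<or>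
    \<not> b01 \<and> b02 \<and> b03 \<and> \<not> b04 \<and> b12 \<and> \<not> b13 \<and> b14 \<and> \<not> b23 \<and> \<not> b24 \<and> b34"
    by (rule pentagon_colourings[OF assms(1) assms(2-)[THEN pentagon_row_nonmono]])
  then show ?thesis
    using assms(2-) by (elim disjE conjE) (simp_all add: pentagon_row_def algebra_simps)
qed

section \<open>The 64 limit points\<close>

text \<open>
  A square root of \<open>-3/5\<close>. A face with three entries \<open>\<plusminus>1\<close> that are not all
  equal is \<open>-5\<close>, and \<open>(-3/5) * (-5) = 3\<close>.
\<close>

definition omega :: complex where
  "omega = Complex 0 (sqrt (3 / 5))"

lemma omega: "omega ^ 2 = - 3 / 5" "omega \<noteq> 0"
  by (auto simp: omega_def power2_eq_square complex_eq_iff)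

text \<open>
  A point \<open>(\<kappa>, p, h)\<close> stands for the configuration with entries \<open>\<kappa>\<close>
  times those listed in \<open>p\<close>; the last component is carried along to compute the slope at the point.
\<close>

definition points :: "(complex \<times> real list \<times> real) set" where
  "points = {1, - 1} \<times> set matching_table \<union> {omega, - omega} \<times> set pentagon_table"

fun config_of :: "complex \<times> real list \<times> real \<Rightarrow> nat \<Rightarrow> nat \<Rightarrow> complex" where
  "config_of (\<kappa>, p, h) i j = \<kappa> * complex_of_real (conf p i j)"

fun slope :: "complex \<times> real list \<times> real \<Rightarrow> complex" where
  "slope (\<kappa>, p, h) = complex_of_real h / (2 * \<kappa>)"

lemma tables_distinct:
  "distinct (map (\<lambda>(p, h). (p ! 0, h)) matching_table)" "distinct (map (\<lambda>(p, h). (p ! 0, h)) pentagon_table)"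
  by (simp_all add: matching_table_def pentagon_table_def)

lemma tables_card: "card (set matching_table) = 26" "card (set pentagon_table) = 6"
proof -
  have "distinct matching_table" "distinct pentagon_table" using tables_distinct by (simp_all only: distinct_map)
  from this[THEN distinct_card] show "card (set matching_table) = 26" "card (set pentagon_table) = 6"
    by (simp_all add: matching_table_def pentagon_table_def)
qed

lemma matching_table_entries:
  assumes "(p, h) \<in> set matching_table"
  shows "\<forall>k\<in>{0,1,2,3,4,5,6,7,8,9}. p ! k \<in> {1, 3}" "p ! 0 \<in> {1, 3}"
    "heron (p!0) (p!4) (p!1) = 3" "heron (p!0) (p!5) (p!2) = 3" "heron (p!0) (p!6) (p!3) = 3"
    "heron (p!1) (p!7) (p!2) = 3" "heron (p!1) (p!8) (p!3) = 3" "heron (p!2) (p!9) (p!3) = 3"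
    "heron (p!4) (p!7) (p!5) = 3" "heron (p!4) (p!8) (p!6) = 3" "heron (p!5) (p!9) (p!6) = 3" "heron (p!7) (p!9) (p!8) = 3"
    "h = (3 - 2 * p!0) * ((8 / (p!0 * p!4 * p!1) + 8 / (p!0 * p!6 * p!3)) / 3 -
      (4 / (p!1 * p!7 * p!2) + 2 / (p!1 * p!8 * p!3) + 7 / (p!2 * p!9 * p!3) + 7 / (p!4 * p!8 * p!6) + 8 / (p!5 * p!9 * p!6)) / 6)"
  using assms unfolding matching_table_def list.set
  by (elim insertE emptyE; simp add: heron_def)+

lemma pentagon_table_entries:
  assumes "(p, h) \<in> set pentagon_table"
  shows "\<forall>k\<in>{0,1,2,3,4,5,6,7,8,9}. p ! k \<in> {1, - 1}" "p ! 0 = 1"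
    "heron (p!0) (p!4) (p!1) = - 5" "heron (p!0) (p!5) (p!2) = - 5" "heron (p!0) (p!6) (p!3) = - 5"
    "heron (p!1) (p!7) (p!2) = - 5" "heron (p!1) (p!8) (p!3) = - 5" "heron (p!2) (p!9) (p!3) = - 5"
    "heron (p!4) (p!7) (p!5) = - 5" "heron (p!4) (p!8) (p!6) = - 5" "heron (p!5) (p!9) (p!6) = - 5" "heron (p!7) (p!9) (p!8) = - 5"
    "50 * h = (if (p!1 = - 1) = (p!4 = - 1) then - 18 * 8 else 2 * 8) + (if (p!3 = - 1) = (p!6 = - 1) then - 18 * 8 else 2 * 8) +
      (if (p!1 = - 1 \<and> p!7 = - 1 \<or> p!7 = - 1 \<and> p!2 = - 1 \<or> p!1 = - 1 \<and> p!2 = - 1) then - 3 * 4 else 7 * 4) +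
      (if (p!1 = - 1 \<and> p!8 = - 1 \<or> p!8 = - 1 \<and> p!3 = - 1 \<or> p!1 = - 1 \<and> p!3 = - 1) then - 3 * 2 else 7 * 2) +
      (if (p!2 = - 1 \<and> p!9 = - 1 \<or> p!9 = - 1 \<and> p!3 = - 1 \<or> p!2 = - 1 \<and> p!3 = - 1) then - 3 * 7 else 7 * 7) +
      (if (p!4 = - 1 \<and> p!8 = - 1 \<or> p!8 = - 1 \<and> p!6 = - 1 \<or> p!4 = - 1 \<and> p!6 = - 1) then - 3 * 7 else 7 * 7) +
      (if (p!5 = - 1 \<and> p!9 = - 1 \<or> p!9 = - 1 \<and> p!6 = - 1 \<or> p!5 = - 1 \<and> p!6 = - 1) then - 3 * 8 else 7 * 8)"
  using assms unfolding pentagon_table_def list.set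
  by (elim insertE emptyE; simp add: heron_def)+


lemma pentagon_row_polar:
  fixes x y z s e1 e2 e3 :: real
  assumes "e1 \<in> {1, - 1}" "e2 \<in> {1, - 1}" "e3 \<in> {1, - 1}" "heron e1 e2 e3 = - 5"
    and "x * (e2 + e3 - e1) + y * (e1 + e3 - e2) + z * (e1 + e2 - e3) = s"
  shows "pentagon_row (e1 = - 1) (e2 = - 1) (e3 = - 1) x y z s"
  using assms by (auto simp: heron_def pentagon_row_def)

lemma polar_conf:
  fixes w :: "nat \<Rightarrow> nat \<Rightarrow> real"
  assumes "symmetric w" "\<forall>i j k. i < j \<longrightarrow> j < k \<longrightarrow> k \<le> 4 \<longrightarrow> polar (conf p) w i j k = s i j k"
  shows "w 0 1 * (p!4 + p!1 - p!0) + w 1 2 * (p!0 + p!1 - p!4) + w 0 2 * (p!0 + p!4 - p!1) = s 0 1 2"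
    "w 0 1 * (p!5 + p!2 - p!0) + w 1 3 * (p!0 + p!2 - p!5) + w 0 3 * (p!0 + p!5 - p!2) = s 0 1 3"
    "w 0 1 * (p!6 + p!3 - p!0) + w 1 4 * (p!0 + p!3 - p!6) + w 0 4 * (p!0 + p!6 - p!3) = s 0 1 4"
    "w 0 2 * (p!7 + p!2 - p!1) + w 2 3 * (p!1 + p!2 - p!7) + w 0 3 * (p!1 + p!7 - p!2) = s 0 2 3"
    "w 0 2 * (p!8 + p!3 - p!1) + w 2 4 * (p!1 + p!3 - p!8) + w 0 4 * (p!1 + p!8 - p!3) = s 0 2 4"
    "w 0 3 * (p!9 + p!3 - p!2) + w 3 4 * (p!2 + p!3 - p!9) + w 0 4 * (p!2 + p!9 - p!3) = s 0 3 4"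
    "w 1 2 * (p!7 + p!5 - p!4) + w 2 3 * (p!4 + p!5 - p!7) + w 1 3 * (p!4 + p!7 - p!5) = s 1 2 3"
    "w 1 2 * (p!8 + p!6 - p!4) + w 2 4 * (p!4 + p!6 - p!8) + w 1 4 * (p!4 + p!8 - p!6) = s 1 2 4"
    "w 1 3 * (p!9 + p!6 - p!5) + w 3 4 * (p!5 + p!6 - p!9) + w 1 4 * (p!5 + p!9 - p!6) = s 1 3 4"
    "w 2 3 * (p!9 + p!8 - p!7) + w 3 4 * (p!7 + p!8 - p!9) + w 2 4 * (p!7 + p!9 - p!8) = s 2 3 4"
proof -
  have "conf p i j = conf p j i" "w i j = w j i" for i j
    using symmetricD[OF symmetric_conf, of p i j] symmetricD[OF assms(1), of i j] .
  note sym = this[of 2 0] this[of 3 0] this[of 4 0] this[of 2 1] this[of 3 1] this[of 4 1] this[of 3 2] this[of 4 2] this[of 4 3]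
  have c: "conf p 0 1 = p ! 0"
    "conf p 0 2 = p ! 1"
    "conf p 0 3 = p ! 2"
    "conf p 0 4 = p ! 3"
    "conf p 1 2 = p ! 4"
    "conf p 1 3 = p ! 5"
    "conf p 1 4 = p ! 6"
    "conf p 2 3 = p ! 7"
    "conf p 2 4 = p ! 8"
    "conf p 3 4 = p ! 9"
    by (subst symmetricD[OF symmetric_conf], rule conf_simps)+
  note unf = polar_def sym c
  show "w 0 1 * (p!4 + p!1 - p!0) + w 1 2 * (p!0 + p!1 - p!4) + w 0 2 * (p!0 + p!4 - p!1) = s 0 1 2"
    by (rule assms(2)[rule_format, of 0 1 2, unfolded unf]; simp)
  show "w 0 1 * (p!5 + p!2 - p!0) + w 1 3 * (p!0 + p!2 - p!5) + w 0 3 * (p!0 + p!5 - p!2) = s 0 1 3"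
    by (rule assms(2)[rule_format, of 0 1 3, unfolded unf]; simp)
  show "w 0 1 * (p!6 + p!3 - p!0) + w 1 4 * (p!0 + p!3 - p!6) + w 0 4 * (p!0 + p!6 - p!3) = s 0 1 4"
    by (rule assms(2)[rule_format, of 0 1 4, unfolded unf]; simp)
  show "w 0 2 * (p!7 + p!2 - p!1) + w 2 3 * (p!1 + p!2 - p!7) + w 0 3 * (p!1 + p!7 - p!2) = s 0 2 3"
    by (rule assms(2)[rule_format, of 0 2 3, unfolded unf]; simp)
  show "w 0 2 * (p!8 + p!3 - p!1) + w 2 4 * (p!1 + p!3 - p!8) + w 0 4 * (p!1 + p!8 - p!3) = s 0 2 4"
    by (rule assms(2)[rule_format, of 0 2 4, unfolded unf]; simp)
  show "w 0 3 * (p!9 + p!3 - p!2) + w 3 4 * (p!2 + p!3 - p!9) + w 0 4 * (p!2 + p!9 - p!3) = s 0 3 4"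
    by (rule assms(2)[rule_format, of 0 3 4, unfolded unf]; simp)
  show "w 1 2 * (p!7 + p!5 - p!4) + w 2 3 * (p!4 + p!5 - p!7) + w 1 3 * (p!4 + p!7 - p!5) = s 1 2 3"
    by (rule assms(2)[rule_format, of 1 2 3, unfolded unf]; simp)
  show "w 1 2 * (p!8 + p!6 - p!4) + w 2 4 * (p!4 + p!6 - p!8) + w 1 4 * (p!4 + p!8 - p!6) = s 1 2 4"
    by (rule assms(2)[rule_format, of 1 2 4, unfolded unf]; simp)
  show "w 1 3 * (p!9 + p!6 - p!5) + w 3 4 * (p!5 + p!6 - p!9) + w 1 4 * (p!5 + p!9 - p!6) = s 1 3 4"
    by (rule assms(2)[rule_format, of 1 3 4, unfolded unf]; simp)
  show "w 2 3 * (p!9 + p!8 - p!7) + w 3 4 * (p!7 + p!8 - p!9) + w 2 4 * (p!7 + p!9 - p!8) = s 2 3 4"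
    by (rule assms(2)[rule_format, of 2 3 4, unfolded unf]; simp)
qed

lemma test_direction_values:
  "test_direction 0 1 2 = 8" "test_direction 0 1 3 = 0" "test_direction 0 1 4 = 8" "test_direction 0 2 3 = 4"
  "test_direction 0 2 4 = 2" "test_direction 0 3 4 = 7" "test_direction 1 2 3 = 0" "test_direction 1 2 4 = 7"
  "test_direction 1 3 4 = 8" "test_direction 2 3 4 = 0"
  by (simp_all add: test_direction_def)

lemma all_edges_zero:
  assumes "symmetric w"
  shows "(\<forall>(i, j)\<in>edges 4. w i j = 0) \<longleftrightarrow>
    w 0 1 = 0 \<and> w 0 2 = 0 \<and> w 0 3 = 0 \<and> w 0 4 = 0 \<and> w 1 2 = 0 \<and> w 1 3 = 0 \<and> w 1 4 = 0 \<and> w 2 3 = 0 \<and> w 2 4 = 0 \<and> w 3 4 = 0"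
  by (rule all_edges_4) (use symmetricD[OF assms] in metis)

lemma matching_system:
  fixes w :: "nat \<Rightarrow> nat \<Rightarrow> real"
  assumes ph: "(p, h) \<in> set matching_table" and w: "symmetric w"
  shows "(\<forall>i j k. i < j \<longrightarrow> j < k \<longrightarrow> k \<le> 4 \<longrightarrow> polar (conf p) w i j k = 0) \<Longrightarrow> (\<forall>(i, j)\<in>edges 4. w i j = 0)"
    and "(\<forall>i j k. i < j \<longrightarrow> j < k \<longrightarrow> k \<le> 4 \<longrightarrow> polar (conf p) w i j k = test_direction i j k) \<Longrightarrow> w 0 1 = h"
proof -
  note e = matching_table_entries[OF ph]
  have e': "p!0 \<in> {1,3}" "p!1 \<in> {1,3}" "p!2 \<in> {1,3}" "p!3 \<in> {1,3}" "p!4 \<in> {1,3}" "p!5 \<in> {1,3}" "p!6 \<in> {1,3}"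
    "p!7 \<in> {1,3}" "p!8 \<in> {1,3}" "p!9 \<in> {1,3}"
    using e(1) by blast+
  have "3 - 2 * x \<noteq> 0" if "x \<in> {1, 3}" for x :: real using that by auto
  note nz = e'[THEN this]
  have rows: "w 0 1 / (3 - 2 * p!0) + w 1 2 / (3 - 2 * p!4) + w 0 2 / (3 - 2 * p!1) = s 0 1 2 / (p!0 * p!4 * p!1)"
    "w 0 1 / (3 - 2 * p!0) + w 1 3 / (3 - 2 * p!5) + w 0 3 / (3 - 2 * p!2) = s 0 1 3 / (p!0 * p!5 * p!2)"
    "w 0 1 / (3 - 2 * p!0) + w 1 4 / (3 - 2 * p!6) + w 0 4 / (3 - 2 * p!3) = s 0 1 4 / (p!0 * p!6 * p!3)"
    "w 0 2 / (3 - 2 * p!1) + w 2 3 / (3 - 2 * p!7) + w 0 3 / (3 - 2 * p!2) = s 0 2 3 / (p!1 * p!7 * p!2)"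
    "w 0 2 / (3 - 2 * p!1) + w 2 4 / (3 - 2 * p!8) + w 0 4 / (3 - 2 * p!3) = s 0 2 4 / (p!1 * p!8 * p!3)"
    "w 0 3 / (3 - 2 * p!2) + w 3 4 / (3 - 2 * p!9) + w 0 4 / (3 - 2 * p!3) = s 0 3 4 / (p!2 * p!9 * p!3)"
    "w 1 2 / (3 - 2 * p!4) + w 2 3 / (3 - 2 * p!7) + w 1 3 / (3 - 2 * p!5) = s 1 2 3 / (p!4 * p!7 * p!5)"
    "w 1 2 / (3 - 2 * p!4) + w 2 4 / (3 - 2 * p!8) + w 1 4 / (3 - 2 * p!6) = s 1 2 4 / (p!4 * p!8 * p!6)"
    "w 1 3 / (3 - 2 * p!5) + w 3 4 / (3 - 2 * p!9) + w 1 4 / (3 - 2 * p!6) = s 1 3 4 / (p!5 * p!9 * p!6)"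
    "w 2 3 / (3 - 2 * p!7) + w 3 4 / (3 - 2 * p!9) + w 2 4 / (3 - 2 * p!8) = s 2 3 4 / (p!7 * p!9 * p!8)"
    if s: "\<forall>i j k. i < j \<longrightarrow> j < k \<longrightarrow> k \<le> 4 \<longrightarrow> polar (conf p) w i j k = s i j k" for s
    by (intro matching_row e e' polar_conf[OF w s])+
  show "\<forall>(i, j)\<in>edges 4. w i j = 0" if "\<forall>i j k. i < j \<longrightarrow> j < k \<longrightarrow> k \<le> 4 \<longrightarrow> polar (conf p) w i j k = 0"
    unfolding all_edges_zero[OF w] using regular_kernel[OF rows[of "\<lambda>_ _ _. 0", OF that, simplified]] nz by simp
  show "w 0 1 = h" if "\<forall>i j k. i < j \<longrightarrow> j < k \<longrightarrow> k \<le> 4 \<longrightarrow> polar (conf p) w i j k = test_direction i j k"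
    using regular_solution[OF rows[of test_direction, OF that, unfolded test_direction_values]] nz(1)
    unfolding e(13) by (simp add: nonzero_divide_eq_eq mult.commute)
qed

lemma pentagon_system:
  fixes w :: "nat \<Rightarrow> nat \<Rightarrow> real"
  assumes ph: "(p, h) \<in> set pentagon_table" and w: "symmetric w"
  shows "(\<forall>i j k. i < j \<longrightarrow> j < k \<longrightarrow> k \<le> 4 \<longrightarrow> polar (conf p) w i j k = 0) \<Longrightarrow> (\<forall>(i, j)\<in>edges 4. w i j = 0)"
    and "(\<forall>i j k. i < j \<longrightarrow> j < k \<longrightarrow> k \<le> 4 \<longrightarrow> polar (conf p) w i j k = test_direction i j k) \<Longrightarrow> w 0 1 = h"
proof -
  note e = pentagon_table_entries[OF ph]
  have e': "p!0 \<in> {1,-1}" "p!1 \<in> {1,-1}" "p!2 \<in> {1,-1}" "p!3 \<in> {1,-1}" "p!4 \<in> {1,-1}" "p!5 \<in> {1,-1}" "p!6 \<in> {1,-1}"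
    "p!7 \<in> {1,-1}" "p!8 \<in> {1,-1}" "p!9 \<in> {1,-1}"
    using e(1) by blast+
  have rows: "pentagon_row (p!0 = - 1) (p!4 = - 1) (p!1 = - 1) (w 0 1) (w 1 2) (w 0 2) (s 0 1 2)"
    "pentagon_row (p!0 = - 1) (p!5 = - 1) (p!2 = - 1) (w 0 1) (w 1 3) (w 0 3) (s 0 1 3)"
    "pentagon_row (p!0 = - 1) (p!6 = - 1) (p!3 = - 1) (w 0 1) (w 1 4) (w 0 4) (s 0 1 4)"
    "pentagon_row (p!1 = - 1) (p!7 = - 1) (p!2 = - 1) (w 0 2) (w 2 3) (w 0 3) (s 0 2 3)"
    "pentagon_row (p!1 = - 1) (p!8 = - 1) (p!3 = - 1) (w 0 2) (w 2 4) (w 0 4) (s 0 2 4)"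
    "pentagon_row (p!2 = - 1) (p!9 = - 1) (p!3 = - 1) (w 0 3) (w 3 4) (w 0 4) (s 0 3 4)"
    "pentagon_row (p!4 = - 1) (p!7 = - 1) (p!5 = - 1) (w 1 2) (w 2 3) (w 1 3) (s 1 2 3)"
    "pentagon_row (p!4 = - 1) (p!8 = - 1) (p!6 = - 1) (w 1 2) (w 2 4) (w 1 4) (s 1 2 4)"
    "pentagon_row (p!5 = - 1) (p!9 = - 1) (p!6 = - 1) (w 1 3) (w 3 4) (w 1 4) (s 1 3 4)"
    "pentagon_row (p!7 = - 1) (p!9 = - 1) (p!8 = - 1) (w 2 3) (w 3 4) (w 2 4) (s 2 3 4)"
    if s: "\<forall>i j k. i < j \<longrightarrow> j < k \<longrightarrow> k \<le> 4 \<longrightarrow> polar (conf p) w i j k = s i j k" for s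
    by (intro pentagon_row_polar e e' polar_conf[OF w s])+
  show "\<forall>(i, j)\<in>edges 4. w i j = 0" if "\<forall>i j k. i < j \<longrightarrow> j < k \<longrightarrow> k \<le> 4 \<longrightarrow> polar (conf p) w i j k = 0"
    unfolding all_edges_zero[OF w] using pentagon_kernel[OF rows[of "\<lambda>_ _ _. 0", OF that]] .
  have "\<not> p!0 = - 1" using e(2) by simp
  then show "w 0 1 = h" if "\<forall>i j k. i < j \<longrightarrow> j < k \<longrightarrow> k \<le> 4 \<longrightarrow> polar (conf p) w i j k = test_direction i j k"
    using pentagon_solution[OF _ rows[of test_direction, OF that, unfolded test_direction_values]] e(13) by argo
qed


lemma card_points: "finite points" "card points = 64"
proof -
  have m1: "(1 :: complex) \<noteq> - 1"
  proof
    assume "(1 :: complex) = - 1"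
    then have "Re 1 = Re (- 1)" by (rule arg_cong)
    then show False by simp
  qed
  have "omega \<noteq> - omega" using omega(2) by simp
  have "omega \<noteq> 1" "omega \<noteq> - 1" "- omega \<noteq> 1" by (auto simp: omega_def complex_eq_iff)
  then have disj: "({1, - 1} \<times> set matching_table) \<inter> ({omega, - omega} \<times> set pentagon_table) = {}" by auto
  have "card points = card ({1, - 1 :: complex} \<times> set matching_table) + card ({omega, - omega} \<times> set pentagon_table)"
    unfolding points_def by (rule card_Un_disjoint) (use disj in auto)
  also have "\<dots> = 64"
    using m1 \<open>omega \<noteq> - omega\<close> by (simp add: card_cartesian_product tables_card)
  finally show "card points = 64" .
  then show "finite points" using card.infinite by fastforce
qed

lemma points_cases:
  assumes "(\<kappa>, p, h) \<in> points"
  obtains "\<kappa> ^ 2 = 1" "(p, h) \<in> set matching_table" | "\<kappa> ^ 2 = - 3 / 5" "(p, h) \<in> set pentagon_table"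
  using assms omega(1) unfolding points_def by (auto simp: power2_eq_square)

lemma points_D:
  assumes "(\<kappa>, p, h) \<in> points"
  shows "(p, h) \<in> set matching_table \<or> (p, h) \<in> set pentagon_table" "\<kappa> \<noteq> 0"
  by (rule points_cases[OF assms]; simp)+ (rule points_cases[OF assms]; auto)

lemma config_of_abs: "config_of (\<kappa>, p, h) = (\<lambda>i j. \<kappa> * complex_of_real (conf p i j))"
  by (intro ext) simp

lemma symmetric_config_of: "symmetric (config_of t)"
  by (cases t) (use symmetricD[OF symmetric_conf] in \<open>auto simp: symmetric_def config_of_abs\<close>)

lemma Re_Im_polar:
  "Re (polar (\<lambda>i j. complex_of_real (z i j)) w i j k) = polar z (\<lambda>i j. Re (w i j)) i j k"
  "Im (polar (\<lambda>i j. complex_of_real (z i j)) w i j k) = polar z (\<lambda>i j. Im (w i j)) i j k"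
  by (simp_all add: polar_def)

lemma table_system:
  fixes w :: "nat \<Rightarrow> nat \<Rightarrow> complex"
  assumes ph: "(p, h) \<in> set matching_table \<or> (p, h) \<in> set pentagon_table" and w: "symmetric w"
  shows "(\<forall>i j k. i < j \<longrightarrow> j < k \<longrightarrow> k \<le> 4 \<longrightarrow> polar (\<lambda>i j. complex_of_real (conf p i j)) w i j k = 0) \<Longrightarrow> (\<forall>(i, j)\<in>edges 4. w i j = 0)"
    and "(\<forall>i j k. i < j \<longrightarrow> j < k \<longrightarrow> k \<le> 4 \<longrightarrow> polar (\<lambda>i j. complex_of_real (conf p i j)) w i j k = of_real (test_direction i j k)) \<Longrightarrow> w 0 1 = of_real h"
proof -
  have s: "symmetric (\<lambda>i j. Re (w i j))" "symmetric (\<lambda>i j. Im (w i j))" using w by (auto simp: symmetric_def)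
  have r1: "\<forall>(i, j)\<in>edges 4. u i j = 0"
    if u: "symmetric u" and 0: "\<forall>i j k. i < j \<longrightarrow> j < k \<longrightarrow> k \<le> 4 \<longrightarrow> polar (conf p) u i j k = 0" for u :: "nat \<Rightarrow> nat \<Rightarrow> real"
    using ph by (elim disjE) (erule matching_system(1)[OF _ u 0], erule pentagon_system(1)[OF _ u 0])
  have r2: "u 0 1 = h"
    if u: "symmetric u" and td: "\<forall>i j k. i < j \<longrightarrow> j < k \<longrightarrow> k \<le> 4 \<longrightarrow> polar (conf p) u i j k = test_direction i j k"
    for u :: "nat \<Rightarrow> nat \<Rightarrow> real"
    using ph by (elim disjE) (erule matching_system(2)[OF _ u td], erule pentagon_system(2)[OF _ u td])
  show "\<forall>(i, j)\<in>edges 4. w i j = 0"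
    if *: "\<forall>i j k. i < j \<longrightarrow> j < k \<longrightarrow> k \<le> 4 \<longrightarrow> polar (\<lambda>i j. complex_of_real (conf p i j)) w i j k = 0"
  proof -
    have "\<forall>(i, j)\<in>edges 4. Re (w i j) = 0"
      by (rule r1[OF s(1)]) (use * in \<open>simp add: Re_Im_polar(1)[symmetric]\<close>)
    moreover have "\<forall>(i, j)\<in>edges 4. Im (w i j) = 0"
      by (rule r1[OF s(2)]) (use * in \<open>simp add: Re_Im_polar(2)[symmetric]\<close>)
    ultimately show ?thesis by (auto simp: complex_eq_iff)
  qed
  show "w 0 1 = of_real h"
    if *: "\<forall>i j k. i < j \<longrightarrow> j < k \<longrightarrow> k \<le> 4 \<longrightarrow> polar (\<lambda>i j. complex_of_real (conf p i j)) w i j k = of_real (test_direction i j k)"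
  proof -
    have "Re (w 0 1) = h"
      by (rule r2[OF s(1)]) (use * in \<open>simp add: Re_Im_polar(1)[symmetric]\<close>)
    moreover have "\<forall>(i, j)\<in>edges 4. Im (w i j) = 0"
      by (rule r1[OF s(2)]) (use * in \<open>simp add: Re_Im_polar(2)[symmetric]\<close>)
    then have "Im (w 0 1) = 0" by (auto simp: edges_def)
    ultimately show ?thesis by (simp add: complex_eq_iff)
  qed
qed

text \<open>
  Scaling a point does not change the kernel, and real and imaginary part of \<open>w\<close> satisfy the same
  real linear system.
\<close>

lemma nondegenerate_point:
  assumes "t \<in> points"
  shows "nondegenerate 4 (config_of t)"
proof -
  obtain \<kappa> p h where t: "t = (\<kappa>, p, h)" by (cases t)
  note ph = points_D(1)[OF assms(1)[unfolded t]]
  have "\<kappa> \<noteq> 0" by (rule points_D(2)[OF assms(1)[unfolded t]])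
  show ?thesis
    unfolding nondegenerate_def t config_of_abs polar_scale_left
  proof (intro allI impI)
    fix w :: "nat \<Rightarrow> nat \<Rightarrow> complex"
    assume w: "symmetric w"
      and "\<forall>i j k. i < j \<longrightarrow> j < k \<longrightarrow> k \<le> 4 \<longrightarrow> \<kappa> * polar (\<lambda>i j. complex_of_real (conf p i j)) w i j k = 0"
    then show "\<forall>(i, j)\<in>edges 4. w i j = 0"
      using \<open>\<kappa> \<noteq> 0\<close> by (intro table_system(1)[OF ph w]) simp
  qed
qed

lemma slope_point:
  assumes "t \<in> points" and w: "symmetric w"
    and "\<And>i j k. i < j \<Longrightarrow> j < k \<Longrightarrow> k \<le> 4 \<Longrightarrow> 2 * polar (config_of t) w i j k = of_real (test_direction i j k)"
  shows "w 0 1 = slope t"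
proof -
  obtain \<kappa> p h where t: "t = (\<kappa>, p, h)" by (cases t)
  note ph = points_D(1)[OF assms(1)[unfolded t]]
  have "\<kappa> \<noteq> 0" by (rule points_D(2)[OF assms(1)[unfolded t]])
  have "symmetric (\<lambda>i j. (2 * \<kappa>) * w i j)" using w by (auto simp: symmetric_def)
  from table_system(2)[OF ph this] assms(3) have "2 * \<kappa> * w 0 1 = of_real h"
    unfolding t config_of_abs polar_scale_left polar_scale by (simp add: mult.assoc)
  then show ?thesis using \<open>\<kappa> \<noteq> 0\<close> by (simp add: t field_simps)
qed

lemma face_point:
  assumes "t \<in> points" "i < j" "j < k" "k \<le> 4"
  shows "face (config_of t) i j k = 3"
proof -
  obtain \<kappa> p h where t: "t = (\<kappa>, p, h)" by (cases t)
  have sym: "conf p i j = conf p j i" for i j by (rule symmetricD[OF symmetric_conf])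
  have c: "conf p 0 1 = p!0" "conf p 0 2 = p!1" "conf p 0 3 = p!2" "conf p 0 4 = p!3" "conf p 1 2 = p!4"
    "conf p 1 3 = p!5" "conf p 1 4 = p!6" "conf p 2 3 = p!7" "conf p 2 4 = p!8" "conf p 3 4 = p!9"
    by (subst sym, rule conf_simps)+
  have tr: "\<forall>i j k. i < j \<longrightarrow> j < k \<longrightarrow> k \<le> 4 \<longrightarrow> heron (conf p i j) (conf p j k) (conf p k i) = r"
    if "heron (p!0) (p!4) (p!1) = r" "heron (p!0) (p!5) (p!2) = r" "heron (p!0) (p!6) (p!3) = r"
    "heron (p!1) (p!7) (p!2) = r" "heron (p!1) (p!8) (p!3) = r" "heron (p!2) (p!9) (p!3) = r"
    "heron (p!4) (p!7) (p!5) = r" "heron (p!4) (p!8) (p!6) = r" "heron (p!5) (p!9) (p!6) = r" "heron (p!7) (p!9) (p!8) = r" for r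
    unfolding all_triples_4 c conf_simps using that by blast
  have "face (config_of t) i j k = \<kappa> ^ 2 * of_real (heron (conf p i j) (conf p j k) (conf p k i))"
    unfolding t config_of_abs face_scale by (simp add: face_def heron_def)
  then show ?thesis
    using assms(2-) tr[OF matching_table_entries(3-12)] tr[OF pentagon_table_entries(3-12)]
    by (cases rule: points_cases[OF assms(1)[unfolded t]]) auto
qed

text \<open>
  The entry on the edge 01 alone takes only a few values; the slopes in the direction
  \<open>test_direction\<close> tell apart the points that share it.
\<close>

lemma points_distinct: "inj_on (\<lambda>t. (config_of t 0 1, slope t)) points"
proof (rule inj_onI)
  fix t t' assume tt: "t \<in> points" "t' \<in> points" and eq: "(config_of t 0 1, slope t) = (config_of t' 0 1, slope t')"
  obtain \<kappa> p h \<kappa>' p' h' where t: "t = (\<kappa>, p, h)" "t' = (\<kappa>', p', h')" by (cases t, cases t')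
  have "conf l 0 1 = l ! 0" for l :: "real list" by (subst symmetricD[OF symmetric_conf]) (rule conf_simps)
  then have e: "\<kappa> * of_real (p ! 0) = \<kappa>' * of_real (p' ! 0)" "of_real h / (2 * \<kappa>) = of_real h' / (2 * \<kappa>')"
    using eq by (simp_all add: t)
  have inj: "(p, h) = (p', h')" if "p ! 0 = p' ! 0" "h = h'"
    "(p, h) \<in> set matching_table \<and> (p', h') \<in> set matching_table \<or> (p, h) \<in> set pentagon_table \<and> (p', h') \<in> set pentagon_table"
    using that tables_distinct unfolding distinct_map inj_on_def by fastforce
  have im: "Re omega = 0" "Im omega \<noteq> 0" by (auto simp: omega_def)
  consider "\<kappa> \<in> {1, - 1}" "\<kappa>' \<in> {1, - 1}" "(p, h) \<in> set matching_table" "(p', h') \<in> set matching_table"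
    | "\<kappa> \<in> {omega, - omega}" "\<kappa>' \<in> {omega, - omega}" "(p, h) \<in> set pentagon_table" "(p', h') \<in> set pentagon_table"
    | "\<kappa> \<in> {1, - 1}" "\<kappa>' \<in> {omega, - omega}" "(p, h) \<in> set matching_table"
    | "\<kappa> \<in> {omega, - omega}" "\<kappa>' \<in> {1, - 1}" "(p', h') \<in> set matching_table"
    using tt unfolding t points_def by blast
  then show "t = t'"
  proof cases
    case 1
    have "\<kappa> = \<kappa>' \<and> p ! 0 = p' ! 0"
      using 1(1,2) matching_table_entries(2)[OF 1(3)] matching_table_entries(2)[OF 1(4)] arg_cong[OF e(1), of Re] by auto
    moreover have "h = h'" using e(2) calculation 1(1) by auto
    ultimately show ?thesis using inj 1 t by blast
  next
    case 2
    have p: "p ! 0 = 1" "p' ! 0 = 1" using pentagon_table_entries(2) 2(3,4) by blast+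
    then have "\<kappa> = \<kappa>'" using e(1) by simp
    moreover have "h = h'" using e(2) calculation 2(1) omega(2) by auto
    ultimately show ?thesis using inj 2 p t by auto
  next
    case 3
    have "Re (\<kappa> * of_real (p ! 0)) \<noteq> 0" using 3(1) matching_table_entries(2)[OF 3(3)] by auto
    moreover have "Re (\<kappa>' * of_real (p' ! 0)) = 0" using 3(2) im by auto
    ultimately show ?thesis using e(1) by simp
  next
    case 4
    have "Re (\<kappa>' * of_real (p' ! 0)) \<noteq> 0" using 4(2) matching_table_entries(2)[OF 4(3)] by auto
    moreover have "Re (\<kappa> * of_real (p ! 0)) = 0" using 4(1) im by auto
    ultimately show ?thesis using e(1) by simp
  qed
qed

lemma heron_1_3:
  fixes a b c :: bool
  defines "r \<equiv> heron (if a then 3 else 1) (if b then 3 else 1) (if c then 3 else 1 :: complex)"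
  shows "r = 3 \<longleftrightarrow> \<not> (a \<and> b) \<and> \<not> (b \<and> c) \<and> \<not> (a \<and> c)"
    "r = 11 \<longleftrightarrow> (a \<and> b \<and> \<not> c) \<or> (a \<and> \<not> b \<and> c) \<or> (\<not> a \<and> b \<and> c)"
    "r = 27 \<longleftrightarrow> a \<and> b \<and> c" "r = 3 \<or> r = 11 \<or> r = 27"
  by (cases a; cases b; cases c; simp add: r_def heron_def)+

lemma heron_signs:
  fixes a b c :: bool
  defines "r \<equiv> heron (if a then - 1 else 1) (if b then - 1 else 1) (if c then - 1 else 1 :: complex)"
  shows "r = 3 \<longleftrightarrow> a = b \<and> b = c" "r = - 5 \<longleftrightarrow> \<not> (a = b \<and> b = c)" "r = 3 \<or> r = - 5"
  by (cases a; cases b; cases c; simp add: r_def heron_def)+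

lemma no_two_of_three:
  assumes "(b01 \<and> b12 \<and> \<not> b02) \<or> (b01 \<and> \<not> b12 \<and> b02) \<or> (\<not> b01 \<and> b12 \<and> b02)"
    "(b01 \<and> b13 \<and> \<not> b03) \<or> (b01 \<and> \<not> b13 \<and> b03) \<or> (\<not> b01 \<and> b13 \<and> b03)"
    "(b01 \<and> b14 \<and> \<not> b04) \<or> (b01 \<and> \<not> b14 \<and> b04) \<or> (\<not> b01 \<and> b14 \<and> b04)"
    "(b02 \<and> b23 \<and> \<not> b03) \<or> (b02 \<and> \<not> b23 \<and> b03) \<or> (\<not> b02 \<and> b23 \<and> b03)"
    "(b02 \<and> b24 \<and> \<not> b04) \<or> (b02 \<and> \<not> b24 \<and> b04) \<or> (\<not> b02 \<and> b24 \<and> b04)"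
    "(b03 \<and> b34 \<and> \<not> b04) \<or> (b03 \<and> \<not> b34 \<and> b04) \<or> (\<not> b03 \<and> b34 \<and> b04)"
    "(b12 \<and> b23 \<and> \<not> b13) \<or> (b12 \<and> \<not> b23 \<and> b13) \<or> (\<not> b12 \<and> b23 \<and> b13)"
    "(b12 \<and> b24 \<and> \<not> b14) \<or> (b12 \<and> \<not> b24 \<and> b14) \<or> (\<not> b12 \<and> b24 \<and> b14)"
    "(b13 \<and> b34 \<and> \<not> b14) \<or> (b13 \<and> \<not> b34 \<and> b14) \<or> (\<not> b13 \<and> b34 \<and> b14)"
    "(b23 \<and> b34 \<and> \<not> b24) \<or> (b23 \<and> \<not> b34 \<and> b24) \<or> (\<not> b23 \<and> b34 \<and> b24)"
  shows False
  using assms by (smt (z3))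

section \<open>Completeness of the list of limit points\<close>

lemma conf_list:
  "conf [a01, a02, a03, a04, a12, a13, a14, a23, a24, a34] 0 1 = a01"
  "conf [a01, a02, a03, a04, a12, a13, a14, a23, a24, a34] 0 2 = a02"
  "conf [a01, a02, a03, a04, a12, a13, a14, a23, a24, a34] 0 3 = a03"
  "conf [a01, a02, a03, a04, a12, a13, a14, a23, a24, a34] 0 4 = a04"
  "conf [a01, a02, a03, a04, a12, a13, a14, a23, a24, a34] 1 2 = a12"
  "conf [a01, a02, a03, a04, a12, a13, a14, a23, a24, a34] 1 3 = a13"
  "conf [a01, a02, a03, a04, a12, a13, a14, a23, a24, a34] 1 4 = a14"
  "conf [a01, a02, a03, a04, a12, a13, a14, a23, a24, a34] 2 3 = a23"
  "conf [a01, a02, a03, a04, a12, a13, a14, a23, a24, a34] 2 4 = a24"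
  "conf [a01, a02, a03, a04, a12, a13, a14, a23, a24, a34] 3 4 = a34"
  by (subst symmetricD[OF symmetric_conf], subst conf_simps, simp)+

lemma conf_of_relation:
  assumes "\<And>i j. B i j = B j i"
  shows "\<forall>(i, j)\<in>edges 4. conf [if B 0 1 then u else v, if B 0 2 then u else v, if B 0 3 then u else v, if B 0 4 then u else v, if B 1 2 then u else v, if B 1 3 then u else v, if B 1 4 then u else v, if B 2 3 then u else v, if B 2 4 then u else v, if B 3 4 then u else v] i j = (if B i j then u else v)"
proof (subst all_edges_4)
  show "(conf l i j = (if B i j then u else v)) \<Longrightarrow> (conf l j i = (if B j i then u else v))" for l i j
    using assms[of i j] symmetricD[OF symmetric_conf, of l i j] by simp
qed (unfold conf_list, simp)

text \<open>
  By the classification \<open>z\<close> has entries \<open>b, 3b\<close> or \<open>\<plusminus>b\<close>. In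
  the first case all triangles have the same type: three entries \<open>3b\<close> give the regular simplex
  again, exactly two in every triangle are impossible on five points, and at most one means that the entries
  \<open>3b\<close> form a matching. In the second case either all entries are equal or no triangle is
  monochromatic, and two-colourings of five points without monochromatic triangle are pentagons.
\<close>

lemma limit_is_point:
  assumes sym: "symmetric z" and tets: "tets 4 z"
    and faces: "\<And>i j k. i < j \<Longrightarrow> j < k \<Longrightarrow> k \<le> 4 \<Longrightarrow> face z i j k = 3"
  shows "\<exists>t\<in>points. \<forall>(i, j)\<in>edges 4. z i j = config_of t i j"
proof -
  obtain b where b: "(\<forall>i j. i \<noteq> j \<longrightarrow> i \<le> 4 \<longrightarrow> j \<le> 4 \<longrightarrow> z i j = b \<or> z i j = 3 * b) \<or>
             (\<forall>i j. i \<noteq> j \<longrightarrow> i \<le> 4 \<longrightarrow> j \<le> 4 \<longrightarrow> z i j = b \<or> z i j = - b)"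
    using classify_complex[OF sym tets] by blast
  have "b \<noteq> 0"
  proof
    assume "b = 0"
    then have "z i j = 0" if "i \<noteq> j" "i \<le> 4" "j \<le> 4" for i j using b that by fastforce
    then show False using faces[of 0 1 2] by (simp add: face_def heron_def)
  qed
  have point: "\<exists>t\<in>points. \<forall>(i, j)\<in>edges 4. z i j = config_of t i j"
    if B: "\<And>i j. B i j = B j i" and z: "\<forall>(i, j)\<in>edges 4. z i j = \<kappa> * (if B i j then of_real u else of_real v)"
      and mem: "(\<kappa> ^ 2 = 1 \<and> [if B 0 1 then u else v, if B 0 2 then u else v, if B 0 3 then u else v, if B 0 4 then u else v, if B 1 2 then u else v, if B 1 3 then u else v, if B 1 4 then u else v, if B 2 3 then u else v, if B 2 4 then u else v, if B 3 4 then u else v] \<in> set (map fst matching_table)) \<or>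
        (\<kappa> ^ 2 = - 3 / 5 \<and> [if B 0 1 then u else v, if B 0 2 then u else v, if B 0 3 then u else v, if B 0 4 then u else v, if B 1 2 then u else v, if B 1 3 then u else v, if B 1 4 then u else v, if B 2 3 then u else v, if B 2 4 then u else v, if B 3 4 then u else v] \<in> set (map fst pentagon_table))"
    for B \<kappa> and u v :: real
  proof -
    let ?l = "[if B 0 1 then u else v, if B 0 2 then u else v, if B 0 3 then u else v, if B 0 4 then u else v, if B 1 2 then u else v, if B 1 3 then u else v, if B 1 4 then u else v, if B 2 3 then u else v, if B 2 4 then u else v, if B 3 4 then u else v]"
    have ex: "\<exists>h. (l, h) \<in> set T" if "l \<in> set (map fst T)" for l :: "real list" and T :: "(real list \<times> real) list"
      using that by auto
    have "\<exists>h. (\<kappa>, ?l, h) \<in> points"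
      using mem
    proof (elim disjE conjE)
      assume "\<kappa> ^ 2 = 1" "?l \<in> set (map fst matching_table)"
      then have "\<kappa> \<in> {1, - 1}" "\<exists>h. (?l, h) \<in> set matching_table" using ex by (simp_all only: power2_eq_1_iff) simp_all
      then show ?thesis unfolding points_def by blast
    next
      assume "\<kappa> ^ 2 = - 3 / 5" "?l \<in> set (map fst pentagon_table)"
      then have "\<kappa> \<in> {omega, - omega}" "\<exists>h. (?l, h) \<in> set pentagon_table"
        using ex by (simp_all only: omega(1)[symmetric] power2_eq_iff) simp_all
      then show ?thesis unfolding points_def by blast
    qed
    then obtain h where h: "(\<kappa>, ?l, h) \<in> points" ..
    show ?thesis
    proof (rule bexI[OF _ h], safe)
      fix i j assume ij: "(i, j) \<in> edges 4"
      then have "conf ?l i j = (if B i j then u else v)" using conf_of_relation[of B u v, OF B] by blast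
      then show "z i j = config_of (\<kappa>, ?l, h) i j" using z ij by fastforce
    qed
  qed
  from b show ?thesis
  proof
    assume A: "\<forall>i j. i \<noteq> j \<longrightarrow> i \<le> 4 \<longrightarrow> j \<le> 4 \<longrightarrow> z i j = b \<or> z i j = 3 * b"
    define B where "B i j \<longleftrightarrow> z i j = 3 * b" for i j
    have B: "B i j = B j i" for i j using symmetricD[OF sym, of i j] by (simp add: B_def)
    have z: "z i j = b * (if B i j then 3 else 1)" if "i \<noteq> j" "i \<le> 4" "j \<le> 4" for i j
      using A that by (auto simp: B_def)
    define r where "r = 3 / b ^ 2"
    have H: "heron (if B i j then 3 else 1) (if B j k then 3 else 1) (if B i k then 3 else 1 :: complex) = r" if "i < j" "j < k" "k \<le> 4" for i j k
    proof -
      have "face z i j k = b ^ 2 * heron (if B i j then 3 else 1) (if B j k then 3 else 1) (if B i k then 3 else 1)"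
        using that z[of i j] z[of j k] z[of k i] B[of k i] by (simp add: face_def heron_def algebra_simps power2_eq_square)
      then show ?thesis using faces[OF that] \<open>b \<noteq> 0\<close> by (simp add: r_def field_simps)
    qed
    note HT = H[of 0 1 2, simplified] H[of 0 1 3, simplified] H[of 0 1 4, simplified] H[of 0 2 3, simplified] H[of 0 2 4, simplified] H[of 0 3 4, simplified] H[of 1 2 3, simplified] H[of 1 2 4, simplified] H[of 1 3 4, simplified] H[of 2 3 4, simplified]
    have "r = 3 \<or> r = 11 \<or> r = 27" using heron_1_3(4)[of "B 0 1" "B 1 2" "B 0 2"] H[of 0 1 2] by simp
    then show ?thesis
    proof (elim disjE)
      assume r: "r = 3"
      then have "b ^ 2 = 1" using \<open>b \<noteq> 0\<close> by (simp add: r_def field_simps)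
      have two: "\<not> (B i j \<and> B j k) \<and> \<not> (B j k \<and> B i k) \<and> \<not> (B i j \<and> B i k)" if "i < j" "j < k" "k \<le> 4" for i j k
        using H[OF that] unfolding r heron_1_3(1) .
      have "[if B 0 1 then 3 else 1, if B 0 2 then 3 else 1, if B 0 3 then 3 else 1, if B 0 4 then 3 else 1, if B 1 2 then 3 else 1, if B 1 3 then 3 else 1, if B 1 4 then 3 else 1, if B 2 3 then 3 else 1, if B 2 4 then 3 else 1, if B 3 4 then 3 else 1] \<in> set (map fst matching_table)"
        by (rule matching_membership; (rule two[THEN conjunct1] | rule two[THEN conjunct2, THEN conjunct1] |
              rule two[THEN conjunct2, THEN conjunct2]); simp)
      then show ?thesis
        using \<open>b ^ 2 = 1\<close> z by (intro point[of B b 3 1, OF B]) (auto simp: edges_def)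
    next
      assume r: "r = 11"
      have ex: "(B i j \<and> B j k \<and> \<not> B i k) \<or> (B i j \<and> \<not> B j k \<and> B i k) \<or> (\<not> B i j \<and> B j k \<and> B i k)" if "i < j" "j < k" "k \<le> 4" for i j k
        using H[OF that] unfolding r heron_1_3(2) .
      show ?thesis
        by (rule FalseE, rule no_two_of_three[OF ex[of 0 1 2] ex[of 0 1 3] ex[of 0 1 4] ex[of 0 2 3] ex[of 0 2 4] ex[of 0 3 4] ex[of 1 2 3] ex[of 1 2 4] ex[of 1 3 4] ex[of 2 3 4]], simp_all)
    next
      assume r: "r = 27"
      then have "(3 * b) ^ 2 = 1" using \<open>b \<noteq> 0\<close> by (simp add: r_def field_simps)
      have all: "B i j \<and> B j k \<and> B i k" if "i < j" "j < k" "k \<le> 4" for i j k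
        using H[OF that] unfolding r heron_1_3(3) .
      have "B i j" if "(i, j) \<in> edges 4" for i j
      proof -
        have "\<forall>(i, j)\<in>edges 4. B i j"
          using B all[of 0 1 2] all[of 0 3 4] all[of 1 3 4] all[of 2 3 4] all[of 1 2 4] all[of 0 2 3] all[of 1 2 3]
          by (subst all_edges_4[of B]) simp_all
        then show ?thesis using that by blast
      qed
      moreover have "[if False then 3 else 1, if False then 3 else 1, if False then 3 else 1, if False then 3 else 1, if False then 3 else 1, if False then 3 else 1, if False then 3 else 1, if False then 3 else 1, if False then 3 else 1, if False then 3 else 1] \<in> set (map fst matching_table)"
        by (rule matching_membership) simp_all
      ultimately show ?thesis
        using \<open>(3 * b) ^ 2 = 1\<close> z by (intro point[of "\<lambda>_ _. False" "3 * b" 3 1]) (auto simp: edges_def)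
    qed
  next
    assume A: "\<forall>i j. i \<noteq> j \<longrightarrow> i \<le> 4 \<longrightarrow> j \<le> 4 \<longrightarrow> z i j = b \<or> z i j = - b"
    define c where "c = z 0 1"
    have c: "c = b \<or> c = - b" using A[rule_format, of 0 1] by (simp add: c_def)
    then have "c \<noteq> 0" "c \<noteq> - c" using \<open>b \<noteq> 0\<close> by auto
    define B where "B i j \<longleftrightarrow> z i j = - c" for i j
    have B: "B i j = B j i" for i j using symmetricD[OF sym, of i j] by (simp add: B_def)
    have z: "z i j = c * (if B i j then - 1 else 1)" if "i \<noteq> j" "i \<le> 4" "j \<le> 4" for i j
      using A[rule_format, OF that] c by (auto simp: B_def)
    have B01: "\<not> B 0 1" using \<open>c \<noteq> - c\<close> by (simp add: B_def c_def)
    define r where "r = 3 / c ^ 2"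
    have H: "heron (if B i j then - 1 else 1) (if B j k then - 1 else 1) (if B i k then - 1 else 1 :: complex) = r" if "i < j" "j < k" "k \<le> 4" for i j k
    proof -
      have "face z i j k = c ^ 2 * heron (if B i j then - 1 else 1) (if B j k then - 1 else 1) (if B i k then - 1 else 1)"
        using that z[of i j] z[of j k] z[of k i] B[of k i] by (simp add: face_def heron_def algebra_simps power2_eq_square)
      then show ?thesis using faces[OF that] \<open>c \<noteq> 0\<close> by (simp add: r_def field_simps)
    qed
    have "r = 3 \<or> r = - 5" using heron_signs(3)[of "B 0 1" "B 1 2" "B 0 2"] H[of 0 1 2] by simp
    then show ?thesis
    proof
      assume r: "r = 3"
      then have "c ^ 2 = 1" using \<open>c \<noteq> 0\<close> by (simp add: r_def field_simps)
      have mono: "B i j = B j k \<and> B j k = B i k" if "i < j" "j < k" "k \<le> 4" for i j k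
        using H[OF that] unfolding r heron_signs(1) .
      have "\<not> B i j" if "(i, j) \<in> edges 4" for i j
      proof -
        have "\<forall>(i, j)\<in>edges 4. \<not> B i j"
        proof (subst all_edges_4)
          show "\<not> B i j \<Longrightarrow> \<not> B j i" for i j using B[of i j] by blast
          show "\<not> B 0 1 \<and> \<not> B 0 2 \<and> \<not> B 0 3 \<and> \<not> B 0 4 \<and> \<not> B 1 2 \<and> \<not> B 1 3 \<and> \<not> B 1 4 \<and> \<not> B 2 3 \<and> \<not> B 2 4 \<and> \<not> B 3 4"
            using B01 mono[of 0 1 2, simplified] mono[of 0 1 3, simplified] mono[of 0 1 4, simplified] mono[of 0 3 4, simplified]
              mono[of 0 2 3, simplified] mono[of 0 2 4, simplified] by (smt (z3) One_nat_def)
        qed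
        then show ?thesis using that by blast
      qed
      moreover have "[if False then 3 else 1, if False then 3 else 1, if False then 3 else 1, if False then 3 else 1, if False then 3 else 1, if False then 3 else 1, if False then 3 else 1, if False then 3 else 1, if False then 3 else 1, if False then 3 else 1] \<in> set (map fst matching_table)"
        by (rule matching_membership) simp_all
      ultimately show ?thesis
        using \<open>c ^ 2 = 1\<close> z by (intro point[of "\<lambda>_ _. False" c 3 1]) (auto simp: edges_def)
    next
      assume r: "r = - 5"
      have "c ^ 2 = (r * c ^ 2) / (- 5)" unfolding r by simp
      also have "r * c ^ 2 = 3" using \<open>c \<noteq> 0\<close> by (simp add: r_def)
      finally have "c ^ 2 = - 3 / 5" by simp
      have nonmono: "\<not> (B i j = B j k \<and> B j k = B i k)" if "i < j" "j < k" "k \<le> 4" for i j k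
        using H[OF that] unfolding r heron_signs(2) .
      have "[if B 0 1 then - 1 else 1, if B 0 2 then - 1 else 1, if B 0 3 then - 1 else 1, if B 0 4 then - 1 else 1, if B 1 2 then - 1 else 1, if B 1 3 then - 1 else 1, if B 1 4 then - 1 else 1, if B 2 3 then - 1 else 1, if B 2 4 then - 1 else 1, if B 3 4 then - 1 else 1] \<in> set (map fst pentagon_table)"
        by (rule pentagon_membership[OF B01]; rule nonmono; simp)
      then show ?thesis
        using \<open>c ^ 2 = - 3 / 5\<close> z by (intro point[of B c "- 1" 1, OF B]) (auto simp: edges_def)
    qed
  qed
qed

section \<open>At most 64 configurations and local solvability\<close>

definition near :: "nat \<Rightarrow> real \<Rightarrow> (nat \<Rightarrow> nat \<Rightarrow> complex) \<Rightarrow> (nat \<Rightarrow> nat \<Rightarrow> complex) \<Rightarrow> bool" where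
  "near n \<epsilon> x y \<longleftrightarrow> (\<forall>(i, j)\<in>edges n. cmod (x i j - y i j) < \<epsilon>)"

lemma nearD: "near n \<epsilon> x y \<Longrightarrow> (i, j) \<in> edges n \<Longrightarrow> cmod (x i j - y i j) < \<epsilon>"
  by (auto simp: near_def)

lemma near_converges:
  assumes "\<And>m. near n (\<delta> m) (y m) z" "\<delta> \<longlonglongrightarrow> 0"
  shows "converges n y z"
  unfolding converges_def
proof safe
  fix i j assume ij: "(i, j) \<in> edges n"
  have "(\<lambda>m. y m i j - z i j) \<longlonglongrightarrow> 0"
  proof (rule tendsto_0_le[OF assms(2), of _ 1], rule always_eventually, rule allI)
    fix m
    have "cmod (y m i j - z i j) < \<delta> m" by (rule nearD[OF assms(1) ij])
    also have "\<delta> m \<le> norm (\<delta> m) * 1" by simp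
    finally show "cmod (y m i j - z i j) \<le> norm (\<delta> m) * 1" by simp
  qed
  then show "(\<lambda>m. y m i j) \<longlonglongrightarrow> z i j" by (simp add: LIM_zero_iff)
qed

lemma inverse_Suc_tendsto: "(\<lambda>m. 1 / real (Suc m)) \<longlonglongrightarrow> 0"
  using LIMSEQ_inverse_real_of_nat by (simp add: inverse_eq_divide)

lemma same_areas_sym: "same_areas n x y \<Longrightarrow> same_areas n y x"
  by (simp add: same_areas_def)

lemma same_areas_trans: "same_areas n x y \<Longrightarrow> same_areas n y z \<Longrightarrow> same_areas n x z"
  by (simp add: same_areas_def)

lemma converging_faces_tend:
  assumes "converges n s (\<lambda>_ _. 1)" "\<And>m. same_areas n (s m) (y m)"
  shows "faces_tend n y"
  unfolding faces_tend_def
proof (intro allI impI)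
  fix i j k assume ijk: "i < j" "j < k" "k \<le> n"
  then have "(\<lambda>m. face (s m) i j k) \<longlonglongrightarrow> face (\<lambda>_ _. 1) i j k"
    by (intro face_tendsto[OF assms(1)]) auto
  moreover have "face (s m) i j k = face (y m) i j k" for m
    using assms(2)[of m] ijk by (simp add: same_areas_def face_def)
  ultimately show "(\<lambda>m. face (y m) i j k) \<longlonglongrightarrow> 3" by (simp add: face_def heron_def)
qed

lemma faces_tend_subseq:
  assumes "faces_tend n Z" "strict_mono r"
  shows "faces_tend n (\<lambda>m. Z (r m))"
  using assms(1) LIMSEQ_subseq_LIMSEQ[OF _ assms(2)] unfolding faces_tend_def o_def by blast

text \<open>
  If this failed for every \<open>\<epsilon>\<close>, there would be sequences of 65 different configurations
  each. A common subsequence converges, and each limit is one of the 64 points, so two of the sequences have the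
  same limit. Nondegeneracy forbids this.
\<close>

lemma at_most_64:
  "\<exists>\<epsilon>>0. \<forall>s. symmetric s \<longrightarrow> near 4 \<epsilon> s (\<lambda>_ _. 1) \<longrightarrow>
    \<not> (\<exists>y. (\<forall>t<65::nat. symmetric (y t) \<and> same_areas 4 s (y t)) \<and>
          (\<forall>t<65. \<forall>t'<65. t \<noteq> t' \<longrightarrow> (\<exists>(i, j)\<in>edges 4. y t i j \<noteq> y t' i j)))"
proof (rule ccontr)
  assume *: "\<not> ?thesis"
  define bad where "bad m s y \<longleftrightarrow> symmetric s \<and> near 4 (1 / real (Suc m)) s (\<lambda>_ _. 1) \<and>
    (\<forall>t<65::nat. symmetric (y t) \<and> same_areas 4 s (y t)) \<and>
    (\<forall>t<65. \<forall>t'<65. t \<noteq> t' \<longrightarrow> (\<exists>(i, j)\<in>edges 4. y t i j \<noteq> y t' i j))" for m s y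
  have "\<exists>s y. bad m s y" for m
  proof -
    have "1 / real (Suc m) > 0" by simp
    then show ?thesis using * unfolding bad_def by blast
  qed
  then obtain s y where bad: "\<And>m. bad m (s m) (y m)" by metis
  have s: "\<And>m. symmetric (s m)" "\<And>m. near 4 (1 / real (Suc m)) (s m) (\<lambda>_ _. 1)"
    and y: "\<And>m t. t < 65 \<Longrightarrow> symmetric (y m t)" "\<And>m t. t < 65 \<Longrightarrow> same_areas 4 (s m) (y m t)"
    and diff: "\<And>m t t'. t < (65::nat) \<Longrightarrow> t' < 65 \<Longrightarrow> t \<noteq> t' \<Longrightarrow> \<exists>(i, j)\<in>edges 4. y m t i j \<noteq> y m t' i j"
    using bad unfolding bad_def by blast+
  have s1: "converges 4 s (\<lambda>_ _. 1)" by (rule near_converges[OF s(2) inverse_Suc_tendsto])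
  define Z where "Z t m = (if t < 65 then y m t else (\<lambda>_ _. 0))" for t m
  have Zy: "Z t = (\<lambda>m. y m t)" if "t < 65" for t using that by (auto simp: Z_def)
  have symZ: "symmetric (Z t m)" for t m using y(1) by (simp add: Z_def symmetric_def)
  have faces: "faces_tend 4 (Z t)" if "t < 65" for t
    by (rule converging_faces_tend[OF s1]) (use y(2) that Zy in auto)
  have "\<exists>r q. strict_mono (r :: nat \<Rightarrow> nat) \<and> (\<forall>t\<in>{..<65}. symmetric (q t) \<and> converges 4 (\<lambda>m. Z t (r m)) (q t))"
  proof (rule convergent_subsequences[OF _ symZ])
    fix t i j assume "t \<in> {..<65::nat}" and ij: "(i, j) \<in> edges 4"
    then obtain B where B: "\<forall>m. edge_norm 4 (Z t m) \<le> B" using faces_tend_bounded[OF symZ faces] by auto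
    have "cmod (Z t m i j) \<le> B" for m
      using edge_norm_ge[OF ij, of "Z t m"] B[rule_format, of m] by (rule order_trans)
    then show "\<exists>B. \<forall>m. cmod (Z t m i j) \<le> B" by blast
  qed simp
  then obtain r q where r: "strict_mono (r :: nat \<Rightarrow> nat)"
    and q: "\<And>t. t < 65 \<Longrightarrow> symmetric (q t)" "\<And>t. t < 65 \<Longrightarrow> converges 4 (\<lambda>m. Z t (r m)) (q t)"
    by auto
  have "\<exists>p\<in>points. \<forall>(i, j)\<in>edges 4. q t i j = config_of p i j" if "t < 65" for t
    using faces_tend_limit[OF symZ faces_tend_subseq[OF faces[OF that] r] q(2)[OF that]] q(1)[OF that]
    by (intro limit_is_point) auto
  then have "\<forall>t\<in>{..<65}. \<exists>p. p \<in> points \<and> (\<forall>(i, j)\<in>edges 4. q t i j = config_of p i j)" by blast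
  from bchoice[OF this] obtain p where p: "\<And>t. t < 65 \<Longrightarrow> p t \<in> points"
    "\<And>t i j. t < 65 \<Longrightarrow> (i, j) \<in> edges 4 \<Longrightarrow> q t i j = config_of (p t) i j"
    by fastforce
  have "p ` {..<65} \<subseteq> points" using p(1) by auto
  then have "card (p ` {..<65}) \<le> 64" using card_mono[OF card_points(1)] card_points(2) by metis
  then have "\<not> inj_on p {..<65}" using card_image[of p "{..<65}"] by auto
  then obtain t t' where t: "t < 65" "t' < 65" "t \<noteq> t'" "p t = p t'" by (auto simp: inj_on_def)
  have conv: "converges 4 (\<lambda>m. Z u (r m)) (config_of (p u))" if "u < 65" for u
    using q(2)[OF that] p(2)[OF that] by (auto simp: converges_def)
  have "\<exists>m. \<forall>(i, j)\<in>edges 4. Z t (r m) i j = Z t' (r m) i j"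
  proof (rule nondegenerate_locally_injective[OF nondegenerate_point[OF p(1)[OF t(1)]] symZ symZ conv[OF t(1)]])
    show "converges 4 (\<lambda>m. Z t' (r m)) (config_of (p t))" using conv[OF t(2)] t(4) by simp
    show "same_areas 4 (Z t (r m)) (Z t' (r m))" for m
      using y(2)[OF t(1), of "r m"] y(2)[OF t(2), of "r m"] t Zy
      by (auto intro: same_areas_trans same_areas_sym)
  qed
  then show False using diff[OF t(1-3)] t Zy by fastforce
qed

text \<open>
  Index types for the ten edges and the ten faces on five points, so that invariance of domain for Euclidean
  spaces applies to the face map.
\<close>

typedef edge5 = "{(i, j). i < j \<and> j \<le> (4::nat)}"
  by (rule exI[of _ "(0, 1)"]) simp

typedef face5 = "{(i, j, k). i < j \<and> j < k \<and> k \<le> (4::nat)}"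
  by (rule exI[of _ "(0, 1, 2)"]) simp

lemma edge5_set: "{(i, j). i < j \<and> j \<le> (4::nat)} = {(0,1),(0,2),(0,3),(0,4),(1,2),(1,3),(1,4),(2,3),(2,4),(3,4)}" (is "?L = ?R")
proof
  show "?L \<subseteq> ?R"
  proof (rule subsetI)
    fix e :: "nat \<times> nat" assume "e \<in> ?L"
    then obtain i j where e: "e = (i, j)" "i < j" "j \<le> 4" by blast
    then have "i \<in> {0,1,2,3}" "j \<in> {1,2,3,4}" by auto
    with e show "e \<in> ?R" by auto
  qed
qed auto

lemma face5_set: "{(i, j, k). i < j \<and> j < k \<and> k \<le> (4::nat)} =
    {(0,1,2),(0,1,3),(0,1,4),(0,2,3),(0,2,4),(0,3,4),(1,2,3),(1,2,4),(1,3,4),(2,3,4)}" (is "?L = ?R")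
proof
  have R: "\<forall>i j k. i < j \<longrightarrow> j < k \<longrightarrow> k \<le> 4 \<longrightarrow> (i, j, k) \<in> ?R" unfolding all_triples_4 by simp
  show "?L \<subseteq> ?R"
  proof (rule subsetI)
    fix t :: "nat \<times> nat \<times> nat" assume "t \<in> ?L"
    then obtain i j k where t: "t = (i, j, k)" "i < j" "j < k" "k \<le> 4" by blast
    show "t \<in> ?R" unfolding t(1) by (rule R[rule_format, OF t(2-4)])
  qed
qed auto

instance edge5 :: finite
proof
  have "finite (Abs_edge5 ` {(i, j). i < j \<and> j \<le> (4::nat)})" unfolding edge5_set by (intro finite_imageI) simp
  then show "finite (UNIV :: edge5 set)" unfolding type_definition.Abs_image[OF type_definition_edge5] .
qed

instance face5 :: finite
proof
  have "finite (Abs_face5 ` {(i, j, k). i < j \<and> j < k \<and> k \<le> (4::nat)})" unfolding face5_set by (intro finite_imageI) simp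
  then show "finite (UNIV :: face5 set)" unfolding type_definition.Abs_image[OF type_definition_face5] .
qed

lemma CARD_edge5_face5: "CARD(edge5) = CARD(face5)"
  unfolding type_definition.card[OF type_definition_edge5] type_definition.card[OF type_definition_face5]
    edge5_set face5_set by simp

definition config_of_vec :: "complex ^ edge5 \<Rightarrow> nat \<Rightarrow> nat \<Rightarrow> complex" where
  "config_of_vec v i j = v $ Abs_edge5 (min i j, max i j)"

definition vec_of_config :: "(nat \<Rightarrow> nat \<Rightarrow> complex) \<Rightarrow> complex ^ edge5" where
  "vec_of_config x = (\<chi> e. case Rep_edge5 e of (i, j) \<Rightarrow> x i j)"

lemma symmetric_config_of_vec: "symmetric (config_of_vec v)"
  by (simp add: symmetric_def config_of_vec_def min.commute max.commute)

lemma config_of_vec_of_config: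
  assumes "symmetric x" "(i, j) \<in> edges 4"
  shows "config_of_vec (vec_of_config x) i j = x i j"
proof -
  have "(min i j, max i j) \<in> {(i, j). i < j \<and> j \<le> (4::nat)}"
    using assms(2) by (auto simp: edges_def min_def max_def)
  then have "config_of_vec (vec_of_config x) i j = x (min i j) (max i j)"
    by (simp add: config_of_vec_def vec_of_config_def Abs_edge5_inverse)
  then show ?thesis using symmetricD[OF assms(1), of i j] by (auto simp: min_def max_def)
qed

definition faces_vec :: "complex ^ edge5 \<Rightarrow> complex ^ face5" where
  "faces_vec v = (\<chi> t. case Rep_face5 t of (i, j, k) \<Rightarrow> face (config_of_vec v) i j k)"

lemma continuous_faces_vec: "continuous_on A faces_vec"
proof -
  have "continuous_on A (\<lambda>v. face (config_of_vec v) i j k)" for i j k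
    unfolding face_def heron_def config_of_vec_def by (intro continuous_intros)
  then show ?thesis
    unfolding faces_vec_def by (intro continuous_on_vec_lambda) (simp add: case_prod_unfold)
qed

lemma face_cong:
  assumes "\<forall>(i, j)\<in>edges n. x i j = y i j" "i < j" "j < k" "k \<le> n"
  shows "face x i j k = face y i j k"
  using assms by (auto simp: face_def edges_def)

text \<open>
  An injective continuous map between spaces of the same dimension is open by invariance of domain, so that
  injectivity alone yields solutions for all nearby values of the faces.
\<close>

lemma locally_solvable:
  assumes z: "symmetric z" and r: "r > 0"
    and inj: "\<And>y y'. symmetric y \<Longrightarrow> symmetric y' \<Longrightarrow> near 4 r y z \<Longrightarrow> near 4 r y' z \<Longrightarrow> same_areas 4 y y' \<Longrightarrow>
      \<forall>(i, j)\<in>edges 4. y i j = y' i j"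
  shows "\<exists>\<delta>>0. \<forall>S. (\<forall>i j k. i < j \<longrightarrow> j < k \<longrightarrow> k \<le> 4 \<longrightarrow> cmod (S i j k - face z i j k) < \<delta>) \<longrightarrow>
    (\<exists>y. symmetric y \<and> near 4 r y z \<and> (\<forall>i j k. i < j \<longrightarrow> j < k \<longrightarrow> k \<le> 4 \<longrightarrow> face y i j k = S i j k))"
proof -
  define V where "V = {v. \<forall>e. cmod (v $ e - vec_of_config z $ e) < r}"
  have V: "near 4 r (config_of_vec v) z" if "v \<in> V" for v
    unfolding near_def
  proof safe
    fix i j assume ij: "(i, j) \<in> edges 4"
    have "config_of_vec v i j - z i j = v $ Abs_edge5 (min i j, max i j) - vec_of_config z $ Abs_edge5 (min i j, max i j)"
      unfolding config_of_vec_of_config[OF z ij, symmetric] by (simp add: config_of_vec_def)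
    then show "cmod (config_of_vec v i j - z i j) < r" using that by (simp add: V_def)
  qed
  have "open V"
  proof -
    have "V = (\<Inter>e. {v. cmod (v $ e - vec_of_config z $ e) < r})" by (auto simp: V_def)
    moreover have "open {v. cmod (v $ e - vec_of_config z $ e) < r}" for e
      by (intro open_Collect_less continuous_intros)
    ultimately show ?thesis by (simp add: open_INT)
  qed
  have "inj_on faces_vec V"
  proof (rule inj_onI)
    fix v v' assume v: "v \<in> V" "v' \<in> V" and eq: "faces_vec v = faces_vec v'"
    have "same_areas 4 (config_of_vec v) (config_of_vec v')"
    proof (rule same_areasI)
      fix i j k :: nat assume "i < j" "j < k" "k \<le> 4"
      then have "Rep_face5 (Abs_face5 (i, j, k)) = (i, j, k)" by (simp add: Abs_face5_inverse)
      then show "face (config_of_vec v) i j k = face (config_of_vec v') i j k"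
        using arg_cong[OF eq, of "\<lambda>u. u $ Abs_face5 (i, j, k)"] by (simp add: faces_vec_def)
    qed
    then have *: "\<forall>(i, j)\<in>edges 4. config_of_vec v i j = config_of_vec v' i j"
      using inj[OF symmetric_config_of_vec symmetric_config_of_vec V[OF v(1)] V[OF v(2)]] by blast
    show "v = v'"
    proof (rule vec_eq_iff[THEN iffD2], rule allI)
      fix e
      obtain i j where e: "Rep_edge5 e = (i, j)" "i < j" "j \<le> 4" using Rep_edge5[of e] by auto
      then have "e = Abs_edge5 (i, j)" by (metis Rep_edge5_inverse)
      moreover have "(i, j) \<in> edges 4" using e(2,3) by (simp add: edges_def)
      then have "config_of_vec v i j = config_of_vec v' i j" using * by blast
      ultimately show "v $ e = v' $ e" using e(2) by (simp add: config_of_vec_def min_def max_def)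
    qed
  qed
  then have "open (faces_vec ` V)"
    by (intro invariance_of_domain_gen[OF \<open>open V\<close> continuous_faces_vec]) (simp_all add: CARD_edge5_face5)
  moreover have "vec_of_config z \<in> V" using r by (simp add: V_def)
  ultimately obtain d where d: "d > 0" "ball (faces_vec (vec_of_config z)) d \<subseteq> faces_vec ` V"
    by (meson imageI openE)
  define \<delta> where "\<delta> = d / real (CARD(face5))"
  have "\<delta> > 0" using d(1) by (simp add: \<delta>_def)
  moreover have "\<exists>y. symmetric y \<and> near 4 r y z \<and> (\<forall>i j k. i < j \<longrightarrow> j < k \<longrightarrow> k \<le> 4 \<longrightarrow> face y i j k = S i j k)"
    if S: "\<forall>i j k. i < j \<longrightarrow> j < k \<longrightarrow> k \<le> 4 \<longrightarrow> cmod (S i j k - face z i j k) < \<delta>" for S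
  proof -
    define u :: "complex ^ face5" where "u = (\<chi> t. case Rep_face5 t of (i, j, k) \<Rightarrow> S i j k)"
    have comp: "cmod ((u - faces_vec (vec_of_config z)) $ t) < \<delta>" for t
    proof -
      obtain i j k where t: "Rep_face5 t = (i, j, k)" "i < j" "j < k" "k \<le> 4" using Rep_face5[of t] by auto
      have "face (config_of_vec (vec_of_config z)) i j k = face z i j k"
        by (rule face_cong[OF _ t(2-4)]) (use config_of_vec_of_config[OF z] in auto)
      then show ?thesis using S t by (simp add: u_def faces_vec_def)
    qed
    have "norm (u - faces_vec (vec_of_config z)) \<le> (\<Sum>t\<in>UNIV. cmod ((u - faces_vec (vec_of_config z)) $ t))"
      unfolding norm_vec_def by (rule L2_set_le_sum) simp
    also have "\<dots> < (\<Sum>t\<in>(UNIV :: face5 set). \<delta>)" by (rule sum_strict_mono) (use comp in auto)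
    also have "\<dots> = d" by (simp add: \<delta>_def)
    finally have "u \<in> ball (faces_vec (vec_of_config z)) d" by (simp add: dist_norm norm_minus_commute)
    then obtain v where v: "v \<in> V" "u = faces_vec v" using d(2) by blast
    have "face (config_of_vec v) i j k = S i j k" if "i < j" "j < k" "k \<le> 4" for i j k
    proof -
      have "Rep_face5 (Abs_face5 (i, j, k)) = (i, j, k)" using that by (simp add: Abs_face5_inverse)
      then show ?thesis using arg_cong[OF v(2), of "\<lambda>u. u $ Abs_face5 (i, j, k)"] by (simp add: faces_vec_def u_def)
    qed
    then show ?thesis using V[OF v(1)] symmetric_config_of_vec by blast
  qed
  ultimately show ?thesis by blast
qed

section \<open>At least 64 configurations\<close>

lemma injectivity_radius:
  assumes z: "nondegenerate n z"
  shows "\<exists>r>0. \<forall>y y'. symmetric y \<longrightarrow> symmetric y' \<longrightarrow> near n r y z \<longrightarrow> near n r y' z \<longrightarrow> same_areas n y y' \<longrightarrow>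
    (\<forall>(i, j)\<in>edges n. y i j = y' i j)"
proof (rule ccontr)
  assume *: "\<not> ?thesis"
  define bad where "bad m y y' \<longleftrightarrow> symmetric y \<and> symmetric y' \<and> near n (1 / real (Suc m)) y z \<and> near n (1 / real (Suc m)) y' z \<and>
    same_areas n y y' \<and> \<not> (\<forall>(i, j)\<in>edges n. y i j = y' i j)" for m y y'
  have "\<exists>y y'. bad m y y'" for m
  proof -
    have "1 / real (Suc m) > 0" by simp
    then show ?thesis using * unfolding bad_def by blast
  qed
  then obtain y y' where bad: "\<And>m. bad m (y m) (y' m)" by metis
  have y: "\<And>m. symmetric (y m)" "\<And>m. symmetric (y' m)" "\<And>m. near n (1 / real (Suc m)) (y m) z"
    "\<And>m. near n (1 / real (Suc m)) (y' m) z" "\<And>m. same_areas n (y m) (y' m)"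
    and diff: "\<And>m. \<not> (\<forall>(i, j)\<in>edges n. y m i j = y' m i j)"
    using bad unfolding bad_def by blast+
  show False
    using nondegenerate_locally_injective[OF z y(1,2) near_converges[OF y(3) inverse_Suc_tendsto]
        near_converges[OF y(4) inverse_Suc_tendsto] y(5)] diff by blast
qed

lemma near_mono: "near n \<epsilon> x y \<Longrightarrow> \<epsilon> \<le> \<epsilon>' \<Longrightarrow> near n \<epsilon>' x y"
  by (fastforce simp: near_def)

lemma near_trans: "near n \<epsilon> x y \<Longrightarrow> near n \<epsilon>' y z \<Longrightarrow> near n (\<epsilon> + \<epsilon>') x z"
  unfolding near_def
proof safe
  fix i j assume *: "\<forall>(i, j)\<in>edges n. cmod (x i j - y i j) < \<epsilon>" "\<forall>(i, j)\<in>edges n. cmod (y i j - z i j) < \<epsilon>'" "(i, j) \<in> edges n"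
  have "cmod (x i j - z i j) \<le> cmod (x i j - y i j) + cmod (y i j - z i j)"
    by (metis add_diff_eq diff_add_cancel norm_triangle_ineq)
  then show "cmod (x i j - z i j) < \<epsilon> + \<epsilon>'" using * by fastforce
qed

lemma faces_continuous:
  assumes "\<delta> > 0"
  shows "\<exists>\<epsilon>>0. \<forall>s. near n \<epsilon> s c \<longrightarrow> (\<forall>i j k. i < j \<longrightarrow> j < k \<longrightarrow> k \<le> n \<longrightarrow> cmod (face s i j k - face c i j k) < \<delta>)"
proof (rule ccontr)
  assume *: "\<not> ?thesis"
  define bad where "bad m s i j k \<longleftrightarrow> near n (1 / real (Suc m)) s c \<and> i < j \<and> j < k \<and> k \<le> n \<and>
    \<not> cmod (face s i j k - face c i j k) < \<delta>" for m s i j k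
  have "\<exists>s i j k. bad m s i j k" for m
  proof -
    have "1 / real (Suc m) > 0" by simp
    then show ?thesis using * unfolding bad_def by blast
  qed
  then obtain s i j k where bad: "\<And>m. bad m (s m) (i m) (j m) (k m)" by metis
  have s: "\<And>m. near n (1 / real (Suc m)) (s m) c"
    and ijk: "\<And>m. i m < j m" "\<And>m. j m < k m" "\<And>m. k m \<le> n"
    and far: "\<And>m. \<not> cmod (face (s m) (i m) (j m) (k m) - face c (i m) (j m) (k m)) < \<delta>"
    using bad unfolding bad_def by blast+
  have conv: "converges n s c" by (rule near_converges[OF s inverse_Suc_tendsto])
  define T where "T = {..n} \<times> {..n} \<times> {..n}"
  have "\<forall>\<^sub>F m in sequentially. \<forall>(a, b, d)\<in>{(a, b, d) \<in> T. a < b \<and> b < d}. cmod (face (s m) a b d - face c a b d) < \<delta>"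
  proof (rule eventually_ball_finite)
    show "finite {(a, b, d) \<in> T. a < b \<and> b < d}" by (rule finite_subset[of _ T]) (auto simp: T_def)
    show "\<forall>t\<in>{(a, b, d) \<in> T. a < b \<and> b < d}. \<forall>\<^sub>F m in sequentially. case t of (a, b, d) \<Rightarrow> cmod (face (s m) a b d - face c a b d) < \<delta>"
    proof safe
      fix a b d assume "(a, b, d) \<in> T" "a < b" "b < d"
      then have "(\<lambda>m. face (s m) a b d) \<longlonglongrightarrow> face c a b d" by (intro face_tendsto[OF conv]) (auto simp: T_def)
      then show "\<forall>\<^sub>F m in sequentially. cmod (face (s m) a b d - face c a b d) < \<delta>"
        using assms unfolding tendsto_iff dist_norm by blast
    qed
  qed
  then obtain m where "\<forall>(a, b, d)\<in>{(a, b, d) \<in> T. a < b \<and> b < d}. cmod (face (s m) a b d - face c a b d) < \<delta>"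
    by (auto simp: eventually_sequentially)
  moreover have "(i m, j m, k m) \<in> {(a, b, d) \<in> T. a < b \<and> b < d}" using ijk[of m] by (auto simp: T_def)
  ultimately show False using far[of m] by blast
qed

lemma finite_min_pos:
  assumes "finite T" "\<And>t. t \<in> T \<Longrightarrow> f t > (0 :: real)"
  shows "\<exists>\<mu>>0. \<forall>t\<in>T. \<mu> \<le> f t"
  using assms
proof (induction T rule: finite_induct)
  case empty
  show ?case by (intro exI[of _ 1]) simp
next
  case (insert a T)
  then obtain \<mu> where "\<mu> > 0" "\<forall>t\<in>T. \<mu> \<le> f t" by auto
  then show ?case using insert.prems[of a] by (intro exI[of _ "min \<mu> (f a)"]) auto
qed

text \<open>
  A solution \<open>y t\<close> for the faces \<open>S\<close> near each of the 64 configurations \<open>z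
  t\<close>.
\<close>

definition solutions_in :: "real \<Rightarrow> ((nat \<Rightarrow> nat \<Rightarrow> nat \<Rightarrow> complex)) \<Rightarrow> ((complex \<times> real list \<times> real) \<Rightarrow> nat \<Rightarrow> nat \<Rightarrow> complex) \<Rightarrow>
    ((complex \<times> real list \<times> real) \<Rightarrow> nat \<Rightarrow> nat \<Rightarrow> complex) \<Rightarrow> bool" where
  "solutions_in \<rho> S z y \<longleftrightarrow> (\<forall>t\<in>points. symmetric (y t) \<and> near 4 \<rho> (y t) (z t) \<and>
     (\<forall>i j k. i < j \<longrightarrow> j < k \<longrightarrow> k \<le> 4 \<longrightarrow> face (y t) i j k = S i j k))"

lemma solvable_at_all_points:
  assumes r: "r > 0" and inj: "\<And>t y y'. t \<in> points \<Longrightarrow> symmetric y \<Longrightarrow> symmetric y' \<Longrightarrow> near 4 r y (z t) \<Longrightarrow> near 4 r y' (z t) \<Longrightarrow>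
      same_areas 4 y y' \<Longrightarrow> \<forall>(i, j)\<in>edges 4. y i j = y' i j"
    and z: "\<And>t. t \<in> points \<Longrightarrow> symmetric (z t)"
    and S: "\<And>t i j k. t \<in> points \<Longrightarrow> i < j \<Longrightarrow> j < k \<Longrightarrow> k \<le> 4 \<Longrightarrow> face (z t) i j k = S i j k"
  shows "\<exists>\<delta>>0. \<forall>S'. (\<forall>i j k. i < j \<longrightarrow> j < k \<longrightarrow> k \<le> 4 \<longrightarrow> cmod (S' i j k - S i j k) < \<delta>) \<longrightarrow> (\<exists>y. solutions_in r S' z y)"
proof -
  have "\<exists>\<delta>>0. \<forall>S'. (\<forall>i j k. i < j \<longrightarrow> j < k \<longrightarrow> k \<le> 4 \<longrightarrow> cmod (S' i j k - S i j k) < \<delta>) \<longrightarrow>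
    (\<exists>y. symmetric y \<and> near 4 r y (z t) \<and> (\<forall>i j k. i < j \<longrightarrow> j < k \<longrightarrow> k \<le> 4 \<longrightarrow> face y i j k = S' i j k))"
    if t: "t \<in> points" for t
  proof -
    have "\<exists>\<delta>>0. \<forall>S'. (\<forall>i j k. i < j \<longrightarrow> j < k \<longrightarrow> k \<le> 4 \<longrightarrow> cmod (S' i j k - face (z t) i j k) < \<delta>) \<longrightarrow>
      (\<exists>y. symmetric y \<and> near 4 r y (z t) \<and> (\<forall>i j k. i < j \<longrightarrow> j < k \<longrightarrow> k \<le> 4 \<longrightarrow> face y i j k = S' i j k))"
      by (rule locally_solvable[OF z[OF t] r inj[OF t]])
    then show ?thesis using S[OF t] by (simp cong: imp_cong)
  qed
  then obtain d where d: "\<And>t. t \<in> points \<Longrightarrow> d t > 0"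
    "\<And>t S'. t \<in> points \<Longrightarrow> (\<forall>i j k. i < j \<longrightarrow> j < k \<longrightarrow> k \<le> 4 \<longrightarrow> cmod (S' i j k - S i j k) < d t) \<Longrightarrow>
    (\<exists>y. symmetric y \<and> near 4 r y (z t) \<and> (\<forall>i j k. i < j \<longrightarrow> j < k \<longrightarrow> k \<le> 4 \<longrightarrow> face y i j k = S' i j k))"
    by metis
  obtain \<delta> where \<delta>: "\<delta> > 0" "\<forall>t\<in>points. \<delta> \<le> d t" using finite_min_pos[of points d, OF card_points(1) d(1)] by blast
  have "\<exists>y. solutions_in r S' z y" if S': "\<forall>i j k. i < j \<longrightarrow> j < k \<longrightarrow> k \<le> 4 \<longrightarrow> cmod (S' i j k - S i j k) < \<delta>" for S'
  proof -
    have "\<exists>y. symmetric y \<and> near 4 r y (z t) \<and> (\<forall>i j k. i < j \<longrightarrow> j < k \<longrightarrow> k \<le> 4 \<longrightarrow> face y i j k = S' i j k)"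
      if t: "t \<in> points" for t
      by (rule d(2)[OF t]) (use S' \<delta>(2) t in \<open>meson less_le_trans\<close>)
    then show ?thesis unfolding solutions_in_def by metis
  qed
  then show ?thesis using \<delta>(1) by blast
qed

lemma test_direction_bound: "cmod (of_real (test_direction i j k)) \<le> 8"
  by (auto simp: test_direction_def)

text \<open>
  Follow the solutions for the faces \<open>3 + \<tau> * test_direction\<close> as \<open>\<tau>\<close> tends
  to \<open>0\<close>. Their entries on the edge 01 tend to those of the limit points and their difference
  quotients tend to the slopes, so by \<open>points_distinct\<close> they are eventually different.
\<close>

lemma separated_solutions:
  fixes r :: real
  assumes r: "r > 0" and inj: "\<And>t y y'. t \<in> points \<Longrightarrow> symmetric y \<Longrightarrow> symmetric y' \<Longrightarrow> near 4 r y (config_of t) \<Longrightarrow>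
      near 4 r y' (config_of t) \<Longrightarrow> same_areas 4 y y' \<Longrightarrow> \<forall>(i, j)\<in>edges 4. y i j = y' i j"
  shows "\<exists>S y. solutions_in r S config_of y \<and> inj_on (\<lambda>t. y t 0 1) points"
proof -
  have "\<exists>\<tau> y. \<tau> > 0 \<and> solutions_in (r / real (Suc m)) (\<lambda>i j k. 3 + of_real (\<tau> * test_direction i j k)) config_of y" for m
  proof -
    have rm: "r / real (Suc m) > 0" "r / real (Suc m) \<le> r"
      using r by (auto simp: field_simps)
    have "\<exists>\<delta>>0. \<forall>S'. (\<forall>i j k. i < j \<longrightarrow> j < k \<longrightarrow> k \<le> 4 \<longrightarrow> cmod (S' i j k - 3) < \<delta>) \<longrightarrow>
        (\<exists>y. solutions_in (r / real (Suc m)) S' config_of y)"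
    proof (rule solvable_at_all_points[OF rm(1)])
      show "\<forall>(i, j)\<in>edges 4. y i j = y' i j"
        if "t \<in> points" "symmetric y" "symmetric y'" "near 4 (r / real (Suc m)) y (config_of t)"
          "near 4 (r / real (Suc m)) y' (config_of t)" "same_areas 4 y y'" for t y y'
        by (rule inj[OF that(1-3) near_mono[OF that(4) rm(2)] near_mono[OF that(5) rm(2)] that(6)])
    qed (simp_all only: symmetric_config_of face_point)
    then obtain \<delta> where \<delta>: "\<delta> > 0" "\<And>S'. (\<forall>i j k. i < j \<longrightarrow> j < k \<longrightarrow> k \<le> 4 \<longrightarrow> cmod (S' i j k - 3) < \<delta>) \<Longrightarrow>
        \<exists>y. solutions_in (r / real (Suc m)) S' config_of y"
      by blast
    have "\<exists>y. solutions_in (r / real (Suc m)) (\<lambda>i j k. 3 + of_real ((\<delta> / 9) * test_direction i j k)) config_of y"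
    proof (rule \<delta>(2), intro allI impI)
      fix i j k
      have "cmod (of_real ((\<delta> / 9) * test_direction i j k)) \<le> \<delta> / 9 * 8"
        using test_direction_bound[of i j k] \<delta>(1) unfolding of_real_mult norm_mult by (intro mult_mono) auto
      then show "cmod (3 + of_real ((\<delta> / 9) * test_direction i j k) - 3) < \<delta>" using \<delta>(1) by simp
    qed
    then show ?thesis using \<delta>(1) by (intro exI[of _ "\<delta> / 9"]) auto
  qed
  then obtain \<tau> y where \<tau>: "\<And>m. \<tau> m > 0"
    and y: "\<And>m. solutions_in (r / real (Suc m)) (\<lambda>i j k. 3 + of_real (\<tau> m * test_direction i j k)) config_of (y m)"
    by metis
  define Z where "Z t m = (if t \<in> points then y m t else config_of t)" for t m
  have Zy: "Z t m = y m t" if "t \<in> points" for t m using that by (simp add: Z_def)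
  have symZ: "symmetric (Z t m)" for t m
    using y[of m] symmetric_config_of by (auto simp: Z_def solutions_in_def)
  have conv: "converges 4 (Z t) (config_of t)" if "t \<in> points" for t
  proof (rule near_converges)
    show "near 4 (r / real (Suc m)) (Z t m) (config_of t)" for m
      using y[of m] that by (simp add: Zy solutions_in_def)
    show "(\<lambda>m. r / real (Suc m)) \<longlonglongrightarrow> 0" using tendsto_mult_right_zero[OF inverse_Suc_tendsto, of r] by simp
  qed
  have lim: "(\<lambda>m. (face (Z t m) i j k - face (config_of t) i j k) / complex_of_real (\<tau> m)) \<longlonglongrightarrow> of_real (test_direction i j k)"
    if "t \<in> points" "i < j" "j < k" "k \<le> 4" for t i j k
  proof -
    have "(face (Z t m) i j k - face (config_of t) i j k) / complex_of_real (\<tau> m) = of_real (test_direction i j k)" for m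
      using y[of m] that \<tau>[of m] by (simp add: Zy solutions_in_def face_point)
    then show ?thesis by simp
  qed
  define W where "W t m i j = (Z t m i j - config_of t i j) / complex_of_real (\<tau> m)" for t m i j
  have symW: "symmetric (W t m)" for t m
    using symmetricD[OF symZ[of t m]] symmetricD[OF symmetric_config_of[of t]] unfolding symmetric_def W_def by metis
  have "\<exists>q w. strict_mono (q :: nat \<Rightarrow> nat) \<and> (\<forall>t\<in>points. symmetric (w t) \<and> converges 4 (\<lambda>m. W t (q m)) (w t))"
  proof (rule convergent_subsequences[OF card_points(1) symW])
    fix t i j assume t: "t \<in> points" and ij: "(i, j) \<in> edges 4"
    have "\<exists>B. \<forall>m. edge_norm 4 (\<lambda>i j. (Z t m i j - config_of t i j) / complex_of_real (\<tau> m)) \<le> B"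
      by (rule first_order_bounded[OF nondegenerate_point[OF t] symmetric_config_of symZ conv[OF t] \<tau> lim[OF t]])
    then obtain B where B: "\<forall>m. edge_norm 4 (W t m) \<le> B" unfolding W_def[abs_def] ..
    have "cmod (W t m i j) \<le> B" for m
      using edge_norm_ge[OF ij, of "W t m"] B[rule_format, of m] by (rule order_trans)
    then show "\<exists>B. \<forall>m. cmod (W t m i j) \<le> B" by blast
  qed
  then obtain q w where q: "strict_mono (q :: nat \<Rightarrow> nat)"
    and w: "\<And>t. t \<in> points \<Longrightarrow> symmetric (w t)" "\<And>t. t \<in> points \<Longrightarrow> converges 4 (\<lambda>m. W t (q m)) (w t)"
    by auto
  have slope: "w t 0 1 = slope t" if t: "t \<in> points" for t
  proof (rule slope_point[OF t w(1)[OF t]])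
    fix i j k :: nat assume ijk: "i < j" "j < k" "k \<le> 4"
    show "2 * polar (config_of t) (w t) i j k = of_real (test_direction i j k)"
    proof (rule first_order_limit[OF symmetric_config_of converges_subseq[OF conv[OF t] q] _ _ ijk, where \<tau> = "\<lambda>m. \<tau> (q m)" and \<sigma> = "\<lambda>i j k. of_real (test_direction i j k)"])
      show "converges 4 (\<lambda>m i j. (Z t (q m) i j - config_of t i j) / complex_of_real (\<tau> (q m))) (w t)"
        using w(2)[OF t] by (simp add: W_def[abs_def])
    qed (use LIMSEQ_subseq_LIMSEQ[OF lim[OF t] q] in \<open>simp add: o_def\<close>)
  qed
  have e01: "(0, 1) \<in> edges 4" by (simp add: edges_def)
  have "\<forall>\<^sub>F m in sequentially. \<forall>(t, t')\<in>{(t, t') \<in> points \<times> points. t \<noteq> t'}. Z t (q m) 0 1 \<noteq> Z t' (q m) 0 1"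
  proof (rule eventually_ball_finite)
    show "finite {(t, t') \<in> points \<times> points. t \<noteq> t'}"
      by (rule finite_subset[of _ "points \<times> points"]) (use card_points(1) in auto)
    show "\<forall>p\<in>{(t, t') \<in> points \<times> points. t \<noteq> t'}. \<forall>\<^sub>F m in sequentially. case p of (t, t') \<Rightarrow> Z t (q m) 0 1 \<noteq> Z t' (q m) 0 1"
    proof (rule ballI)
      fix p assume "p \<in> {(t, t') \<in> points \<times> points. t \<noteq> t'}"
      then obtain t t' where p: "p = (t, t')" and t: "t \<in> points" "t' \<in> points" "t \<noteq> t'" by blast
      have lim0: "(\<lambda>m. Z t (q m) 0 1 - Z t' (q m) 0 1) \<longlonglongrightarrow> config_of t 0 1 - config_of t' 0 1"
        by (intro tendsto_diff convergesD[OF converges_subseq[OF conv[OF t(1)] q]]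
            convergesD[OF converges_subseq[OF conv[OF t(2)] q]]) auto
      have lim1: "(\<lambda>m. W t (q m) 0 1 - W t' (q m) 0 1) \<longlonglongrightarrow> slope t - slope t'"
        unfolding slope[OF t(1), symmetric] slope[OF t(2), symmetric]
        by (intro tendsto_diff convergesD[OF w(2)[OF t(1)]] convergesD[OF w(2)[OF t(2)]]) auto
      have "\<forall>\<^sub>F m in sequentially. Z t (q m) 0 1 \<noteq> Z t' (q m) 0 1"
      proof (cases "config_of t 0 1 = config_of t' 0 1")
        case False
        then have "\<forall>\<^sub>F m in sequentially. Z t (q m) 0 1 - Z t' (q m) 0 1 \<noteq> 0"
          by (intro tendsto_imp_eventually_ne[OF lim0]) simp
        then show ?thesis by eventually_elim simp
      next
        case True
        then have "slope t \<noteq> slope t'" using points_distinct t unfolding inj_on_def by blast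
        then have "\<forall>\<^sub>F m in sequentially. W t (q m) 0 1 - W t' (q m) 0 1 \<noteq> 0"
          by (intro tendsto_imp_eventually_ne[OF lim1]) simp
        then show ?thesis by eventually_elim (auto simp: W_def True simp del: One_nat_def)
      qed
      then show "\<forall>\<^sub>F m in sequentially. case p of (t, t') \<Rightarrow> Z t (q m) 0 1 \<noteq> Z t' (q m) 0 1"
        unfolding p prod.case .
    qed
  qed
  then obtain m where H: "\<forall>(t, t')\<in>{(t, t') \<in> points \<times> points. t \<noteq> t'}. Z t (q m) 0 1 \<noteq> Z t' (q m) 0 1"
    by (auto simp: eventually_sequentially)
  have "inj_on (\<lambda>t. y (q m) t 0 1) points"
  proof (rule inj_onI, rule ccontr)
    fix t t' assume t: "t \<in> points" "t' \<in> points" "y (q m) t 0 1 = y (q m) t' 0 1" "t \<noteq> t'"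
    then have "(t, t') \<in> {(t, t') \<in> points \<times> points. t \<noteq> t'}" by blast
    from bspec[OF H this] have "Z t (q m) 0 1 \<noteq> Z t' (q m) 0 1" by simp
    then show False using t(3) Zy[OF t(1)] Zy[OF t(2)] by simp
  qed
  moreover have "r / real (Suc (q m)) \<le> r" using r by (auto simp: field_simps)
  then have "solutions_in r (\<lambda>i j k. 3 + of_real (\<tau> (q m) * test_direction i j k)) config_of (y (q m))"
    using y[of "q m"] near_mono unfolding solutions_in_def by blast
  ultimately show ?thesis by blast
qed

text \<open>
  The separated solutions remain separated for all faces near those just found. Any one of them may serve as
  centre \<open>c\<close>, since all have the same faces.
\<close>

lemma at_least_64_edge01:
  "\<exists>c \<epsilon>. symmetric c \<and> \<epsilon> > 0 \<and> (\<forall>s. symmetric s \<longrightarrow> near 4 \<epsilon> s c \<longrightarrow>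
    (\<exists>y. (\<forall>t\<in>points. symmetric (y t) \<and> same_areas 4 s (y t)) \<and> inj_on (\<lambda>t. y t 0 1) points))"
proof -
  obtain R where R: "\<And>t. t \<in> points \<Longrightarrow> R t > 0" "\<And>t y y'. t \<in> points \<Longrightarrow> symmetric y \<Longrightarrow> symmetric y' \<Longrightarrow>
      near 4 (R t) y (config_of t) \<Longrightarrow> near 4 (R t) y' (config_of t) \<Longrightarrow> same_areas 4 y y' \<Longrightarrow> \<forall>(i, j)\<in>edges 4. y i j = y' i j"
  proof -
    have "\<forall>t\<in>points. \<exists>r>0. \<forall>y y'. symmetric y \<longrightarrow> symmetric y' \<longrightarrow> near 4 r y (config_of t) \<longrightarrow>
      near 4 r y' (config_of t) \<longrightarrow> same_areas 4 y y' \<longrightarrow> (\<forall>(i, j)\<in>edges 4. y i j = y' i j)"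
      by (rule ballI, rule injectivity_radius, rule nondegenerate_point)
    from bchoice[OF this] obtain R where R: "\<forall>t\<in>points. R t > 0 \<and> (\<forall>y y'. symmetric y \<longrightarrow> symmetric y' \<longrightarrow>
      near 4 (R t) y (config_of t) \<longrightarrow> near 4 (R t) y' (config_of t) \<longrightarrow> same_areas 4 y y' \<longrightarrow> (\<forall>(i, j)\<in>edges 4. y i j = y' i j))" ..
    show thesis by (rule that[of R]) (use R in simp_all)
  qed
  obtain r0 where r0: "r0 > 0" "\<forall>t\<in>points. r0 \<le> R t" using finite_min_pos[of points R, OF card_points(1) R(1)] by blast
  have inj: "\<forall>(i, j)\<in>edges 4. y i j = y' i j"
    if t: "t \<in> points" "symmetric y" "symmetric y'" "near 4 r0 y (config_of t)" "near 4 r0 y' (config_of t)" "same_areas 4 y y'" for t y y'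
    by (rule R(2)[OF t(1-3) near_mono[OF t(4)] near_mono[OF t(5)] t(6)]) (use r0(2) t(1) in auto)
  have half: "r0 / 2 > 0" "r0 / 2 \<le> r0" using r0(1) by auto
  have "\<exists>S z. solutions_in (r0 / 2) S config_of z \<and> inj_on (\<lambda>t. z t 0 1) points"
    by (rule separated_solutions[OF half(1)], rule inj) (auto intro: near_mono[OF _ half(2)])
  then obtain S z where z: "solutions_in (r0 / 2) S config_of z" and zinj: "inj_on (\<lambda>t. z t 0 1) points"
    by blast
  have symz: "symmetric (z t)" "near 4 (r0 / 2) (z t) (config_of t)" if "t \<in> points" for t
    using z that by (auto simp: solutions_in_def)
  have facez: "face (z t) i j k = S i j k" if "t \<in> points" "i < j" "j < k" "k \<le> 4" for t i j k
    using z that by (auto simp: solutions_in_def)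
  define P where "P = {(t, t') \<in> points \<times> points. t \<noteq> t'}"
  have "finite P" unfolding P_def by (rule finite_subset[of _ "points \<times> points"]) (use card_points(1) in auto)
  moreover have "(case p of (t, t') \<Rightarrow> cmod (z t 0 1 - z t' 0 1)) > 0" if pP: "p \<in> P" for p
  proof -
    obtain t t' where p: "p = (t, t')" "t \<in> points" "t' \<in> points" "t \<noteq> t'" using pP unfolding P_def by blast
    then have "z t 0 1 \<noteq> z t' 0 1" using inj_onD[OF zinj] by blast
    then show ?thesis unfolding p(1) prod.case by simp
  qed
  ultimately obtain g where g: "g > 0" "\<forall>p\<in>P. g \<le> (case p of (t, t') \<Rightarrow> cmod (z t 0 1 - z t' 0 1))"
    using finite_min_pos[of P "\<lambda>p. case p of (t, t') \<Rightarrow> cmod (z t 0 1 - z t' 0 1)"] by auto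
  define \<rho> where "\<rho> = min (r0 / 2) (g / 2)"
  have \<rho>: "\<rho> > 0" "\<rho> \<le> r0 / 2" "\<rho> \<le> g / 2" using r0(1) g(1) by (auto simp: \<rho>_def)
  have inj\<rho>: "\<forall>(i, j)\<in>edges 4. y i j = y' i j"
    if t: "t \<in> points" and yy: "symmetric y" "symmetric y'" "near 4 \<rho> y (z t)" "near 4 \<rho> y' (z t)" "same_areas 4 y y'" for t y y'
  proof (rule inj[OF t yy(1,2) _ _ yy(5)])
    have "\<rho> + r0 / 2 \<le> r0" using \<rho>(2) by simp
    then show "near 4 r0 y (config_of t)" "near 4 r0 y' (config_of t)"
      by (rule near_mono[OF near_trans[OF yy(3) symz(2)[OF t]]], rule near_mono[OF near_trans[OF yy(4) symz(2)[OF t]]])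
  qed
  obtain \<delta> where \<delta>: "\<delta> > 0" "\<And>S'. (\<forall>i j k. i < j \<longrightarrow> j < k \<longrightarrow> k \<le> 4 \<longrightarrow> cmod (S' i j k - S i j k) < \<delta>) \<Longrightarrow> \<exists>y. solutions_in \<rho> S' z y"
  proof -
    have "\<exists>\<delta>>0. \<forall>S'. (\<forall>i j k. i < j \<longrightarrow> j < k \<longrightarrow> k \<le> 4 \<longrightarrow> cmod (S' i j k - S i j k) < \<delta>) \<longrightarrow> (\<exists>y. solutions_in \<rho> S' z y)"
      by (rule solvable_at_all_points[OF \<rho>(1) inj\<rho> symz(1) facez])
    then show thesis using that by blast
  qed
  obtain t0 where t0: "t0 \<in> points" using card_points(2) by (metis all_not_in_conv card.empty zero_neq_numeral)
  obtain \<epsilon> where \<epsilon>: "\<epsilon> > 0" "\<And>s i j k. near 4 \<epsilon> s (z t0) \<Longrightarrow> i < j \<Longrightarrow> j < k \<Longrightarrow> k \<le> 4 \<Longrightarrow> cmod (face s i j k - face (z t0) i j k) < \<delta>"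
    using faces_continuous[OF \<delta>(1), of 4 "z t0"] by blast
  have "\<exists>y. (\<forall>t\<in>points. symmetric (y t) \<and> same_areas 4 s (y t)) \<and> inj_on (\<lambda>t. y t 0 1) points"
    if s: "symmetric s" "near 4 \<epsilon> s (z t0)" for s
  proof -
    have "\<exists>y. solutions_in \<rho> (face s) z y"
      using \<epsilon>(2)[OF s(2)] facez[OF t0] by (intro \<delta>(2)) auto
    then obtain y where y: "solutions_in \<rho> (face s) z y" ..
    have "inj_on (\<lambda>t. y t 0 1) points"
    proof (rule inj_onI, rule ccontr)
      fix t t' assume t: "t \<in> points" "t' \<in> points" "y t 0 1 = y t' 0 1" "t \<noteq> t'"
      have "cmod (y t 0 1 - z t 0 1) < \<rho>" "cmod (y t' 0 1 - z t' 0 1) < \<rho>"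
        using y t(1,2) nearD[of 4 \<rho> "y t" "z t" 0 1] nearD[of 4 \<rho> "y t'" "z t'" 0 1]
        unfolding solutions_in_def by (simp_all add: edges_def)
      moreover have "z t 0 1 - z t' 0 1 = (y t' 0 1 - z t' 0 1) - (y t 0 1 - z t 0 1)" using t(3) by simp
      then have "cmod (z t 0 1 - z t' 0 1) \<le> cmod (y t' 0 1 - z t' 0 1) + cmod (y t 0 1 - z t 0 1)"
        by (metis norm_triangle_ineq4)
      moreover have "(t, t') \<in> P" unfolding P_def using t by blast
      then have "g \<le> cmod (z t 0 1 - z t' 0 1)" using bspec[OF g(2), of "(t, t')"] by simp
      ultimately show False using \<rho>(3) by linarith
    qed
    moreover have "symmetric (y t) \<and> same_areas 4 s (y t)" if "t \<in> points" for t
      using y that by (auto simp: solutions_in_def intro!: same_areasI)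
    ultimately show ?thesis by blast
  qed
  then show ?thesis using \<epsilon>(1) symz(1)[OF t0] by blast
qed

section \<open>Six points\<close>

text \<open>
  The configuration induced on the points \<open>g 0, g 1, \<dots>\<close>.
\<close>

definition pull :: "(nat \<Rightarrow> nat) \<Rightarrow> (nat \<Rightarrow> nat \<Rightarrow> 'a) \<Rightarrow> nat \<Rightarrow> nat \<Rightarrow> 'a" where
  "pull g x i j = x (g i) (g j)"

definition embeds :: "nat \<Rightarrow> nat \<Rightarrow> (nat \<Rightarrow> nat) \<Rightarrow> bool" where
  "embeds m n g \<longleftrightarrow> inj_on g {..m} \<and> g ` {..m} \<subseteq> {..n}"

lemma embeds_edges: "embeds m n g \<Longrightarrow> (i, j) \<in> edges m \<Longrightarrow> (g i, g j) \<in> edges n"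
  unfolding embeds_def edges_def inj_on_def by blast

lemma symmetric_pull: "symmetric x \<Longrightarrow> symmetric (pull g x)"
  by (simp add: symmetric_def pull_def)

lemma near_pull: "embeds m n g \<Longrightarrow> near n \<epsilon> x y \<Longrightarrow> near m \<epsilon> (pull g x) (pull g y)"
  using embeds_edges unfolding near_def pull_def by blast

lemma converges_pull: "embeds m n g \<Longrightarrow> converges n Z z \<Longrightarrow> converges m (\<lambda>k. pull g (Z k)) (pull g z)"
  using embeds_edges unfolding converges_def pull_def by blast

lemma face_pull: "face (pull g x) i j k = face x (g i) (g j) (g k)"
  by (simp add: face_def pull_def)

lemma embeds_triple:
  assumes "embeds m n g" "i < j" "j < k" "k \<le> m"
  shows "g i \<noteq> g j" "g j \<noteq> g k" "g i \<noteq> g k" "g i \<le> n" "g j \<le> n" "g k \<le> n"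
proof -
  have e: "(i, j) \<in> edges m" "(j, k) \<in> edges m" "(i, k) \<in> edges m" using assms(2-) by (auto simp: edges_def)
  show "g i \<noteq> g j" "g j \<noteq> g k" "g i \<noteq> g k" "g i \<le> n" "g j \<le> n" "g k \<le> n"
    using e[THEN embeds_edges[OF assms(1)]] by (simp_all add: edges_def)
qed

lemma same_areas_pull:
  assumes "embeds m n g" "symmetric x" "symmetric y" "same_areas n x y"
  shows "same_areas m (pull g x) (pull g y)"
  by (rule same_areasI, unfold face_pull, rule same_areas_face[OF assms(2-4)])
    (use embeds_triple[OF assms(1)] in auto)

lemma faces_tend_pull:
  assumes "embeds m n g" "\<And>k. symmetric (Z k)" "faces_tend n Z"
  shows "faces_tend m (\<lambda>k. pull g (Z k))"
  unfolding faces_tend_def face_pull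
proof (intro allI impI)
  fix i j k assume "i < j" "j < k" "k \<le> m"
  from embeds_triple[OF assms(1) this] show "(\<lambda>l. face (Z l) (g i) (g j) (g k)) \<longlonglongrightarrow> 3"
    by (rule faces_tend_face[OF assms(2,3)])
qed

text \<open>
  A relabelling of the five points carries the edge \<open>ab\<close> to 01.
\<close>

lemma at_least_64:
  assumes ab: "a \<noteq> b" "a \<le> 4" "b \<le> 4"
  shows "\<exists>c \<epsilon>. symmetric c \<and> \<epsilon> > 0 \<and> (\<forall>s. symmetric s \<longrightarrow> near 4 \<epsilon> s c \<longrightarrow>
    (\<exists>y. (\<forall>t\<in>points. symmetric (y t) \<and> same_areas 4 s (y t)) \<and> inj_on (\<lambda>t. y t a b) points))"
proof -
  obtain c \<epsilon> where c: "symmetric c" "\<epsilon> > 0" and sol: "\<And>s. symmetric s \<Longrightarrow> near 4 \<epsilon> s c \<Longrightarrow>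
    (\<exists>y. (\<forall>t\<in>points. symmetric (y t) \<and> same_areas 4 s (y t)) \<and> inj_on (\<lambda>t. y t 0 1) points)"
    using at_least_64_edge01 by blast
  define g where "g = Transposition.transpose a 0"
  define h where "h = Transposition.transpose (g b) 1"
  have gb: "g b \<noteq> 0" "g b \<le> 4" using ab by (auto simp: g_def Transposition.transpose_def)
  have \<pi>: "h (g a) = 0" "h (g b) = 1" using gb by (auto simp: g_def h_def Transposition.transpose_def)
  have inv: "g (g i) = i" "h (h i) = i" for i by (simp_all add: g_def h_def)
  have le: "g i \<le> 4" "h i \<le> 4" if "i \<le> 4" for i
    using that ab gb(2) by (auto simp: g_def h_def Transposition.transpose_def)
  have emb: "embeds 4 4 (h \<circ> g)" "embeds 4 4 (g \<circ> h)"
    unfolding embeds_def using le inv by (auto intro!: inj_onI) (metis inv)+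
  have pp: "pull (h \<circ> g) (pull (g \<circ> h) x) = x" "pull (g \<circ> h) (pull (h \<circ> g) x) = x" for x :: "nat \<Rightarrow> nat \<Rightarrow> complex"
    by (intro ext, simp add: pull_def inv)+
  have "\<exists>y. (\<forall>t\<in>points. symmetric (y t) \<and> same_areas 4 s (y t)) \<and> inj_on (\<lambda>t. y t a b) points"
    if s: "symmetric s" "near 4 \<epsilon> s (pull (h \<circ> g) c)" for s
  proof -
    have "near 4 \<epsilon> (pull (g \<circ> h) s) c" using near_pull[OF emb(2) s(2)] by (simp add: pp)
    from sol[OF symmetric_pull[OF s(1)] this] obtain y where
      y: "\<And>t. t \<in> points \<Longrightarrow> symmetric (y t)" "\<And>t. t \<in> points \<Longrightarrow> same_areas 4 (pull (g \<circ> h) s) (y t)"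
      and inj: "inj_on (\<lambda>t. y t 0 1) points" by blast
    have same: "same_areas 4 s (pull (h \<circ> g) (y t))" if "t \<in> points" for t
      using same_areas_pull[OF emb(1) symmetric_pull[OF s(1)] y(1)[OF that] y(2)[OF that]] by (simp add: pp)
    have "(\<lambda>t. pull (h \<circ> g) (y t) a b) = (\<lambda>t. y t 0 1)" by (simp add: pull_def \<pi>)
    then have "inj_on (\<lambda>t. pull (h \<circ> g) (y t) a b) points" using inj by (simp only:)
    moreover have "\<forall>t\<in>points. symmetric (pull (h \<circ> g) (y t)) \<and> same_areas 4 s (pull (h \<circ> g) (y t))"
      by (intro ballI conjI symmetric_pull y(1) same)
    ultimately show ?thesis by (intro exI[of _ "\<lambda>t. pull (h \<circ> g) (y t)"] conjI)
  qed
  then show ?thesis using c symmetric_pull by blast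
qed

text \<open>
  Enumerates the points other than \<open>v\<close>.
\<close>

definition omit :: "nat \<Rightarrow> nat \<Rightarrow> nat" where
  "omit v i = (if i < v then i else Suc i)"

lemma embeds_omit: "v \<le> 5 \<Longrightarrow> embeds 4 5 (omit v)"
  by (auto simp: embeds_def omit_def inj_on_def split: if_splits)

lemma omit_mono: "i < j \<Longrightarrow> omit v i < omit v j"
  by (simp add: omit_def)

lemma omit_surj:
  assumes "i \<noteq> v" "i \<le> 5" "v \<le> 5"
  shows "\<exists>i'\<le>4. omit v i' = i"
proof (cases "i < v")
  case True
  then show ?thesis using assms by (intro exI[of _ i]) (auto simp: omit_def)
next
  case False
  then show ?thesis using assms by (intro exI[of _ "i - 1"]) (auto simp: omit_def)
qed

lemma omit_edge:
  assumes "(i, j) \<in> edges 5" "i \<noteq> v" "j \<noteq> v" "v \<le> 5"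
  shows "\<exists>i' j'. (i', j') \<in> edges 4 \<and> omit v i' = i \<and> omit v j' = j"
proof -
  obtain i' where i': "i' \<le> 4" "omit v i' = i" using omit_surj[of i v] assms by (auto simp: edges_def)
  obtain j' where j': "j' \<le> 4" "omit v j' = j" using omit_surj[of j v] assms by (auto simp: edges_def)
  have "i' \<noteq> j'" using i' j' assms(1) by (auto simp: edges_def)
  then show ?thesis using i' j' by (intro exI[of _ i'] exI[of _ j']) (simp add: edges_def)
qed

lemma avoid_four: "\<exists>v\<le>5. v \<notin> {a, b, c, d :: nat}"
proof -
  have "card ({..5} - {a, b, c, d}) \<ge> card {..5::nat} - card {a, b, c, d}" by (rule diff_card_le_card_Diff) simp
  moreover have "card {a, b, c, d} \<le> 4" by (simp add: card_insert_if)
  ultimately have "card ({..5} - {a, b, c, d}) > 0" by simp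
  then have "{..5} - {a, b, c, d} \<noteq> {}" by (metis card.empty less_irrefl)
  then show ?thesis by auto
qed

lemma edge_avoiding:
  assumes "v \<le> 5" "v' \<le> 5"
  shows "\<exists>i j. (i, j) \<in> edges 5 \<and> i \<notin> {v, v'} \<and> j \<notin> {v, v'}"
proof -
  obtain i where i: "i \<le> 5" "i \<notin> {v, v', v, v}" using avoid_four by blast
  obtain j where "j \<le> 5" "j \<notin> {v, v', i, i}" using avoid_four by blast
  with i show ?thesis by (intro exI[of _ i] exI[of _ j]) (auto simp: edges_def)
qed

text \<open>
  The Ramsey number \<open>R(3, 3) = 6\<close>, with the twenty triangles listed in lexicographic order.
\<close>

lemma no_two_colouring_of_K6:
  fixes b01 :: bool
  assumes "\<not> (b01 = b12 \<and> b12 = b02)"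
    "\<not> (b01 = b13 \<and> b13 = b03)"
    "\<not> (b01 = b14 \<and> b14 = b04)"
    "\<not> (b01 = b15 \<and> b15 = b05)"
    "\<not> (b02 = b23 \<and> b23 = b03)"
    "\<not> (b02 = b24 \<and> b24 = b04)"
    "\<not> (b02 = b25 \<and> b25 = b05)"
    "\<not> (b03 = b34 \<and> b34 = b04)"
    "\<not> (b03 = b35 \<and> b35 = b05)"
    "\<not> (b04 = b45 \<and> b45 = b05)"
    "\<not> (b12 = b23 \<and> b23 = b13)"
    "\<not> (b12 = b24 \<and> b24 = b14)"
    "\<not> (b12 = b25 \<and> b25 = b15)"
    "\<not> (b13 = b34 \<and> b34 = b14)"
    "\<not> (b13 = b35 \<and> b35 = b15)"
    "\<not> (b14 = b45 \<and> b45 = b15)"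
    "\<not> (b23 = b34 \<and> b34 = b24)"
    "\<not> (b23 = b35 \<and> b35 = b25)"
    "\<not> (b24 = b45 \<and> b45 = b25)"
    "\<not> (b34 = b45 \<and> b45 = b35)"
  shows False
  using assms by (smt (z3))


lemma six_points_bounded:
  assumes sym: "\<And>m. symmetric (Z m)" and faces: "faces_tend 5 Z" and ij: "(i, j) \<in> edges 5"
  shows "\<exists>B. \<forall>m. cmod (Z m i j) \<le> B"
proof -
  obtain v where v: "v \<le> 5" "v \<notin> {i, j, i, i}" using avoid_four by blast
  then obtain i' j' where ij': "(i', j') \<in> edges 4" "omit v i' = i" "omit v j' = j"
    using omit_edge[OF ij _ _ v(1)] by blast
  obtain B where "\<And>m. edge_norm 4 (pull (omit v) (Z m)) \<le> B"
    using faces_tend_bounded[OF symmetric_pull[OF sym] faces_tend_pull[OF embeds_omit[OF v(1)] sym faces]] by blast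
  then have "cmod (pull (omit v) (Z m) i' j') \<le> B" for m
    using edge_norm_ge[OF ij'(1)] order_trans by blast
  then show ?thesis using ij' by (auto simp: pull_def)
qed

lemma six_points_limit:
  assumes sym: "\<And>m. symmetric (Z m)" and faces: "faces_tend 5 Z" and q: "symmetric q" "converges 5 Z q" and v: "v \<le> 5"
  shows "\<exists>t\<in>points. \<forall>(i, j)\<in>edges 4. pull (omit v) q i j = config_of t i j"
proof (rule limit_is_point[OF symmetric_pull[OF q(1)]])
  note L = faces_tend_limit[OF symmetric_pull[OF sym] faces_tend_pull[OF embeds_omit[OF v] sym faces]
      converges_pull[OF embeds_omit[OF v] q(2)]]
  show "tets 4 (pull (omit v) q)" by (rule L(1))
  show "face (pull (omit v) q) i j k = 3" if "i < j" "j < k" "k \<le> 4" for i j k by (rule L(2)[OF that])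
qed

lemma polar_cong:
  assumes "\<forall>(i, j)\<in>edges n. z i j = z' i j" "i < j" "j < k" "k \<le> n"
  shows "polar z w i j k = polar z' w i j k"
  using assms by (auto simp: polar_def edges_def)

lemma six_points_nondegenerate:
  assumes "\<And>v. v \<le> 5 \<Longrightarrow> \<exists>t\<in>points. \<forall>(i, j)\<in>edges 4. pull (omit v) q i j = config_of t i j"
  shows "nondegenerate 5 q"
  unfolding nondegenerate_def
proof (intro allI impI, safe)
  fix w :: "nat \<Rightarrow> nat \<Rightarrow> complex" and i j
  assume w: "symmetric w" and 0: "\<forall>i j k. i < j \<longrightarrow> j < k \<longrightarrow> k \<le> 5 \<longrightarrow> polar q w i j k = 0" and ij: "(i, j) \<in> edges 5"
  obtain v where v: "v \<le> 5" "v \<notin> {i, j, i, i}" using avoid_four by blast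
  then obtain i' j' where ij': "(i', j') \<in> edges 4" "omit v i' = i" "omit v j' = j"
    using omit_edge[OF ij _ _ v(1)] by blast
  obtain t where t: "t \<in> points" "\<forall>(i, j)\<in>edges 4. pull (omit v) q i j = config_of t i j"
    using assms[OF v(1)] by blast
  have "polar (config_of t) (pull (omit v) w) i j k = 0" if ijk: "i < j" "j < k" "k \<le> 4" for i j k
  proof -
    have "omit v k \<le> 5" using ijk(3) by (simp add: omit_def)
    then have "polar q w (omit v i) (omit v j) (omit v k) = 0" using 0 omit_mono ijk by blast
    moreover have "polar (pull (omit v) q) (pull (omit v) w) i j k = polar q w (omit v i) (omit v j) (omit v k)"
      by (simp add: polar_def pull_def)
    ultimately show ?thesis using polar_cong[OF t(2) ijk, of "pull (omit v) w"] by simp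
  qed
  then have "pull (omit v) w i' j' = 0"
    using nondegenerate_point[OF t(1)] symmetric_pull[OF w] ij'(1) unfolding nondegenerate_def by blast
  then show "w i j = 0" using ij' by (simp add: pull_def)
qed

text \<open>
  The dichotomy that survives on six points, where no individual limit point has to be known.
\<close>

lemma point_entries:
  assumes "t \<in> points"
  shows "(\<exists>b\<in>{1, - 1}. \<forall>(i, j)\<in>edges 4. config_of t i j = b \<or> config_of t i j = 3 * b) \<or>
    (\<forall>(i, j)\<in>edges 4. (config_of t i j) ^ 2 = - 3 / 5)"
proof -
  obtain \<kappa> p h where t: "t = (\<kappa>, p, h)" by (cases t)
  have c: "conf p 0 1 = p!0" "conf p 0 2 = p!1" "conf p 0 3 = p!2" "conf p 0 4 = p!3" "conf p 1 2 = p!4"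
    "conf p 1 3 = p!5" "conf p 1 4 = p!6" "conf p 2 3 = p!7" "conf p 2 4 = p!8" "conf p 3 4 = p!9"
    by (subst symmetricD[OF symmetric_conf], rule conf_simps)+
  have entries: "\<forall>(i, j)\<in>edges 4. P (conf p i j)" if ent: "\<forall>k\<in>{0,1,2,3,4,5,6,7,8,9}. P (p ! k)" for P
  proof (rule all_edges_4[of "\<lambda>i j. P (conf p i j)", THEN iffD2])
    show "P (conf p j i)" if "P (conf p i j)" for i j
      using that by (subst symmetricD[OF symmetric_conf])
    show "P (conf p 0 1) \<and> P (conf p 0 2) \<and> P (conf p 0 3) \<and> P (conf p 0 4) \<and> P (conf p 1 2) \<and>
      P (conf p 1 3) \<and> P (conf p 1 4) \<and> P (conf p 2 3) \<and> P (conf p 2 4) \<and> P (conf p 3 4)"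
      using ent by (simp add: c del: One_nat_def)
  qed
  from points_cases[OF assms[unfolded t]] show ?thesis
  proof cases
    case 1
    then have "\<kappa> \<in> {1, - 1}" by (simp add: power2_eq_1_iff)
    moreover have "\<forall>(i, j)\<in>edges 4. conf p i j \<in> {1, 3}"
      using entries[of "\<lambda>x. x \<in> {1, 3}"] matching_table_entries(1)[OF 1(2)] by blast
    ultimately show ?thesis by (intro disjI1 bexI[of _ \<kappa>]) (auto simp: t)
  next
    case 2
    have "\<forall>(i, j)\<in>edges 4. conf p i j \<in> {1, - 1}"
      using entries[of "\<lambda>x. x \<in> {1, - 1}"] pentagon_table_entries(1)[OF 2(2)] by blast
    then show ?thesis using 2(1) by (intro disjI2) (auto simp: t power_mult_distrib)
  qed
qed

section \<open>Limits on six points\<close>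

text \<open>
  Any two of the six sets of five points share an edge, on which the square of the entry tells the two types of
  limit points apart, so all six are of the same type. Entries \<open>\<plusminus>\<omega>\<close> everywhere
  would colour the edges on six points without monochromatic triangle.
\<close>

lemma six_points_values:
  assumes q: "symmetric q" and faces: "\<And>i j k. i < j \<Longrightarrow> j < k \<Longrightarrow> k \<le> 5 \<Longrightarrow> face q i j k = 3"
    and pts: "\<And>v. v \<le> 5 \<Longrightarrow> \<exists>t\<in>points. \<forall>(i, j)\<in>edges 4. pull (omit v) q i j = config_of t i j"
  shows "\<exists>b\<in>{1, - 1}. \<forall>(i, j)\<in>edges 5. q i j = b \<or> q i j = 3 * b"
proof -
  have types: "(\<exists>b\<in>{1, - 1}. \<forall>i j. (i, j) \<in> edges 5 \<longrightarrow> i \<noteq> v \<longrightarrow> j \<noteq> v \<longrightarrow> q i j = b \<or> q i j = 3 * b) \<or>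
    (\<forall>i j. (i, j) \<in> edges 5 \<longrightarrow> i \<noteq> v \<longrightarrow> j \<noteq> v \<longrightarrow> (q i j) ^ 2 = - 3 / 5)" if v: "v \<le> 5" for v
  proof -
    obtain t where t: "t \<in> points" and eq4: "\<forall>(i, j)\<in>edges 4. pull (omit v) q i j = config_of t i j"
      using pts[OF v] by blast
    have eq: "q (omit v i) (omit v j) = config_of t i j" if "(i, j) \<in> edges 4" for i j
      using bspec[OF eq4 that] by (simp add: pull_def)
    have transfer: "P (q i j)" if tr: "\<forall>(i, j)\<in>edges 4. P (config_of t i j)" "(i, j) \<in> edges 5" "i \<noteq> v" "j \<noteq> v" for P i j
    proof -
      obtain i' j' where "(i', j') \<in> edges 4" "omit v i' = i" "omit v j' = j" using omit_edge[OF tr(2-4) v] by blast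
      then show ?thesis using tr(1) eq[of i' j'] by fastforce
    qed
    from point_entries[OF t] show ?thesis
    proof
      assume "\<exists>b\<in>{1, - 1}. \<forall>(i, j)\<in>edges 4. config_of t i j = b \<or> config_of t i j = 3 * b"
      then obtain b where b: "b \<in> {1, - 1}" "\<forall>(i, j)\<in>edges 4. config_of t i j = b \<or> config_of t i j = 3 * b" ..
      show ?thesis
        by (rule disjI1, rule bexI[OF _ b(1)]) (use transfer[of "\<lambda>x. x = b \<or> x = 3 * b", OF b(2)] in blast)
    next
      assume b: "\<forall>(i, j)\<in>edges 4. (config_of t i j) ^ 2 = - 3 / 5"
      show ?thesis
        by (rule disjI2) (use transfer[of "\<lambda>x. x ^ 2 = - 3 / 5", OF b] in blast)
    qed
  qed
  have excl: "\<not> (x ^ 2 = - 3 / 5)" if "x = b \<or> x = 3 * b" "b \<in> {1, - 1}" for x b :: complex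
  proof
    assume "x ^ 2 = - 3 / 5"
    then have "Re (x ^ 2) = - 3 / 5" by simp
    then show False using that by (auto simp: power2_eq_square)
  qed
  show ?thesis
  proof (cases "\<exists>v\<le>5. \<forall>i j. (i, j) \<in> edges 5 \<longrightarrow> i \<noteq> v \<longrightarrow> j \<noteq> v \<longrightarrow> (q i j) ^ 2 = - 3 / 5")
    case True
    then obtain v where v: "v \<le> 5" "\<And>i j. (i, j) \<in> edges 5 \<Longrightarrow> i \<noteq> v \<Longrightarrow> j \<noteq> v \<Longrightarrow> (q i j) ^ 2 = - 3 / 5" by blast
    have all: "(q i j) ^ 2 = - 3 / 5" if ij: "(i, j) \<in> edges 5" for i j
    proof -
      obtain v' where v': "v' \<le> 5" "v' \<notin> {i, j, i, i}" using avoid_four by blast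
      obtain k l where kl: "(k, l) \<in> edges 5" "k \<notin> {v, v'}" "l \<notin> {v, v'}" using edge_avoiding[OF v(1) v'(1)] by blast
      then have "(q k l) ^ 2 = - 3 / 5" using v(2) by blast
      then have "\<forall>i j. (i, j) \<in> edges 5 \<longrightarrow> i \<noteq> v' \<longrightarrow> j \<noteq> v' \<longrightarrow> (q i j) ^ 2 = - 3 / 5"
        using types[OF v'(1)] excl kl by blast
      then show ?thesis using ij v'(2) by blast
    qed
    define c where "c = q 0 1"
    have c2: "c ^ 2 = - 3 / 5" using all[of 0 1] by (simp add: c_def edges_def)
    define B where "B i j \<longleftrightarrow> q i j = c" for i j
    have B: "q i j = (if B i j then c else - c)" if "(i, j) \<in> edges 5" for i j
    proof -
      have "(q i j) ^ 2 = c ^ 2" using all[OF that] c2 by simp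
      then show ?thesis by (auto simp: B_def power2_eq_iff)
    qed
    have "\<not> (B i j = B j k \<and> B j k = B i k)" if "i < j" "j < k" "k \<le> 5" for i j k
    proof
      assume "B i j = B j k \<and> B j k = B i k"
      then have "q j k = q i j" "q k i = q i j"
        using B[of i j] B[of j k] B[of i k] symmetricD[OF q, of k i] that by (auto simp: edges_def)
      then have "face q i j k = 3 * (q i j) ^ 2" by (simp add: face_def heron_def power2_eq_square)
      also have "\<dots> = - 9 / 5" using all[of i j] that by (simp add: edges_def)
      finally have "Re (face q i j k) = Re (- 9 / 5)" by (rule arg_cong)
      then show False using faces[OF that] by simp
    qed
    note nm = this
    have False
      by (rule no_two_colouring_of_K6[OF nm[of 0 1 2] nm[of 0 1 3] nm[of 0 1 4] nm[of 0 1 5] nm[of 0 2 3] nm[of 0 2 4] nm[of 0 2 5] nm[of 0 3 4] nm[of 0 3 5] nm[of 0 4 5]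
            nm[of 1 2 3] nm[of 1 2 4] nm[of 1 2 5] nm[of 1 3 4] nm[of 1 3 5] nm[of 1 4 5] nm[of 2 3 4] nm[of 2 3 5] nm[of 2 4 5] nm[of 3 4 5]]) simp_all
    then show ?thesis ..
  next
    case False
    then have "\<forall>v\<in>{..5}. \<exists>b. b \<in> {1, - 1} \<and> (\<forall>i j. (i, j) \<in> edges 5 \<longrightarrow> i \<noteq> v \<longrightarrow> j \<noteq> v \<longrightarrow> q i j = b \<or> q i j = 3 * b)"
      using types by blast
    from bchoice[OF this] obtain b where b: "\<And>v. v \<le> 5 \<Longrightarrow> b v \<in> {1, - 1}"
      "\<And>v i j. v \<le> 5 \<Longrightarrow> (i, j) \<in> edges 5 \<Longrightarrow> i \<noteq> v \<Longrightarrow> j \<noteq> v \<Longrightarrow> q i j = b v \<or> q i j = 3 * b v" by auto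
    have same: "b v = b 0" if v: "v \<le> 5" for v
    proof -
      obtain k l where kl: "(k, l) \<in> edges 5" "k \<notin> {v, 0}" "l \<notin> {v, 0}" using edge_avoiding[OF v, of 0] by blast
      then have "q k l = b v \<or> q k l = 3 * b v" "q k l = b 0 \<or> q k l = 3 * b 0" using b(2)[OF v] b(2)[of 0] by auto
      then show ?thesis using b(1)[OF v] b(1)[of 0] by (auto simp: complex_eq_iff)
    qed
    have "q i j = b 0 \<or> q i j = 3 * b 0" if ij: "(i, j) \<in> edges 5" for i j
    proof -
      obtain v where "v \<le> 5" "v \<notin> {i, j, i, i}" using avoid_four by blast
      then show ?thesis using b(2)[of v, OF _ ij] same[of v] by auto
    qed
    then show ?thesis using b(1)[of 0] by blast
  qed
qed

text \<open>
  Let \<open>p\<close> have the entry 3 on \<open>ab\<close>. Put \<open>U = w\<^sub>a\<^sub>c +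
  w\<^sub>b\<^sub>c - w\<^sub>a\<^sub>d - w\<^sub>b\<^sub>d\<close> and \<open>V = w\<^sub>c\<^sub>e +
  w\<^sub>c\<^sub>f - w\<^sub>d\<^sub>e - w\<^sub>d\<^sub>f\<close>. The faces through \<open>ab\<close>
  determine \<open>3U\<close>, and the faces with one vertex in each of \<open>ab\<close>, \<open>cd\<close>,
  \<open>ef\<close> determine \<open>U + V\<close>. The faces through \<open>ef\<close> determine
  \<open>V\<close> or \<open>3V\<close>, according to the entry on that edge. Comparison yields one of the two
  equations.
\<close>

lemma first_order_obstruction:
  fixes p w :: "nat \<Rightarrow> nat \<Rightarrow> complex" and x :: "nat \<Rightarrow> complex"
  assumes w: "symmetric w" and p: "symmetric p"
    and eq: "\<And>i j k. i \<noteq> j \<Longrightarrow> j \<noteq> k \<Longrightarrow> i \<noteq> k \<Longrightarrow> i \<le> 5 \<Longrightarrow> j \<le> 5 \<Longrightarrow> k \<le> 5 \<Longrightarrow>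
      polar p w i j k = x i * x j + x j * x k + x k * x i"
    and dist: "distinct [a, b, c, d, e, f]" "a \<le> 5" "b \<le> 5" "c \<le> 5" "d \<le> 5" "e \<le> 5" "f \<le> 5"
    and ab: "p a b = 3"
    and one: "p a c = 1" "p a d = 1" "p a e = 1" "p a f = 1" "p b c = 1" "p b d = 1" "p b e = 1" "p b f = 1"
      "p c e = 1" "p c f = 1" "p d e = 1" "p d f = 1"
    and ef: "p e f = 1 \<or> p e f = 3"
  shows "(x a + x b) * (x c - x d) = 0 \<or> (x a + x b + x e + x f) * (x c - x d) = 0"
proof -
  have sp: "p i j = p j i" and sw: "w i j = w j i" for i j
    using symmetricD[OF p, of i j] symmetricD[OF w, of i j] .
  note flip = sp[of c a] sp[of d a] sp[of e a] sp[of f a] sp[of c b] sp[of d b] sp[of e b] sp[of f b]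
    sp[of e c] sp[of f c] sp[of e d] sp[of f d] sw[of c a] sw[of d a] sw[of e a] sw[of f a] sw[of c b] sw[of d b]
    sw[of e b] sw[of f b] sw[of e c] sw[of f c] sw[of e d] sw[of f d]
  note P = eq[unfolded polar_def]
  have 1: "3 * (w a c + w b c) - w a b = x a * x b + x b * x c + x c * x a"
    "3 * (w a d + w b d) - w a b = x a * x b + x b * x d + x d * x a"
    using P[of a b c] P[of a b d] dist by (simp_all add: flip ab one algebra_simps)
  have 2: "w a c + w c e + w a e = x a * x c + x c * x e + x e * x a" "w a d + w d e + w a e = x a * x d + x d * x e + x e * x a"
    "w a c + w c f + w a f = x a * x c + x c * x f + x f * x a" "w a d + w d f + w a f = x a * x d + x d * x f + x f * x a"
    "w b c + w c e + w b e = x b * x c + x c * x e + x e * x b" "w b d + w d e + w b e = x b * x d + x d * x e + x e * x b"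
    "w b c + w c f + w b f = x b * x c + x c * x f + x f * x b" "w b d + w d f + w b f = x b * x d + x d * x f + x f * x b"
    using P[of a c e] P[of a d e] P[of a c f] P[of a d f] P[of b c e] P[of b d e] P[of b c f] P[of b d f] dist
    by (simp_all add: flip one algebra_simps)
  define U where "U = w a c + w b c - w a d - w b d"
  define V where "V = w c e + w c f - w d e - w d f"
  have U: "3 * U = (x a + x b) * (x c - x d)"
    using arg_cong2[OF 1, of "(-)"] by (simp add: U_def algebra_simps)
  have UV: "2 * (U + V) = 2 * ((x a + x b + x e + x f) * (x c - x d))"
  proof -
    have "2 * (U + V) = (w a c + w c e + w a e) - (w a d + w d e + w a e) + ((w a c + w c f + w a f) - (w a d + w d f + w a f)) +
      ((w b c + w c e + w b e) - (w b d + w d e + w b e)) + ((w b c + w c f + w b f) - (w b d + w d f + w b f))"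
      by (simp add: U_def V_def algebra_simps)
    also have "\<dots> = 2 * ((x a + x b + x e + x f) * (x c - x d))"
      unfolding 2 by (simp add: algebra_simps)
    finally show ?thesis .
  qed
  have sum: "U + V = (x a + x b + x e + x f) * (x c - x d)"
    by (rule iffD1[OF mult_left_cancel UV]) simp
  from ef show ?thesis
  proof
    assume "p e f = 1"
    then have "w c e + w e f + w c f = x c * x e + x e * x f + x f * x c" "w d e + w e f + w d f = x d * x e + x e * x f + x f * x d"
      using P[of c e f] P[of d e f] dist by (simp_all add: flip one algebra_simps)
    from arg_cong2[OF this, of "(-)"] have "V = (x e + x f) * (x c - x d)" by (simp add: V_def algebra_simps)
    then have "U = (x a + x b + x e + x f) * (x c - x d) - (x e + x f) * (x c - x d)"
      using sum by (metis add_diff_cancel_right')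
    also have "\<dots> = (x a + x b) * (x c - x d)" by (simp add: algebra_simps)
    finally have "U = (x a + x b) * (x c - x d)" .
    then show ?thesis using U by auto
  next
    assume "p e f = 3"
    then have "3 * (w c e + w c f) - w e f = x c * x e + x e * x f + x f * x c" "3 * (w d e + w d f) - w e f = x d * x e + x e * x f + x f * x d"
      using P[of c e f] P[of d e f] dist by (simp_all add: flip one algebra_simps)
    from arg_cong2[OF this, of "(-)"] have "3 * V = (x e + x f) * (x c - x d)" by (simp add: V_def algebra_simps)
    then have "3 * (U + V) = (x a + x b + x e + x f) * (x c - x d)" using U by (simp add: algebra_simps)
    then have "2 * ((x a + x b + x e + x f) * (x c - x d)) = 0" unfolding sum by (simp add: algebra_simps)
    then show ?thesis by (simp only: mult_eq_0_iff) simp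
  qed
qed

text \<open>
  The edges with entry 3 form a matching. The four remaining points can be divided into two pairs such that no
  edge between the pairs belongs to it.
\<close>

lemma matching_partner:
  fixes p :: "nat \<Rightarrow> nat \<Rightarrow> complex"
  assumes p: "symmetric p" "\<And>i j. (i, j) \<in> edges 5 \<Longrightarrow> p i j = 1 \<or> p i j = 3"
    and faces: "\<And>i j k. i \<noteq> j \<Longrightarrow> j \<noteq> k \<Longrightarrow> i \<noteq> k \<Longrightarrow> i \<le> 5 \<Longrightarrow> j \<le> 5 \<Longrightarrow> k \<le> 5 \<Longrightarrow> face p i j k = 3"
    and ab: "(a, b) \<in> edges 5" "p a b = 3"
  shows "\<exists>c d e f. distinct [a, b, c, d, e, f] \<and> {c, d, e, f} \<subseteq> {..5} \<and>
    p c e = 1 \<and> p c f = 1 \<and> p d e = 1 \<and> p d f = 1 \<and>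
    (\<forall>u\<in>{c, d, e, f}. p a u = 1 \<and> p b u = 1)"
proof -
  have adj: "p i k = 1 \<and> p j k = 1" if "i \<noteq> j" "j \<noteq> k" "i \<noteq> k" "i \<le> 5" "j \<le> 5" "k \<le> 5" "p i j = 3" for i j k
  proof -
    have h: "heron 3 (p j k) (p i k) = 3" using faces[OF that(1-6)] that(7) symmetricD[OF p(1), of k i] by (simp add: face_def)
    have "p j k = 1 \<or> p j k = 3" "p i k = 1 \<or> p i k = 3"
      by (rule p(2), use that in \<open>simp add: edges_def\<close>)+
    then consider "p j k = 1" "p i k = 1" | "p j k = 3" "p i k = 1" | "p j k = 1" "p i k = 3" | "p j k = 3" "p i k = 3" by blast
    then show ?thesis by cases (use h in \<open>simp_all add: heron_def\<close>)
  qed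
  have "card ({..5} - {a, b}) = 4" using ab(1) by (subst card_Diff_subset) (auto simp: edges_def)
  moreover obtain us where us: "set us = {..5} - {a, b}" "distinct us"
    using finite_distinct_list[of "{..5} - {a, b}"] by auto
  ultimately have "length us = Suc (Suc (Suc (Suc 0)))" using distinct_card[OF us(2)] by simp
  then obtain r s t u where "us = [r, s, t, u]"
    unfolding length_Suc_conv length_0_conv by blast
  then have d: "distinct [a, b, r, s, t, u]" "r \<le> 5" "s \<le> 5" "t \<le> 5" "u \<le> 5" "a \<le> 5" "b \<le> 5"
    using us ab(1) by (auto simp: edges_def)
  have abu: "p a v = 1 \<and> p b v = 1" if "v \<in> {r, s, t, u}" for v
    by (rule adj[OF _ _ _ _ _ _ ab(2)]) (use that d in auto)
  have sp: "p i j = p j i" for i j by (rule symmetricD[OF p(1)])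
  have opposite: "p i k = 1 \<and> p i l = 1 \<and> p j k = 1 \<and> p j l = 1"
    if "p i j = 3 \<or> p k l = 3" and ne: "i \<noteq> j" "i \<noteq> k" "i \<noteq> l" "j \<noteq> k" "j \<noteq> l" "k \<noteq> l"
      and le: "i \<le> 5" "j \<le> 5" "k \<le> 5" "l \<le> 5" for i j k l
    using that(1)
  proof
    assume "p i j = 3"
    with adj[of i j k] adj[of i j l] ne le show ?thesis by simp
  next
    assume "p k l = 3"
    with adj[of k l i] adj[of k l j] ne[symmetric] le show ?thesis
      by (simp add: sp[of i k] sp[of i l] sp[of j k] sp[of j l])
  qed
  consider "p r s = 3 \<or> p t u = 3" | "p r t = 3 \<or> p s u = 3" | "p r s = 1" "p t u = 1" "p r t = 1" "p s u = 1"
    using p(2)[of r s] p(2)[of t u] p(2)[of r t] p(2)[of s u] d by (auto simp: edges_def)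
  moreover have ne: "r \<noteq> s" "r \<noteq> t" "r \<noteq> u" "s \<noteq> t" "s \<noteq> u" "t \<noteq> u" using d(1) by auto
  have split: ?thesis
    if set: "{c, d, e, f} = {r, s, t, u}" and dist: "distinct [a, b, c, d, e, f]"
      and across: "p c e = 1" "p c f = 1" "p d e = 1" "p d f = 1" for c d e f
  proof -
    have "{c, d, e, f} \<subseteq> {..5}" unfolding set using d(2-5) by simp
    moreover have "\<forall>u\<in>{c, d, e, f}. p a u = 1 \<and> p b u = 1" unfolding set using abu by (rule ballI)
    ultimately show ?thesis
      by (intro exI[of _ c] exI[of _ d] exI[of _ e] exI[of _ f] conjI dist across)
  qed
  ultimately show ?thesis
  proof cases
    case 1
    have "p r t = 1 \<and> p r u = 1 \<and> p s t = 1 \<and> p s u = 1" by (rule opposite) (use d(2-5) ne 1 in simp_all)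
    then show ?thesis using d(1) by (intro split[of r s t u]) simp_all
  next
    case 2
    have "p r s = 1 \<and> p r u = 1 \<and> p t s = 1 \<and> p t u = 1" by (rule opposite) (use d(2-5) ne 2 in simp_all)
    moreover have "{r, t, s, u} = {r, s, t, u}" "distinct [a, b, r, t, s, u]" using d(1) by auto
    ultimately show ?thesis by (intro split[of r t s u]) simp_all
  next
    case 3
    moreover have "{r, u, s, t} = {r, s, t, u}" "distinct [a, b, r, u, s, t]" using d(1) by auto
    ultimately show ?thesis by (intro split[of r u s t]) (simp_all add: sp[of u s] sp[of u t])
  qed
qed

section \<open>Uniqueness up to sign on six points\<close>

text \<open>
  The right-hand side of the first order system for this direction is \<open>x i * x j + x j * x k + x k * x
  i\<close> with distinct positive \<open>x i\<close>, which violates both equations of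
  \<open>first_order_obstruction\<close>.
\<close>

definition direction :: "nat \<Rightarrow> nat \<Rightarrow> complex" where
  "direction i j = of_nat (Suc i) * of_nat (Suc j)"

lemma polar_perm:
  assumes "symmetric z" "symmetric w"
  shows "polar z w j i k = polar z w i j k" "polar z w i k j = polar z w i j k"
proof -
  have e: "z j i = z i j" "z k j = z j k" "z i k = z k i" "w j i = w i j" "w k j = w j k" "w i k = w k i"
    using symmetricD[OF assms(1)] symmetricD[OF assms(2)] by blast+
  show "polar z w j i k = polar z w i j k" "polar z w i k j = polar z w i j k"
    unfolding polar_def e by (simp_all add: algebra_simps)
qed

text \<open>
  The difference quotients of \<open>y\<close> at \<open>p\<close> have a limit \<open>w\<close>, a solution of
  the linear system at \<open>p\<close> with the right-hand side that \<open>direction\<close> produces at the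
  regular simplex.
\<close>

lemma six_points_first_order:
  fixes \<tau> :: "nat \<Rightarrow> real"
  assumes sym: "\<And>m. symmetric (y m)" "symmetric p" and \<tau>: "\<And>m. \<tau> m > 0"
    and s: "converges 5 s (\<lambda>_ _. 1)" "converges 5 (\<lambda>m i j. (s m i j - 1) / complex_of_real (\<tau> m)) direction"
    and y: "converges 5 y p" "\<And>m. same_areas 5 (s m) (y m)"
    and nd: "nondegenerate 5 p"
    and faces: "\<And>i j k. i < j \<Longrightarrow> j < k \<Longrightarrow> k \<le> 5 \<Longrightarrow> face p i j k = 3"
    and vals: "\<And>i j. (i, j) \<in> edges 5 \<Longrightarrow> p i j = 1 \<or> p i j = 3"
    and ab: "(a, b) \<in> edges 5"
  shows "p a b = 1"
proof (rule ccontr)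
  assume "p a b \<noteq> 1"
  then have ab3: "p a b = 3" using vals[OF ab] by simp
  define \<sigma> where "\<sigma> i j k = 2 * (direction i j + direction j k + direction k i)" for i j k
  have lim: "(\<lambda>m. (face (y m) i j k - face p i j k) / complex_of_real (\<tau> m)) \<longlonglongrightarrow> \<sigma> i j k"
    if ijk: "i < j" "j < k" "k \<le> 5" for i j k
  proof -
    have "converges 5 (\<lambda>m i j. s m i j + 1) (\<lambda>i j. 1 + 1)" by (rule converges_add[OF s(1) converges_const])
    from polar_tendsto[OF this s(2) ijk]
    have "(\<lambda>m. polar (\<lambda>i j. s m i j + 1) (\<lambda>i j. (s m i j - 1) / complex_of_real (\<tau> m)) i j k) \<longlonglongrightarrow> \<sigma> i j k"
      by (simp add: polar_def \<sigma>_def algebra_simps)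
    moreover have "polar (\<lambda>i j. s m i j + 1) (\<lambda>i j. (s m i j - 1) / complex_of_real (\<tau> m)) i j k =
      (face (y m) i j k - face p i j k) / complex_of_real (\<tau> m)" for m
    proof -
      have "face (y m) i j k = face (s m) i j k" using y(2)[of m] ijk by (simp add: same_areas_def face_def)
      moreover have "face p i j k = face (\<lambda>_ _. 1) i j k" using faces[OF ijk] by (simp add: face_def heron_def)
      ultimately have "face (y m) i j k - face p i j k = face (s m) i j k - face (\<lambda>_ _. 1) i j k" by simp
      also have "\<dots> = polar (\<lambda>i j. s m i j + 1) (\<lambda>i j. s m i j - 1) i j k" by (rule face_diff)
      finally show ?thesis by (simp add: polar_def add_divide_distrib)
    qed
    ultimately show ?thesis by simp
  qed
  define D where "D m i j = (y m i j - p i j) / complex_of_real (\<tau> m)" for m i j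
  have symD: "symmetric (D m)" for m using sym(1)[of m] sym(2) by (simp add: D_def symmetric_def)
  obtain B where B: "\<And>m. edge_norm 5 (D m) \<le> B"
    using first_order_bounded[OF nd sym(2) sym(1) y(1) \<tau> lim] unfolding D_def by blast
  have "\<exists>B. \<forall>m. cmod (D m i j) \<le> B" if "(i, j) \<in> edges 5" for i j
    using order_trans[OF edge_norm_ge[OF that] B] by blast
  from convergent_subsequence[of D 5, OF symD this] obtain r w where
    r: "strict_mono (r :: nat \<Rightarrow> nat)" "symmetric w" "converges 5 (\<lambda>m. D (r m)) w" by blast
  have "2 * polar p w i j k = \<sigma> i j k" if ijk: "i < j" "j < k" "k \<le> 5" for i j k
  proof (rule first_order_limit[OF sym(2) converges_subseq[OF y(1) r(1)] _ _ ijk])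
    show "(\<lambda>m. (face (y (r m)) i j k - face p i j k) / complex_of_real (\<tau> (r m))) \<longlonglongrightarrow> \<sigma> i j k"
      if "i < j" "j < k" "k \<le> 5" for i j k
      using LIMSEQ_subseq_LIMSEQ[OF lim[OF that] r(1)] by (simp add: o_def)
    show "converges 5 (\<lambda>m i j. (y (r m) i j - p i j) / complex_of_real (\<tau> (r m))) w"
      using r(3) unfolding D_def .
  qed
  then have ord: "polar p w i j k = direction i j + direction j k + direction k i" if "i < j" "j < k" "k \<le> 5" for i j k
    using iffD1[OF mult_left_cancel, of 2 "polar p w i j k"] that unfolding \<sigma>_def by simp
  have all: "polar p w i j k = direction i j + direction j k + direction k i"
    if "i \<noteq> j" "j \<noteq> k" "i \<noteq> k" "i \<le> 5" "j \<le> 5" "k \<le> 5" for i j k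
    by (rule triple_wlog[where P = "\<lambda>i j k. polar p w i j k = direction i j + direction j k + direction k i", OF ord _ _ that])
      (simp_all add: polar_perm[OF sym(2) r(2)], simp_all add: direction_def algebra_simps)
  have faces3: "face p i j k = 3" if "i \<noteq> j" "j \<noteq> k" "i \<noteq> k" "i \<le> 5" "j \<le> 5" "k \<le> 5" for i j k
    by (rule triple_wlog[where P = "\<lambda>i j k. face p i j k = 3", OF faces _ _ that])
      (simp_all add: face_perm[OF sym(2)])
  define v where "v i = complex_of_nat (Suc i)" for i
  have v: "v i = v j \<longleftrightarrow> i = j" "v i + v j \<noteq> 0" "v i + v j + v k + v l \<noteq> 0" for i j k l
  proof -
    show "v i = v j \<longleftrightarrow> i = j" unfolding v_def of_nat_eq_iff by simp
    show "v i + v j \<noteq> 0" unfolding v_def of_nat_add[symmetric] of_nat_eq_0_iff by simp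
    show "v i + v j + v k + v l \<noteq> 0" unfolding v_def of_nat_add[symmetric] of_nat_eq_0_iff by simp
  qed
  obtain c d e f where m: "distinct [a, b, c, d, e, f]" "{c, d, e, f} \<subseteq> {..5}"
    "p c e = 1" "p c f = 1" "p d e = 1" "p d f = 1" "\<forall>u\<in>{c, d, e, f}. p a u = 1 \<and> p b u = 1"
    using matching_partner[OF sym(2) vals faces3 ab ab3] by blast
  have le: "a \<le> 5" "b \<le> 5" "c \<le> 5" "d \<le> 5" "e \<le> 5" "f \<le> 5" using ab m(2) by (auto simp: edges_def)
  have "(e, f) \<in> edges 5" using m(1) le by (simp add: edges_def)
  then have ef: "p e f = 1 \<or> p e f = 3" by (rule vals)
  have "(v a + v b) * (v c - v d) = 0 \<or> (v a + v b + v e + v f) * (v c - v d) = 0"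
  proof (rule first_order_obstruction[OF r(2) sym(2) _ m(1) le ab3 _ _ _ _ _ _ _ _ m(3-6) ef])
    show "polar p w i j k = v i * v j + v j * v k + v k * v i"
      if "i \<noteq> j" "j \<noteq> k" "i \<noteq> k" "i \<le> 5" "j \<le> 5" "k \<le> 5" for i j k
      using all[OF that] unfolding direction_def v_def .
  qed (use m(7) in auto)
  then show False using v m(1) by auto
qed

text \<open>
  The centre \<open>c\<close> is close to the regular simplex in the direction \<open>direction\<close>. If all
  such centres failed, a second solution would converge, up to sign, to a limit \<open>p\<close> with entries 1
  and 3, which is the regular simplex by \<open>six_points_first_order\<close>. There the face map is locally
  injective.
\<close>

lemma six_points_unique:
  "\<exists>c \<epsilon>. symmetric c \<and> \<epsilon> > 0 \<and> (\<forall>s y. symmetric s \<longrightarrow> near 5 \<epsilon> s c \<longrightarrow> symmetric y \<longrightarrow> same_areas 5 s y \<longrightarrow>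
    (\<forall>(i, j)\<in>edges 5. y i j = s i j) \<or> (\<forall>(i, j)\<in>edges 5. y i j = - s i j))"
proof (rule ccontr)
  assume none: "\<not> ?thesis"
  define \<tau> where "\<tau> m = 1 / real (Suc m)" for m
  define c where "c m i j = 1 + complex_of_real (\<tau> m) * direction i j" for m i j
  \<comment> \<open>The radius \<open>\<tau>\<^sup>2\<close> is of smaller order than \<open>\<tau>\<close>, so the difference quotients of \<open>s\<close> at the regular simplex tend to \<open>direction\<close>.\<close>
  define bad where "bad m s y \<longleftrightarrow> symmetric s \<and> near 5 (\<tau> m ^ 2) s (c m) \<and> symmetric y \<and> same_areas 5 s y \<and>
    \<not> ((\<forall>(i, j)\<in>edges 5. y i j = s i j) \<or> (\<forall>(i, j)\<in>edges 5. y i j = - s i j))" for m s y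
  have \<tau>: "\<tau> m > 0" for m by (simp add: \<tau>_def)
  have \<tau>0: "\<tau> \<longlonglongrightarrow> 0" unfolding \<tau>_def by (rule inverse_Suc_tendsto)
  have "\<exists>sy. bad m (fst sy) (snd sy)" for m
  proof (rule ccontr)
    assume *: "\<not> ?thesis"
    have nb: "\<not> bad m s y" for s y
    proof
      assume "bad m s y"
      then have "bad m (fst (s, y)) (snd (s, y))" by simp
      with * show False by blast
    qed
    have all: "\<forall>s y. symmetric s \<longrightarrow> near 5 (\<tau> m ^ 2) s (c m) \<longrightarrow> symmetric y \<longrightarrow> same_areas 5 s y \<longrightarrow>
      (\<forall>(i, j)\<in>edges 5. y i j = s i j) \<or> (\<forall>(i, j)\<in>edges 5. y i j = - s i j)"
    proof (intro allI impI)
      fix s y assume "symmetric s" "near 5 (\<tau> m ^ 2) s (c m)" "symmetric y" "same_areas 5 s y"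
      with nb[of s y] show "(\<forall>(i, j)\<in>edges 5. y i j = s i j) \<or> (\<forall>(i, j)\<in>edges 5. y i j = - s i j)"
        unfolding bad_def by argo
    qed
    have "symmetric (c m)" by (simp add: symmetric_def c_def direction_def mult.commute)
    moreover have "\<tau> m ^ 2 > 0" by (rule zero_less_power[OF \<tau>])
    ultimately have "symmetric (c m) \<and> \<tau> m ^ 2 > 0 \<and> (\<forall>s y. symmetric s \<longrightarrow> near 5 (\<tau> m ^ 2) s (c m) \<longrightarrow>
      symmetric y \<longrightarrow> same_areas 5 s y \<longrightarrow>
      (\<forall>(i, j)\<in>edges 5. y i j = s i j) \<or> (\<forall>(i, j)\<in>edges 5. y i j = - s i j))"
      using all by (intro conjI)
    from none[THEN notE, OF exI, OF exI, OF this] show False .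
  qed
  then have "\<forall>m. \<exists>sy. bad m (fst sy) (snd sy)" by (rule allI)
  from choice[OF this] obtain sy where sy: "\<And>m. bad m (fst (sy m)) (snd (sy m))" by auto
  define s where "s m = fst (sy m)" for m
  define y where "y m = snd (sy m)" for m
  have s: "symmetric (s m)" "near 5 (\<tau> m ^ 2) (s m) (c m)" and y: "symmetric (y m)" "same_areas 5 (s m) (y m)"
    and diff: "\<not> (\<forall>(i, j)\<in>edges 5. y m i j = s m i j)" "\<not> (\<forall>(i, j)\<in>edges 5. y m i j = - s m i j)" for m
    using sy[of m] unfolding bad_def s_def[symmetric] y_def[symmetric] by argo+
  have slope: "converges 5 (\<lambda>m i j. (s m i j - 1) / complex_of_real (\<tau> m)) direction"
  proof (rule near_converges[OF _ \<tau>0])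
    fix m
    have "cmod ((s m i j - 1) / complex_of_real (\<tau> m) - direction i j) < \<tau> m" if ij: "(i, j) \<in> edges 5" for i j
    proof -
      have ne: "\<tau> m \<noteq> 0" by (simp add: \<tau>_def)
      have "(s m i j - 1) / complex_of_real (\<tau> m) - direction i j = (s m i j - c m i j) / complex_of_real (\<tau> m)"
        using ne by (simp add: c_def diff_divide_distrib add_divide_distrib)
      also have "cmod \<dots> = cmod (s m i j - c m i j) / \<tau> m" using \<tau>[of m] by (simp add: norm_divide)
      also have "\<dots> < \<tau> m ^ 2 / \<tau> m" using nearD[OF s(2) ij] \<tau>[of m] by (rule divide_strict_right_mono)
      also have "\<dots> = \<tau> m" using \<tau>[of m] by (simp add: power2_eq_square)
      finally show ?thesis .
    qed
    then show "near 5 (\<tau> m) (\<lambda>i j. (s m i j - 1) / complex_of_real (\<tau> m)) direction" by (auto simp: near_def)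
  qed
  have s1: "converges 5 s (\<lambda>_ _. 1)"
    unfolding converges_def
  proof clarify
    fix i j assume "(i, j) \<in> edges 5"
    then have "(\<lambda>m. (s m i j - 1) / complex_of_real (\<tau> m)) \<longlonglongrightarrow> direction i j"
      using convergesD[OF slope, of i j] by (simp add: edges_def)
    moreover have "(\<lambda>m. complex_of_real (\<tau> m)) \<longlonglongrightarrow> of_real 0" by (rule tendsto_of_real[OF \<tau>0])
    ultimately have "(\<lambda>m. 1 + complex_of_real (\<tau> m) * ((s m i j - 1) / complex_of_real (\<tau> m))) \<longlonglongrightarrow> 1 + of_real 0 * direction i j"
      by (intro tendsto_add tendsto_mult tendsto_const)
    moreover have "1 + complex_of_real (\<tau> m) * ((s m i j - 1) / complex_of_real (\<tau> m)) = s m i j" for m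
      using \<tau>[of m] by simp
    ultimately show "(\<lambda>m. s m i j) \<longlonglongrightarrow> 1" by simp
  qed
  have faces: "faces_tend 5 y" by (rule converging_faces_tend[OF s1 y(2)])
  obtain r q where r: "strict_mono (r :: nat \<Rightarrow> nat)" "symmetric q" "converges 5 (\<lambda>m. y (r m)) q"
    using convergent_subsequence[of y 5, OF y(1) six_points_bounded[OF y(1) faces]] by blast
  note faces' = faces_tend_subseq[OF faces r(1)]
  note face_q = faces_tend_limit(2)[OF y(1) faces' r(3)]
  obtain b where b: "b \<in> {1, - 1}" "\<forall>(i, j)\<in>edges 5. q i j = b \<or> q i j = 3 * b"
    using six_points_values[OF r(2) face_q six_points_limit[OF y(1) faces' r(2,3)]] by blast
  define Y where "Y m i j = b * y (r m) i j" for m i j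
  define p where "p i j = b * q i j" for i j
  have bb: "b ^ 2 = 1" "b * b = 1" using b(1) by auto
  have symY: "symmetric (Y m)" for m using y(1)[of "r m"] by (simp add: Y_def symmetric_def)
  have symp: "symmetric p" using r(2) by (simp add: p_def symmetric_def)
  have Yp: "converges 5 Y p"
    unfolding converges_def Y_def p_def using r(3) by (auto simp: converges_def intro!: tendsto_mult)
  have face_p: "face p i j k = 3" if "i < j" "j < k" "k \<le> 5" for i j k
    using face_scale[of b q i j k] face_q[OF that] bb(1) by (simp add: p_def[abs_def])
  have vals: "p i j = 1 \<or> p i j = 3" if "(i, j) \<in> edges 5" for i j
    using b(2) that bb(2) unfolding p_def by fastforce
  have sameY: "same_areas 5 (s (r m)) (Y m)" for m
  proof (rule same_areas_trans[OF y(2)[of "r m"]], rule same_areasI)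
    show "face (y (r m)) i j k = face (Y m) i j k" for i j k
      using face_scale[of b "y (r m)" i j k] bb(1) by (simp add: Y_def[abs_def])
  qed
  note s1' = converges_subseq[OF s1 r(1)]
  have nd: "nondegenerate 5 p"
    by (rule six_points_nondegenerate, rule six_points_limit[OF symY converging_faces_tend[OF s1' sameY] symp Yp])
  have one: "p i j = 1" if "(i, j) \<in> edges 5" for i j
    by (rule six_points_first_order[of Y p "\<lambda>m. \<tau> (r m)" "\<lambda>m. s (r m)", OF symY symp \<tau> s1' _ Yp sameY nd face_p vals that])
      (use converges_subseq[OF slope r(1)] in simp_all)
  have s1p: "converges 5 (\<lambda>m. s (r m)) p"
    using s1' one by (auto simp: converges_def)
  from nondegenerate_locally_injective[OF nd symY s(1) Yp s1p same_areas_sym[OF sameY]] obtain m where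
    m: "\<forall>(i, j)\<in>edges 5. Y m i j = s (r m) i j" by blast
  from b(1) consider "b = 1" | "b = - 1" by blast
  then show False
  proof cases
    case 1
    then have "\<forall>(i, j)\<in>edges 5. y (r m) i j = s (r m) i j" using m by (simp add: Y_def)
    then show False using diff(1) by contradiction
  next
    case 2
    have "y (r m) i j = - s (r m) i j" if "(i, j) \<in> edges 5" for i j
      using bspec[OF m that] 2 by (simp add: Y_def minus_equation_iff eq_commute)
    then have "\<forall>(i, j)\<in>edges 5. y (r m) i j = - s (r m) i j" by blast
    then show False using diff(2) by contradiction
  qed
qed

section \<open>The degrees\<close>

lemma generic_near:
  assumes "symmetric c" "\<epsilon> > 0"
  shows "\<exists>K \<psi>. closed_field K \<and> countable K \<and> hom_on K \<psi> \<and>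
    (\<forall>i j. i \<noteq> j \<longrightarrow> i \<le> n \<longrightarrow> j \<le> n \<longrightarrow> edge_len i j \<in> K) \<and> near n \<epsilon> (\<lambda>i j. \<psi> (edge_sq i j)) c"
proof -
  obtain K \<psi> where K: "closed_field K" "countable K" "hom_on K \<psi>"
    "\<forall>i j. i \<noteq> j \<longrightarrow> i \<le> n \<longrightarrow> j \<le> n \<longrightarrow> edge_len i j \<in> K \<and> cmod (\<psi> (edge_sq i j) - c i j) < \<epsilon>"
    using generic_config[OF assms, of n] by blast
  have "near n \<epsilon> (\<lambda>i j. \<psi> (edge_sq i j)) c" using K(4) by (auto simp: near_def edges_def)
  then show ?thesis using K by blast
qed

lemma symmetric_edge_sq: "symmetric (\<lambda>i j. \<psi> (edge_sq i j))"
  by (simp add: symmetric_def edge_sq_commute)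

text \<open>
  Changing all signs does not change the faces, so by \<open>same_areas_root\<close> an element of \<open>K2
  n\<close> would have to satisfy \<open>\<psi> e = - \<psi> e\<close>.
\<close>

lemma edge_sq_not_in_K2:
  assumes ab: "a \<noteq> b" "a \<le> n" "b \<le> n"
  shows "edge_sq a b \<notin> K2 n"
proof
  let ?e = "edge_sq a b"
  assume e: "?e \<in> K2 n"
  have "symmetric (\<lambda>_ _. 1 :: complex)" by (simp add: symmetric_def)
  then obtain K \<psi> where K: "closed_field K" "hom_on K \<psi>"
    "\<And>i j. i \<noteq> j \<Longrightarrow> i \<le> n \<Longrightarrow> j \<le> n \<Longrightarrow> edge_len i j \<in> K" and near: "near n (1 / 2) (\<lambda>i j. \<psi> (edge_sq i j)) (\<lambda>_ _. 1)"
    using generic_near[of "\<lambda>_ _. 1" "1 / 2" n] by auto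
  note RK = closed_fieldD(1)[OF K(1)]
  note c = closed_fieldD(1)[OF closed_field_K2]
  define p where "p = [:- ?e, 1:]"
  have p: "p \<in> polys_over (K2 n)"
    unfolding p_def by (intro polys_over_closed(3,4)[OF c] closed_ringD(1,4)[OF c] e)
  have "symmetric (\<lambda>i j. - \<psi> (edge_sq i j))"
    using symmetric_edge_sq[of \<psi>] by (simp add: symmetric_def)
  moreover have "same_areas n (\<lambda>i j. \<psi> (edge_sq i j)) (\<lambda>i j. - \<psi> (edge_sq i j))"
    by (simp add: same_areas_def heron_def)
  ultimately have "poly (map_poly \<psi> p) (- \<psi> ?e) = 0"
    using same_areas_root[OF K p _ ab, of "\<lambda>i j. - \<psi> (edge_sq i j)"] by (simp add: p_def)
  moreover have "?e \<in> K" using K2_subset[OF K(1,3)] e by blast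
  then have "map_poly \<psi> p = [:- \<psi> ?e, 1:]"
    by (simp add: p_def map_poly_pCons hom_onD[OF K(2) RK])
  ultimately have "\<psi> ?e = 0" by simp
  moreover have "cmod (\<psi> ?e - 1) < 1 / 2" using nearD[OF near, of a b] ab by (simp add: edges_def)
  ultimately show False by simp
qed

lemma root_in_field:
  assumes K: "closed_field K" and q: "q \<in> polys_over K" "q \<noteq> 0" "poly q x = 0" "Polynomial.degree q < 2"
  shows "x \<in> K"
proof -
  define u v where "u = coeff q 0" and "v = coeff q 1"
  have uv: "u \<in> K" "v \<in> K" using q(1) by (simp_all add: u_def v_def polys_over_coeff)
  have "q = [:u, v:]"
  proof (rule poly_eqI)
    fix i
    show "coeff q i = coeff [:u, v:] i"
      using q(4) coeff_eq_0[of q i] by (cases i; cases "i - 1") (auto simp: u_def v_def)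
  qed
  then have eq: "u + x * v = 0" "u \<noteq> 0 \<or> v \<noteq> 0" using q(2,3) by auto
  then have "v \<noteq> 0" by auto
  then have "x = - u / v" using eq(1) by (simp add: field_simps add_eq_0_iff)
  then show ?thesis using closed_fieldD(3)[OF K closed_ringD(4)[OF closed_fieldD(1)[OF K] uv(1)] uv(2)] by simp
qed

text \<open>
  Choose six points that contain the given ones. If the product were not in \<open>K2 n\<close>, some
  configuration with the same faces would give it another value, but on the six points that configuration agrees
  with the original one up to a common sign.
\<close>

lemma products_in_K2:
  assumes n: "5 \<le> n" and ij: "i \<noteq> j" "i \<le> n" "j \<le> n" and kl: "k \<noteq> l" "k \<le> n" "l \<le> n"
  shows "edge_sq i j * edge_sq k l \<in> K2 n"
proof (rule ccontr)
  let ?x = "edge_sq i j * edge_sq k l"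
  assume x: "?x \<notin> K2 n"
  have "card {i, j, k, l} \<le> 6" by (simp add: card_insert_if)
  then obtain A where A: "{i, j, k, l} \<subseteq> A" "A \<subseteq> {..n}" "card A = 6"
    using exists_subset_between[of "{i, j, k, l}" 6 "{..n}"] n ij kl by auto
  then have "finite A" "card {..5::nat} = card A" by (auto intro: finite_subset)
  then obtain g :: "nat \<Rightarrow> nat" where g: "bij_betw g {..5} A" using finite_same_card_bij[of "{..5::nat}" A] by auto
  have emb: "embeds 5 n g" using g A(2) by (auto simp: embeds_def bij_betw_def)
  define h where "h = inv_into {..5} g"
  have h: "h (g u) = u" if "u \<le> 5" for u
    using g that by (simp add: h_def bij_betw_def)
  have gh: "h u \<le> 5" "g (h u) = u" if "u \<in> A" for u
    using g that inv_into_into[of u g "{..5}"] f_inv_into_f[of u g "{..5}"] by (auto simp: h_def bij_betw_def)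
  obtain c \<epsilon> where c: "symmetric c" "\<epsilon> > 0" and uniq: "\<And>s y. symmetric s \<Longrightarrow> near 5 \<epsilon> s c \<Longrightarrow> symmetric y \<Longrightarrow>
    same_areas 5 s y \<Longrightarrow> (\<forall>(i, j)\<in>edges 5. y i j = s i j) \<or> (\<forall>(i, j)\<in>edges 5. y i j = - s i j)"
    using six_points_unique by blast
  obtain K \<psi> where K: "closed_field K" "countable K" "hom_on K \<psi>"
    "\<And>i j. i \<noteq> j \<Longrightarrow> i \<le> n \<Longrightarrow> j \<le> n \<Longrightarrow> edge_len i j \<in> K" and near: "near n \<epsilon> (\<lambda>i j. \<psi> (edge_sq i j)) (pull h c)"
    using generic_near[OF symmetric_pull[OF c(1)] c(2), of n h] by blast
  define s where "s i j = \<psi> (edge_sq i j)" for i j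
  have sym: "symmetric s" unfolding s_def by (rule symmetric_edge_sq)
  have "near 5 \<epsilon> (pull g s) c"
    using near_pull[OF emb near] by (auto simp: near_def pull_def edges_def h s_def)
  note uniq' = uniq[OF symmetric_pull[OF sym] this]
  have mult: "\<psi>' ?x = \<psi>' (edge_sq i j) * \<psi>' (edge_sq k l)"
    if K': "closed_field K'" "hom_on K' \<psi>'" "\<And>i j. i \<noteq> j \<Longrightarrow> i \<le> n \<Longrightarrow> j \<le> n \<Longrightarrow> edge_len i j \<in> K'" for K' \<psi>'
    using hom_onD(3)[OF K'(2) closed_fieldD(1)[OF K'(1)]] closed_ring_power[OF closed_fieldD(1)[OF K'(1)] K'(3)] ij kl
    unfolding edge_sq_def by blast
  have low: "2 \<le> Polynomial.degree q" if "q \<in> polys_over (K2 n)" "q \<noteq> 0" "poly q ?x = 0" for q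
    using root_in_field[OF closed_field_K2 that] x by (meson not_le)
  obtain \<rho>s where \<rho>s: "finite \<rho>s" "card \<rho>s = 2" and conj: "\<forall>\<rho>\<in>\<rho>s. \<exists>K' \<psi>'. closed_field K' \<and> hom_on K' \<psi>' \<and>
    (\<forall>i j. i \<noteq> j \<longrightarrow> i \<le> n \<longrightarrow> j \<le> n \<longrightarrow> edge_len i j \<in> K') \<and> \<psi>' ?x = \<rho> \<and>
    same_areas n (\<lambda>i j. \<psi> (edge_sq i j)) (\<lambda>i j. \<psi>' (edge_sq i j))"
    using conjugate_configs[OF K low] by blast
  have "\<not> \<rho>s \<subseteq> {\<psi> ?x}" using card_mono[of "{\<psi> ?x}" \<rho>s] \<rho>s by auto
  then obtain \<rho> where \<rho>: "\<rho> \<in> \<rho>s" "\<rho> \<noteq> \<psi> ?x" by blast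
  obtain K' \<psi>' where K': "closed_field K'" "hom_on K' \<psi>'" "\<And>i j. i \<noteq> j \<Longrightarrow> i \<le> n \<Longrightarrow> j \<le> n \<Longrightarrow> edge_len i j \<in> K'"
    "\<psi>' ?x = \<rho>" "same_areas n (\<lambda>i j. \<psi> (edge_sq i j)) (\<lambda>i j. \<psi>' (edge_sq i j))"
    using bspec[OF conj \<rho>(1)] by blast
  define y where "y i j = \<psi>' (edge_sq i j)" for i j
  have symy: "symmetric y" unfolding y_def by (rule symmetric_edge_sq)
  have "same_areas n s y" using K'(5) by (simp add: s_def[abs_def] y_def[abs_def])
  from uniq'[OF symmetric_pull[OF symy] same_areas_pull[OF emb sym symy this]]
  have "(\<forall>(i, j)\<in>edges 5. pull g y i j = pull g s i j) \<or> (\<forall>(i, j)\<in>edges 5. pull g y i j = - pull g s i j)" .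
  moreover have e: "(h i, h j) \<in> edges 5" "(h k, h l) \<in> edges 5" and g': "g (h i) = i" "g (h j) = j" "g (h k) = k" "g (h l) = l"
    using A(1) ij(1) kl(1) gh[of i] gh[of j] gh[of k] gh[of l] by (auto simp: edges_def)
  ultimately have "y i j * y k l = s i j * s k l"
  proof (elim disjE)
    assume "\<forall>(i, j)\<in>edges 5. pull g y i j = pull g s i j"
    from bspec[OF this e(1)] bspec[OF this e(2)] show ?thesis by (simp add: pull_def g')
  next
    assume "\<forall>(i, j)\<in>edges 5. pull g y i j = - pull g s i j"
    from bspec[OF this e(1)] bspec[OF this e(2)] show ?thesis by (simp add: pull_def g')
  qed
  then have "\<psi>' ?x = \<psi> ?x" using mult[OF K'(1-3)] mult[OF K(1,3,4)] by (simp add: y_def s_def)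
  then show False using \<rho>(2) K'(4) by simp
qed

text \<open>
  The polynomial has 64 different roots after specialisation.
\<close>

lemma degree_at_least_64:
  assumes ab: "a \<noteq> b" "a \<le> 4" "b \<le> 4"
    and q: "q \<in> polys_over (K2 4)" "q \<noteq> 0" "poly q (edge_sq a b) = 0"
  shows "64 \<le> Polynomial.degree q"
proof -
  obtain c \<epsilon> where c: "symmetric c" "\<epsilon> > 0" and sol: "\<forall>s. symmetric s \<longrightarrow> near 4 \<epsilon> s c \<longrightarrow>
    (\<exists>y. (\<forall>t\<in>points. symmetric (y t) \<and> same_areas 4 s (y t)) \<and> inj_on (\<lambda>t. y t a b) points)"
    using at_least_64[OF ab] by blast
  obtain K \<psi> where K: "closed_field K" "hom_on K \<psi>"
    "\<And>i j. i \<noteq> j \<Longrightarrow> i \<le> 4 \<Longrightarrow> j \<le> 4 \<Longrightarrow> edge_len i j \<in> K" and near: "near 4 \<epsilon> (\<lambda>i j. \<psi> (edge_sq i j)) c"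
    using generic_near[OF c, of 4] by blast
  obtain y where y: "\<forall>t\<in>points. symmetric (y t) \<and> same_areas 4 (\<lambda>i j. \<psi> (edge_sq i j)) (y t)" "inj_on (\<lambda>t. y t a b) points"
    using sol symmetric_edge_sq near by blast
  note RK = closed_fieldD(1)[OF K(1)]
  have "\<psi> (coeff q (Polynomial.degree q)) \<noteq> 0"
  proof
    assume 0: "\<psi> (coeff q (Polynomial.degree q)) = 0"
    have "coeff q (Polynomial.degree q) \<in> K" using K2_subset[OF K(1,3)] polys_over_coeff[OF q(1)] by blast
    from hom_on_nonzero[OF K(2,1) this 0] q(2) show False by simp
  qed
  then have "coeff (map_poly \<psi> q) (Polynomial.degree q) \<noteq> 0" by (simp add: coeff_map_poly hom_onD(4)[OF K(2) RK])
  then have nz: "map_poly \<psi> q \<noteq> 0" by (metis coeff_0)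
  have "poly (map_poly \<psi> q) (y t a b) = 0" if "t \<in> points" for t
    using same_areas_root[OF K q(1,3) ab] y(1) that by blast
  then have "(\<lambda>t. y t a b) ` points \<subseteq> {z. poly (map_poly \<psi> q) z = 0}" by blast
  then have "card ((\<lambda>t. y t a b) ` points) \<le> card {z. poly (map_poly \<psi> q) z = 0}"
    by (intro card_mono poly_roots_finite nz)
  also have "\<dots> \<le> Polynomial.degree (map_poly \<psi> q)" by (rule card_poly_roots_bound[OF nz])
  also have "\<dots> \<le> Polynomial.degree q" by (rule map_poly_degree_leq)
  finally show ?thesis using card_image[OF y(2)] card_points(2) by simp
qed

text \<open>
  Otherwise there would be 65 values of the entry on the edge \<open>ab\<close> in configurations with the same
  faces.
\<close>

lemma degree_at_most_64:
  assumes ab: "a \<noteq> b" "a \<le> 4" "b \<le> 4"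
  shows "\<exists>p\<in>polys_over (K2 4). p \<noteq> 0 \<and> poly p (edge_sq a b) = 0 \<and> Polynomial.degree p \<le> 64"
proof (rule ccontr)
  assume none: "\<not> ?thesis"
  have low: "65 \<le> Polynomial.degree q" if "q \<in> polys_over (K2 4)" "q \<noteq> 0" "poly q (edge_sq a b) = 0" for q
  proof (rule ccontr)
    assume "\<not> 65 \<le> Polynomial.degree q"
    then have "Polynomial.degree q \<le> 64" by simp
    then show False using none that by blast
  qed
  obtain \<epsilon> where \<epsilon>: "\<epsilon> > 0" and most: "\<And>s y. symmetric s \<Longrightarrow> near 4 \<epsilon> s (\<lambda>_ _. 1) \<Longrightarrow>
      (\<forall>t<65::nat. symmetric (y t) \<and> same_areas 4 s (y t)) \<Longrightarrow>
      (\<forall>t<65. \<forall>t'<65. t \<noteq> t' \<longrightarrow> (\<exists>(i, j)\<in>edges 4. y t i j \<noteq> y t' i j)) \<Longrightarrow> False"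
    using at_most_64 by blast
  have "symmetric (\<lambda>_ _. 1 :: complex)" by (simp add: symmetric_def)
  from generic_near[OF this \<epsilon>, of 4] obtain K \<psi> where K: "closed_field K" "countable K" "hom_on K \<psi>"
    "\<And>i j. i \<noteq> j \<Longrightarrow> i \<le> 4 \<Longrightarrow> j \<le> 4 \<Longrightarrow> edge_len i j \<in> K" and near: "near 4 \<epsilon> (\<lambda>i j. \<psi> (edge_sq i j)) (\<lambda>_ _. 1)"
    by blast
  let ?s = "\<lambda>i j. \<psi> (edge_sq i j)"
  obtain \<rho>s where \<rho>s: "finite \<rho>s" "card \<rho>s = 65" and conj: "\<forall>\<rho>\<in>\<rho>s. \<exists>K' \<psi>'. closed_field K' \<and> hom_on K' \<psi>' \<and>
    (\<forall>i j. i \<noteq> j \<longrightarrow> i \<le> 4 \<longrightarrow> j \<le> 4 \<longrightarrow> edge_len i j \<in> K') \<and> \<psi>' (edge_sq a b) = \<rho> \<and>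
    same_areas 4 ?s (\<lambda>i j. \<psi>' (edge_sq i j))"
    using conjugate_configs[OF K low] by blast
  have "\<forall>\<rho>\<in>\<rho>s. \<exists>y. symmetric y \<and> same_areas 4 ?s y \<and> y a b = \<rho>"
  proof
    fix \<rho> assume "\<rho> \<in> \<rho>s"
    from bspec[OF conj this] obtain \<psi>' where "\<psi>' (edge_sq a b) = \<rho>" "same_areas 4 ?s (\<lambda>i j. \<psi>' (edge_sq i j))" by blast
    then show "\<exists>y. symmetric y \<and> same_areas 4 ?s y \<and> y a b = \<rho>"
      by (intro exI[of _ "\<lambda>i j. \<psi>' (edge_sq i j)"] conjI symmetric_edge_sq)
  qed
  from bchoice[OF this] obtain y where y: "\<forall>\<rho>\<in>\<rho>s. symmetric (y \<rho>) \<and> same_areas 4 ?s (y \<rho>) \<and> y \<rho> a b = \<rho>" ..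
  obtain f where f: "bij_betw f {..<65::nat} \<rho>s"
    using finite_same_card_bij[of "{..<65::nat}" \<rho>s] \<rho>s by auto
  have f\<rho>: "f t \<in> \<rho>s" if "t < 65" for t using f that by (auto simp: bij_betw_def)
  show False
  proof (rule most[OF symmetric_edge_sq near, of "\<lambda>t. y (f t)"])
    show "\<forall>t<65. symmetric (y (f t)) \<and> same_areas 4 ?s (y (f t))" using y f\<rho> by blast
    show "\<forall>t<65. \<forall>t'<65. t \<noteq> t' \<longrightarrow> (\<exists>(i, j)\<in>edges 4. y (f t) i j \<noteq> y (f t') i j)"
    proof (intro allI impI)
      fix t t' :: nat assume t: "t < 65" "t' < 65" "t \<noteq> t'"
      have "f t \<noteq> f t'" using inj_onD[of f "{..<65}" t t'] f t by (auto simp: bij_betw_def)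
      moreover have "y (f t) a b = f t" "y (f t') a b = f t'" using y f\<rho> t by blast+
      ultimately have "y (f t) a b \<noteq> y (f t') a b" by simp
      moreover have "(a, b) \<in> edges 4" using ab by (simp add: edges_def)
      ultimately show "\<exists>(i, j)\<in>edges 4. y (f t) i j \<noteq> y (f t') i j" by (intro bexI[of _ "(a, b)"]) simp_all
    qed
  qed
qed

theorem theorem1p2:
  fixes n :: nat
  shows
    "(5 \<le> n \<longrightarrow>
        (\<forall>i j k l. i \<le> n \<and> j \<le> n \<and> k \<le> n \<and> l \<le> n \<and> i \<noteq> j \<and> k \<noteq> l
           \<longrightarrow> edge_sq i j * edge_sq k l \<in> K2 n) \<and>
        (\<forall>i j. i \<le> n \<and> j \<le> n \<and> i \<noteq> j \<longrightarrow> edge_sq i j \<notin> K2 n)) \<and>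
     (n = 4 \<longrightarrow>
        (\<forall>i j. i \<le> n \<and> j \<le> n \<and> i \<noteq> j \<longrightarrow>
           ring.algebraic (edge_field n) (K2 n) (edge_sq i j) \<and>
           Polynomials.degree (ring.Irr (edge_field n) (K2 n) (edge_sq i j)) = 64))"
proof (intro conjI impI allI; elim conjE)
  fix i j k l assume "5 \<le> n" "i \<le> n" "j \<le> n" "k \<le> n" "l \<le> n" "i \<noteq> j" "k \<noteq> l"
  then show "edge_sq i j * edge_sq k l \<in> K2 n" by (intro products_in_K2)
next
  fix i j assume "i \<le> n" "j \<le> n" "i \<noteq> j"
  then show "edge_sq i j \<notin> K2 n" by (intro edge_sq_not_in_K2)
next
  fix i j assume n: "n = 4" and "i \<le> n" "j \<le> n" "i \<noteq> j"
  then have ij: "i \<noteq> j" "i \<le> 4" "j \<le> 4" by simp_all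
  obtain p where p: "p \<in> polys_over (K2 4)" "p \<noteq> 0" "poly p (edge_sq i j) = 0" "Polynomial.degree p \<le> 64"
    using degree_at_most_64[OF ij] by blast
  note Irr = Irr_degree[OF edge_sq_carrier[OF ij] p degree_at_least_64[OF ij]]
  show "ring.algebraic (edge_field n) (K2 n) (edge_sq i j)" unfolding n by (rule Irr(1))
  show "Polynomials.degree (ring.Irr (edge_field n) (K2 n) (edge_sq i j)) = 64" unfolding n by (rule Irr(2))
qed

end
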